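(* In the setting and notation of the context, suppose there exist $\lambda,\eta\in C(T)$ with $\eta\ge0$ such that $b^{(l)}(t)=\lambda(t)$ for all $t\in T$, $l\in\mathbb N_0$, and $a^{(l)}(t)=\eta(t)$ for all $t\in T$, $l\in\mathbb N$. Then, for each $f\in B_0(T)$, the action of $X(f)$ in $\mathbb F$ may be represented as $$X(f)=\int_T\sigma(dt)\,f(t)\,\omega(t),\qquad \omega(t)=\partial_t^\dagger+\lambda(t)\partial_t^\dagger\partial_t+\partial_t+\eta(t)\partial_t^\dagger\partial_t\partial_t,$$ i.e. on $\mathcal F_{\mathrm{fin}}(\mathcal D)\subset\mathbb F$, $X(f)$ equals the sum of the four smeared operators $\int_T\sigma(dt)f(t)\partial_t^\dagger$, $\int_T\sigma(dt)f(t)\lambda(t)\partial_t^\dagger\partial_t$, $\int_T\sigma(dt)f(t)\partial_t$ and $\int_T\sigma(dt)f(t)\eta(t)\partial_t^\dagger\partial_t\partial_t$.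
   Context: **Underlying space.** $T$ is a locally compact, second countable Hausdorff space without isolated points; $\mathcal B_0(T)$ is the family of relatively compact Borel sets. $\sigma$ is a Radon non-atomic measure on $T$ with $\sigma(O)>0$ for every non-empty open $O$. $\mathcal D^{(n)}=C_0(T^n)$ (real continuous, compact support), $\mathcal D=\mathcal D^{(1)}$, $\mathcal D^{(0)}=\mathbb R$; $B_0(T^n)$ denotes real bounded measurable functions with compact support. $\mathcal F_{\mathrm{fin}}(\mathcal D)$ is the set of finite sequences $(f^{(0)},\dots,f^{(n)},0,0,\dots)$ with $f^{(i)}\in\mathcal D^{(i)}$. **Smeared point operators.** $\partial_t$ is the annihilation operator at $t$: $\partial_t\Omega=0$, $(\partial_tg^{(n)})(t_1,\dots,t_{n-1})=g^{(n)}(t,t_1,\dots,t_{n-1})$ for $g^{(n)}\in\mathcal D^{(n)}$. $\partial_t^\dagger$ is, formally, creation of a delta function at $t$, given meaning through smearing: for a bounded measurable compactly supported $u$ and a family $t\mapsto h_t$ of functions of $k$ variables, $\big(\int_T\sigma(dt)u(t)\partial_t^\dagger h_t\big)(t_1,\dots,t_{k+1})=u(t_1)h_{t_1}(t_2,\dots,t_{k+1})$. Thus for $g^{(n)}\in\mathcal D^{(n)}$: $(\int\sigma(dt)u(t)\partial^\dagger_tg^{(n)})(t_1,\dots,t_{n+1})=u(t_1)g^{(n)}(t_2,\dots,t_{n+1})$; $(\int\sigma(dt)u(t)\partial_t^\dagger\partial_tg^{(n)})(t_1,\dots,t_n)=u(t_1)g^{(n)}(t_1,\dots,t_n)$ (zero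 for $n=0$); $(\int\sigma(dt)u(t)\partial_tg^{(n)})(t_1,\dots,t_{n-1})=\int_T\sigma(dt)u(t)g^{(n)}(t,t_1,\dots,t_{n-1})$ (zero for $n=0$); $(\int\sigma(dt)u(t)\partial_t^\dagger\partial_t\partial_tg^{(n)})(t_1,\dots,t_{n-1})=u(t_1)g^{(n)}(t_1,t_1,t_2,\dots,t_{n-1})$ (zero for $n\le1$). **The process.** For each $t\in T$, $\mu(t,\cdot)$ is a probability measure on $\mathbb R$; $t\mapsto\mu(t,A)$ is measurable for each Borel $A$; and for each $\Delta\in\mathcal B_0(T)$ there is $R=R(\Delta)>0$ such that $\mu(t,\cdot)$ is supported in $[-R,R]$ for all $t\in\Delta$. Put $\tilde T=T\times\mathbb R$, $\tilde\sigma(dt,ds)=\sigma(dt)\mu(t,ds)$, $\mathcal H=L^2(\tilde T,\tilde\sigma)$ (real), $\mathcal F(\mathcal H)=\mathbb R\oplus\bigoplus_{n\ge1}\mathcal H^{\otimes n}$ with vacuum $\Omega$. For $f\in B_0(T)$, $X(f)=a^+(f\otimes1)+a^-(f\otimes 1)+a^0(f\otimes s)$ on $\mathcal F(\mathcal H)$, where $(f\otimes s^l)(t,s)=f(t)s^l$, $a^+(h)g^{(n)}=h\otimes g^{(n)}$; $a^-(h)g_1\otimes\dots\otimes g_n=(h,g_1)_{\mathcal H}\,g_2\otimes\dots\otimes g_n$; $a^0(h)g_1\otimes\dots\otimes g_n=(hg_1)\otimes g_2\otimes\dots\otimes g_n$; $a^-(h)\Omega=a^0(h)\Omega=0$. **Jacobi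 coefficients.** For each $t$, $(p^{(n)}(t,\cdot))_{n\ge0}$ are the monic orthogonal polynomials of $\mu(t,\cdot)$, with $sp^{(n)}(t,s)=p^{(n+1)}(t,s)+b^{(n)}(t)p^{(n)}(t,s)+a^{(n)}(t)p^{(n-1)}(t,s)$, $n\in\mathbb N_0$, $p^{(-1)}:=0$. If $\mu(t,\cdot)$ is supported on exactly $N$ points, then $p^{(n)}(t,\cdot):=0$, $a^{(n)}(t):=0$ for $n\ge N$, and $b^{(n)}(t)$, $n\ge N$, may be chosen arbitrarily. **Free extended Fock space $\mathbb F$ and the realization of $X(f)$ in it.** Put $w_l(t)=\int\mu(t,ds)|p^{(l)}(t,s)|^2$, $\sigma^{(l)}(dt)=w_l(t)\sigma(dt)$. For $(l_1,\dots,l_i)\in\mathbb N_0^i$ with $l_1+\dots+l_i+i=n$, let $\gamma^{(l_1,\dots,l_i)}$ be the image of $\sigma^{(l_1)}\otimes\dots\otimes\sigma^{(l_i)}$ under $(t_1,\dots,t_i)\mapsto(t_1,\dots,t_1,\dots,t_i,\dots,t_i)\in T^n$ ($t_j$ repeated $l_j+1$ times), and $\gamma_n$ the sum of all these. $\mathbb F=\mathbb R\oplus\bigoplus_{n\ge1}L^2(T^n,\gamma_n)$, containing $\mathcal F_{\mathrm{fin}}(\mathcal D)$ as a dense subset. There is a unitary $K:\mathbb F\to\mathcal F(\mathcal H)$ determined by: $K$ maps $(1,0,0,\dots)$ to $\Omega$, and for $f^{(n)}\in\mathcal D^{(n)}$, $n\ge1$, $$Kf^{(n)}=\sum_{l_1+\dots+l_i+i=n}f^{(n)}(\underbrace{t_1,\dots,t_1}_{l_1+1},\dots,\underbrace{t_i,\dots,t_i}_{l_i+1})\,p^{(l_1)}(t_1,s_1)\cdots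 p^{(l_i)}(t_i,s_i),$$ the $(l_1,\dots,l_i)$ term lying in $\mathcal H^{\otimes i}$. The action of $X(f)$ in $\mathbb F$ means the operator $K^{-1}X(f)K$. Equalities in $\mathbb F$ are $\gamma_n$-a.e. *)

theory Defs
  imports "HOL-Probability.Probability"
begin

section \<open>Tuples, test functions and the underlying measure\<close>

text \<open>An \<open>n\<close>-tuple of points is an element of \<open>PiE {..<n} (\<lambda>_. UNIV)\<close>, the space underlying both
  \<open>PiM {..<n} _\<close> and \<open>product_topology _ {..<n}\<close>; coordinates are counted from 0. There is exactly one
  0-tuple, so functions of 0 variables are real numbers. A sequence of functions, the \<open>n\<close>-th one of
  \<open>n\<close> variables, has type \<open>'b fock\<close>; values outside \<open>PiE {..<n} (\<lambda>_. UNIV)\<close> never matter.\<close>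

type_synonym 'b fock = "nat \<Rightarrow> (nat \<Rightarrow> 'b) \<Rightarrow> real"

definition tuple_cons :: "nat \<Rightarrow> 'b \<Rightarrow> (nat \<Rightarrow> 'b) \<Rightarrow> nat \<Rightarrow> 'b" where
  "tuple_cons n y x = (\<lambda>k\<in>{..<Suc n}. case k of 0 \<Rightarrow> y | Suc j \<Rightarrow> x j)"

definition tuple_tail :: "nat \<Rightarrow> (nat \<Rightarrow> 'b) \<Rightarrow> nat \<Rightarrow> 'b" where
  "tuple_tail n x = (\<lambda>k\<in>{..<n}. x (Suc k))"

definition single :: "nat \<Rightarrow> ((nat \<Rightarrow> 'b) \<Rightarrow> real) \<Rightarrow> 'b fock" where
  "single n g = (\<lambda>m. if m = n then g else (\<lambda>_. 0))"

definition vacuum :: "'b fock" where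
  "vacuum = single 0 (\<lambda>_. 1)"

definition test_functions :: "nat \<Rightarrow> ((nat \<Rightarrow> 'a::topological_space) \<Rightarrow> real) set" where
  "test_functions n =
    (let X = product_topology (\<lambda>_. euclidean) {..<n}
     in {g. continuous_map X euclideanreal g \<and>
            compactin X (X closure_of {x \<in> topspace X. g x \<noteq> 0})})"

definition F_fin :: "('a::topological_space) fock set" where
  "F_fin = {F. (\<forall>n. F n \<in> test_functions n) \<and>
               (\<exists>N. \<forall>n>N. \<forall>x \<in> PiE {..<n} (\<lambda>_. UNIV). F n x = 0)}"

definition B0_functions :: "('a::topological_space \<Rightarrow> real) set" where
  "B0_functions = {f. f \<in> borel_measurable borel \<and> bounded (range f) \<and>
                      compact (closure {t. f t \<noteq> 0})}"

definition B0_sets :: "('a::topological_space) set set" where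
  "B0_sets = {D. D \<in> sets borel \<and> compact (closure D)}"

definition radon_measure :: "'a::topological_space measure \<Rightarrow> bool" where
  "radon_measure M \<longleftrightarrow> sets M = sets borel \<and>
     (\<forall>C. compact C \<longrightarrow> emeasure M C < \<infinity>) \<and>
     (\<forall>A\<in>sets M. emeasure M A = (SUP C\<in>{C. compact C \<and> C \<subseteq> A \<and> C \<in> sets M}. emeasure M C))"

definition non_atomic :: "'a measure \<Rightarrow> bool" where
  "non_atomic M \<longleftrightarrow> (\<forall>A\<in>sets M. 0 < emeasure M A \<longrightarrow>
     (\<exists>B\<in>sets M. B \<subseteq> A \<and> 0 < emeasure M B \<and> emeasure M B < emeasure M A))"

section \<open>Orthogonal sums of \<open>L\<^sup>2\<close> spaces\<close>

text \<open>Elements are given by representatives. \<open>hs_eq\<close> is equality in the Hilbert space, i.e. both sides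
  belong to the space and agree almost everywhere in every component.\<close>

definition hs :: "(nat \<Rightarrow> 'x measure) \<Rightarrow> (nat \<Rightarrow> 'x \<Rightarrow> real) set" where
  "hs M = {F. (\<forall>n. F n \<in> borel_measurable (M n) \<and> integrable (M n) (\<lambda>x. (F n x)\<^sup>2)) \<and>
              summable (\<lambda>n. \<integral>x. (F n x)\<^sup>2 \<partial>M n)}"

definition hs_inner :: "(nat \<Rightarrow> 'x measure) \<Rightarrow> (nat \<Rightarrow> 'x \<Rightarrow> real) \<Rightarrow> (nat \<Rightarrow> 'x \<Rightarrow> real) \<Rightarrow> real" where
  "hs_inner M F G = (\<Sum>n. \<integral>x. F n x * G n x \<partial>M n)"

definition hs_eq :: "(nat \<Rightarrow> 'x measure) \<Rightarrow> (nat \<Rightarrow> 'x \<Rightarrow> real) \<Rightarrow> (nat \<Rightarrow> 'x \<Rightarrow> real) \<Rightarrow> bool" where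
  "hs_eq M F G \<longleftrightarrow> F \<in> hs M \<and> G \<in> hs M \<and> (\<forall>n. AE x in M n. F n x = G n x)"

text \<open>Linearity together with preservation of inner products makes \<open>K\<close> compatible with \<open>hs_eq\<close>.\<close>

definition hs_unitary ::
  "(nat \<Rightarrow> 'x measure) \<Rightarrow> (nat \<Rightarrow> 'y measure) \<Rightarrow>
   ((nat \<Rightarrow> 'x \<Rightarrow> real) \<Rightarrow> (nat \<Rightarrow> 'y \<Rightarrow> real)) \<Rightarrow> bool" where
  "hs_unitary M N K \<longleftrightarrow>
     (\<forall>F\<in>hs M. K F \<in> hs N) \<and>
     (\<forall>F\<in>hs M. \<forall>G\<in>hs M. \<forall>c. hs_eq N (K (\<lambda>n x. c * F n x + G n x)) (\<lambda>n y. c * K F n y + K G n y)) \<and>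
     (\<forall>F\<in>hs M. \<forall>G\<in>hs M. hs_inner N (K F) (K G) = hs_inner M F G) \<and>
     (\<forall>G\<in>hs N. \<exists>F\<in>hs M. hs_eq N (K F) G)"

definition hs_inv ::
  "(nat \<Rightarrow> 'x measure) \<Rightarrow> (nat \<Rightarrow> 'y measure) \<Rightarrow>
   ((nat \<Rightarrow> 'x \<Rightarrow> real) \<Rightarrow> (nat \<Rightarrow> 'y \<Rightarrow> real)) \<Rightarrow> (nat \<Rightarrow> 'y \<Rightarrow> real) \<Rightarrow> (nat \<Rightarrow> 'x \<Rightarrow> real)" where
  "hs_inv M N K G = (SOME F. F \<in> hs M \<and> hs_eq N (K F) G)"

section \<open>The full Fock space and the process\<close>

definition sigma_tilde :: "'a::topological_space measure \<Rightarrow> ('a \<Rightarrow> real measure) \<Rightarrow> ('a \<times> real) measure" where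
  "sigma_tilde \<sigma> \<mu> =
     measure_of UNIV (sets (borel \<Otimes>\<^sub>M borel))
       (\<lambda>A. \<integral>\<^sup>+ t. (\<integral>\<^sup>+ s. indicator A (t, s) \<partial>\<mu> t) \<partial>\<sigma>)"

text \<open>The \<open>n\<close>-th tensor power of \<open>L\<^sup>2(M)\<close> is realised as \<open>L\<^sup>2\<close> of the \<open>n\<close>-fold product of \<open>M\<close>, the tensor
  product of functions being the pointwise product in separate variables.\<close>

definition full_fock :: "'b measure \<Rightarrow> nat \<Rightarrow> (nat \<Rightarrow> 'b) measure" where
  "full_fock M n = PiM {..<n} (\<lambda>_. M)"

definition simple_tensor :: "nat \<Rightarrow> (nat \<Rightarrow> 'b \<Rightarrow> real) \<Rightarrow> (nat \<Rightarrow> 'b) \<Rightarrow> real" where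
  "simple_tensor n g x = (\<Prod>j<n. g j (x j))"

definition a_plus :: "('b \<Rightarrow> real) \<Rightarrow> 'b fock \<Rightarrow> 'b fock" where
  "a_plus h G = (\<lambda>m x. case m of 0 \<Rightarrow> 0 | Suc n \<Rightarrow> h (x 0) * G n (tuple_tail n x))"

definition a_minus :: "'b measure \<Rightarrow> ('b \<Rightarrow> real) \<Rightarrow> 'b fock \<Rightarrow> 'b fock" where
  "a_minus M h G = (\<lambda>n x. \<integral>y. h y * G (Suc n) (tuple_cons n y x) \<partial>M)"

definition a_zero :: "('b \<Rightarrow> real) \<Rightarrow> 'b fock \<Rightarrow> 'b fock" where
  "a_zero h G = (\<lambda>m x. case m of 0 \<Rightarrow> 0 | Suc n \<Rightarrow> h (x 0) * G (Suc n) x)"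

text \<open>The values on simple tensors and on the vacuum; they determine \<open>a_minus\<close> and \<open>a_zero\<close> as continuous
  linear operators on the Fock space (for square integrable, respectively bounded \<open>h\<close>).\<close>

lemma a_plus_single:
  "a_plus h (single n g) (Suc n) x = h (x 0) * g (tuple_tail n x)"
  "m \<noteq> Suc n \<Longrightarrow> a_plus h (single n g) m x = 0"
  by (auto simp: a_plus_def single_def split: nat.splits)

lemma a_minus_simple_tensor:
  "a_minus M h (single (Suc n) (simple_tensor (Suc n) g)) =
     single n (\<lambda>x. (\<integral>y. h y * g 0 y \<partial>M) * simple_tensor n (\<lambda>j. g (Suc j)) x)"
proof -
  have "simple_tensor (Suc n) g (tuple_cons n y x) = g 0 y * simple_tensor n (\<lambda>j. g (Suc j)) x"
    for x :: "nat \<Rightarrow> 'a" and y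
    by (simp add: simple_tensor_def tuple_cons_def prod.lessThan_Suc_shift del: prod.lessThan_Suc)
  then have "(\<integral>y. h y * simple_tensor (Suc n) g (tuple_cons n y x) \<partial>M) =
      (\<integral>y. h y * g 0 y \<partial>M) * simple_tensor n (\<lambda>j. g (Suc j)) x" for x :: "nat \<Rightarrow> 'a"
    by (simp flip: mult.assoc)
  then show ?thesis
    by (intro ext) (simp add: a_minus_def single_def)
qed

lemma a_zero_simple_tensor:
  "a_zero h (single (Suc n) (simple_tensor (Suc n) g)) =
     single (Suc n) (simple_tensor (Suc n) (g(0 := \<lambda>y. h y * g 0 y)))"
  by (intro ext)
     (simp add: a_zero_def single_def simple_tensor_def prod.lessThan_Suc_shift
        split: nat.splits del: prod.lessThan_Suc)

lemma a_minus_vacuum: "a_minus M h vacuum = (\<lambda>_ _. 0)"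
  by (intro ext) (simp add: a_minus_def vacuum_def single_def)

lemma a_zero_vacuum: "a_zero h vacuum = (\<lambda>_ _. 0)"
  by (intro ext) (simp add: a_zero_def vacuum_def single_def split: nat.splits)

definition X_op :: "('a \<times> real) measure \<Rightarrow> ('a \<Rightarrow> real) \<Rightarrow> ('a \<times> real) fock \<Rightarrow> ('a \<times> real) fock" where
  "X_op M f G = (\<lambda>n x. a_plus (\<lambda>(t, s). f t) G n x + a_minus M (\<lambda>(t, s). f t) G n x
                        + a_zero (\<lambda>(t, s). f t * s) G n x)"

section \<open>Orthogonal polynomials\<close>

definition supported_on_exactly :: "real measure \<Rightarrow> nat \<Rightarrow> bool" where
  "supported_on_exactly M N \<longleftrightarrow>
     (\<exists>S. finite S \<and> card S = N \<and> (AE s in M. s \<in> S) \<and> (\<forall>s\<in>S. 0 < emeasure M {s}))"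

definition monic_orthogonal :: "real measure \<Rightarrow> (nat \<Rightarrow> real poly) \<Rightarrow> bool" where
  "monic_orthogonal M p \<longleftrightarrow>
     (\<forall>n. if \<exists>N\<le>n. supported_on_exactly M N then p n = 0
          else degree (p n) = n \<and> lead_coeff (p n) = 1 \<and>
               (\<forall>m<n. (\<integral>s. poly (p n) s * poly (p m) s \<partial>M) = 0))"

text \<open>The recurrence is an identity in \<open>L\<^sup>2(M)\<close>: if \<open>M\<close> is supported on exactly \<open>N\<close> points, then it fails
  for \<open>n = N - 1\<close> as an identity of polynomials, because \<open>p N = 0\<close>. If the support of \<open>M\<close> is infinite, it
  is an identity of polynomials.\<close>

definition jacobi_coefficients ::
  "real measure \<Rightarrow> (nat \<Rightarrow> real poly) \<Rightarrow> (nat \<Rightarrow> real) \<Rightarrow> (nat \<Rightarrow> real) \<Rightarrow> bool" where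
  "jacobi_coefficients M p a b \<longleftrightarrow>
     (\<forall>n. AE s in M. s * poly (p n) s =
        poly (p (Suc n)) s + b n * poly (p n) s + (case n of 0 \<Rightarrow> 0 | Suc k \<Rightarrow> a n * poly (p k) s)) \<and>
     (\<forall>N n. supported_on_exactly M N \<longrightarrow> N \<le> n \<longrightarrow> a n = 0)"

section \<open>The free extended Fock space\<close>

definition compositions :: "nat \<Rightarrow> nat list set" where
  "compositions n = {ls. sum_list ls + length ls = n}"

definition diag :: "nat list \<Rightarrow> (nat \<Rightarrow> 'a) \<Rightarrow> nat \<Rightarrow> 'a" where
  "diag ls x = (\<lambda>k\<in>{..<sum_list ls + length ls}.
     concat (map (\<lambda>j. replicate (ls ! j + 1) (x j)) [0..<length ls]) ! k)"

definition sigma_l ::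
  "'a measure \<Rightarrow> ('a \<Rightarrow> real measure) \<Rightarrow> (nat \<Rightarrow> 'a \<Rightarrow> real poly) \<Rightarrow> nat \<Rightarrow> 'a measure" where
  "sigma_l \<sigma> \<mu> p l = density \<sigma> (\<lambda>t. ennreal (\<integral>s. \<bar>poly (p l t) s\<bar>\<^sup>2 \<partial>\<mu> t))"

definition gamma_list ::
  "'a::topological_space measure \<Rightarrow> ('a \<Rightarrow> real measure) \<Rightarrow> (nat \<Rightarrow> 'a \<Rightarrow> real poly) \<Rightarrow> nat list \<Rightarrow>
   (nat \<Rightarrow> 'a) measure" where
  "gamma_list \<sigma> \<mu> p ls =
     distr (PiM {..<length ls} (\<lambda>j. sigma_l \<sigma> \<mu> p (ls ! j)))
       (PiM {..<sum_list ls + length ls} (\<lambda>_. borel)) (diag ls)"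

text \<open>For \<open>n = 0\<close> only the empty composition occurs, and the result is the unit mass at the unique 0-tuple.\<close>

definition gamma ::
  "'a::topological_space measure \<Rightarrow> ('a \<Rightarrow> real measure) \<Rightarrow> (nat \<Rightarrow> 'a \<Rightarrow> real poly) \<Rightarrow> nat \<Rightarrow>
   (nat \<Rightarrow> 'a) measure" where
  "gamma \<sigma> \<mu> p n =
     measure_of (PiE {..<n} (\<lambda>_. UNIV)) (sets (PiM {..<n} (\<lambda>_. borel)))
       (\<lambda>A. \<Sum>ls\<in>compositions n. emeasure (gamma_list \<sigma> \<mu> p ls) A)"

text \<open>Component \<open>i\<close> collects all compositions of length \<open>i\<close>.\<close>

definition K_image ::
  "(nat \<Rightarrow> 'a \<Rightarrow> real poly) \<Rightarrow> nat \<Rightarrow> ((nat \<Rightarrow> 'a) \<Rightarrow> real) \<Rightarrow> ('a \<times> real) fock" where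
  "K_image p n g = (\<lambda>i x. \<Sum>ls | ls \<in> compositions n \<and> length ls = i.
     g (diag ls (\<lambda>j. fst (x j))) * (\<Prod>j<i. poly (p (ls ! j) (fst (x j))) (snd (x j))))"

definition is_K ::
  "'a::topological_space measure \<Rightarrow> ('a \<Rightarrow> real measure) \<Rightarrow> (nat \<Rightarrow> 'a \<Rightarrow> real poly) \<Rightarrow>
   ('a fock \<Rightarrow> ('a \<times> real) fock) \<Rightarrow> bool" where
  "is_K \<sigma> \<mu> p K \<longleftrightarrow>
     hs_unitary (gamma \<sigma> \<mu> p) (full_fock (sigma_tilde \<sigma> \<mu>)) K \<and>
     hs_eq (full_fock (sigma_tilde \<sigma> \<mu>)) (K vacuum) vacuum \<and>
     (\<forall>n\<ge>1. \<forall>g\<in>test_functions n.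
        hs_eq (full_fock (sigma_tilde \<sigma> \<mu>)) (K (single n g)) (K_image p n g))"

section \<open>Smeared point operators\<close>

definition point_annihilation :: "'a \<Rightarrow> 'a fock \<Rightarrow> 'a fock" where
  "point_annihilation t F = (\<lambda>n x. F (Suc n) (tuple_cons n t x))"

text \<open>\<open>smeared_creation u h\<close> is the integral of \<open>u(t) \<partial>\<^sub>t\<^sup>\<dagger> h\<^sub>t\<close> against \<open>\<sigma>(dt)\<close>.\<close>

definition smeared_creation :: "('a \<Rightarrow> real) \<Rightarrow> ('a \<Rightarrow> 'a fock) \<Rightarrow> 'a fock" where
  "smeared_creation u h =
     (\<lambda>m x. case m of 0 \<Rightarrow> 0 | Suc k \<Rightarrow> u (x 0) * h (x 0) k (tuple_tail k x))"

definition smeared_annihilation :: "'a measure \<Rightarrow> ('a \<Rightarrow> real) \<Rightarrow> 'a fock \<Rightarrow> 'a fock" where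
  "smeared_annihilation \<sigma> u F = (\<lambda>n x. \<integral>t. u t * point_annihilation t F n x \<partial>\<sigma>)"

end

theory Submission
  imports Defs
begin

text \<open>The isomorphism \<open>K\<close> carries a sequence \<open>F\<close> of continuous functions to an explicit sum over
  compositions. If the same formula held for the sequence \<open>G\<close> obtained from \<open>F\<close> by the four smeared
  operators, the claim would be the pointwise identity \<open>X(f) (K F) = K G\<close>, since \<open>K\<close> is injective.
  Two things have to be shown: the formula for \<open>K\<close> on sequences such as \<open>G\<close>, and this identity.

  The function \<open>f\<close> is only bounded and measurable, so \<open>G\<close> is not a sequence of continuous functions.
  Its components are bounded, measurable and of compact support (\<open>B0_tuples\<close>). On such
  functions the formula for \<open>K\<close> follows by a monotone class argument (\<open>B0_tuples_induct\<close>): the measures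
  \<open>\<gamma>\<^sub>n\<close> are finite on compact cubes, so bounded pointwise convergence implies convergence in \<open>L\<^sup>2(\<gamma>\<^sub>n)\<close>; the
  isometry \<open>K\<close> turns it into convergence in the Fock space, and the formula is continuous under
  pointwise convergence (\<open>hs_unitary_limit\<close>, \<open>K_single\<close>). Finiteness on cubes rests on
  \<open>\<integral> |p\<^sup>(\<^sup>l\<^sup>)(t, s)|\<^sup>2 \<mu>(t, ds) = \<eta>(t)\<^sup>l\<close>, a continuous function of \<open>t\<close> (\<open>norm_p\<close>).

  For the identity, split off the first entry of a composition (\<open>K_formula_Suc\<close>). If \<open>Y\<^sub>l\<close> is the formula for
  \<open>\<partial>\<^sub>t\<^sup>l F\<close> in the remaining variables, then the formula for \<open>F\<close> is \<open>\<Sum>\<^sub>l p\<^sup>(\<^sup>l\<^sup>)(t, s) Y\<^sub>l\<^sub>+\<^sub>1\<close>, and a sequence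
  \<open>\<integral> u(t) \<partial>\<^sub>t\<^sup>\<dagger> h\<^sub>t \<sigma>(dt)\<close> gives \<open>u(t) \<Sum>\<^sub>l p\<^sup>(\<^sup>l\<^sup>)(t, s) Y'\<^sub>l\<close> with \<open>Y'\<^sub>l\<close> the formula for \<open>\<partial>\<^sub>t\<^sup>l h\<^sub>t\<close>. Multiplication by \<open>s\<close> and the three-term
  recurrence therefore produce the number operator from \<open>b = \<lambda>\<close> and the double annihilation from \<open>a = \<eta>\<close>;
  the shift \<open>p\<^sup>(\<^sup>l\<^sup>) \<mapsto> p\<^sup>(\<^sup>l\<^sup>+\<^sup>1\<^sup>)\<close> together with the creation operator, which supplies the
  term with \<open>p\<^sup>(\<^sup>0\<^sup>) = 1\<close>, makes up the smeared creation (\<open>sum_recurrence_shift\<close>). In the annihilation part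
  the integral over \<open>s\<close> kills every \<open>p\<^sup>(\<^sup>l\<^sup>)\<close> with \<open>l \<ge> 1\<close> (\<open>integral_rho_p\<close>).

  Fubini's theorem needs \<open>p\<^sup>(\<^sup>l\<^sup>)\<close> to be jointly measurable. The measure \<open>\<mu>(t, \<cdot>)\<close> is either the
  point mass at \<open>\<lambda>(t)\<close> or has infinite support, and in the second case the recurrence is an identity
  of polynomials with continuous coefficients (\<open>measurable_p\<close>).\<close>

section \<open>Orthogonal sums of spaces of square integrable functions\<close>

lemma hsD:
  assumes "F \<in> hs M"
  shows "F n \<in> borel_measurable (M n)" "integrable (M n) (\<lambda>x. (F n x)\<^sup>2)"
    "summable (\<lambda>n. \<integral>x. (F n x)\<^sup>2 \<partial>M n)"
  using assms by (auto simp: hs_def)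

lemma integrable_square_lincomb:
  fixes f g :: "'x \<Rightarrow> real"
  assumes [measurable]: "f \<in> borel_measurable M" "g \<in> borel_measurable M"
    and "integrable M (\<lambda>x. (f x)\<^sup>2)" "integrable M (\<lambda>x. (g x)\<^sup>2)"
  shows "integrable M (\<lambda>x. (c * f x + g x)\<^sup>2)"
    and "(\<integral>x. (c * f x + g x)\<^sup>2 \<partial>M) \<le> 2 * c\<^sup>2 * (\<integral>x. (f x)\<^sup>2 \<partial>M) + 2 * (\<integral>x. (g x)\<^sup>2 \<partial>M)"
proof -
  have b: "(c * f x + g x)\<^sup>2 \<le> 2 * c\<^sup>2 * (f x)\<^sup>2 + 2 * (g x)\<^sup>2" for x
    using sum_squares_bound[of "c * f x" "g x"] by (simp add: power2_sum power_mult_distrib)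
  have i: "integrable M (\<lambda>x. 2 * c\<^sup>2 * (f x)\<^sup>2 + 2 * (g x)\<^sup>2)"
    using assms by (intro Bochner_Integration.integrable_add integrable_mult_right) auto
  show 1: "integrable M (\<lambda>x. (c * f x + g x)\<^sup>2)"
    by (rule Bochner_Integration.integrable_bound[OF i])
       (use b in \<open>auto intro!: order_trans[OF _ abs_ge_self]\<close>)
  show "(\<integral>x. (c * f x + g x)\<^sup>2 \<partial>M) \<le> 2 * c\<^sup>2 * (\<integral>x. (f x)\<^sup>2 \<partial>M) + 2 * (\<integral>x. (g x)\<^sup>2 \<partial>M)"
    using integral_mono[OF 1 i b] assms(3,4) by simp
qed

lemma hs_lincomb:
  assumes F: "F \<in> hs M" and G: "G \<in> hs M"
  shows "(\<lambda>n x. c * F n x + G n x) \<in> hs M"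
proof -
  note [measurable] = hsD(1)[OF F] hsD(1)[OF G]
  have "summable (\<lambda>n. \<integral>x. (c * F n x + G n x)\<^sup>2 \<partial>M n)"
  proof (rule summable_comparison_test')
    show "summable (\<lambda>n. 2 * c\<^sup>2 * (\<integral>x. (F n x)\<^sup>2 \<partial>M n) + 2 * (\<integral>x. (G n x)\<^sup>2 \<partial>M n))"
      by (intro summable_add summable_mult hsD(3)[OF F] hsD(3)[OF G])
  qed (use integrable_square_lincomb(2)[OF hsD(1)[OF F] hsD(1)[OF G] hsD(2)[OF F] hsD(2)[OF G]] in auto)
  then show ?thesis
    using integrable_square_lincomb(1)[OF hsD(1)[OF F] hsD(1)[OF G] hsD(2)[OF F] hsD(2)[OF G]]
    by (auto simp: hs_def)
qed

lemma hs_zero: "(\<lambda>_ _. 0) \<in> hs M"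
  by (simp add: hs_def)

lemma hs_diff: "F \<in> hs M \<Longrightarrow> G \<in> hs M \<Longrightarrow> (\<lambda>n x. F n x - G n x) \<in> hs M"
  using hs_lincomb[of G M F "-1"] by simp

lemma hs_cong_AE:
  assumes F: "F \<in> hs M" and [measurable]: "\<And>n. G n \<in> borel_measurable (M n)"
    and ae: "\<And>n. AE x in M n. F n x = G n x"
  shows "hs_eq M F G"
proof -
  note [measurable] = hsD(1)[OF F]
  have "integrable (M n) (\<lambda>x. (G n x)\<^sup>2)" for n
  proof (rule integrable_cong_AE_imp[OF hsD(2)[OF F]])
    show "AE x in M n. (F n x)\<^sup>2 = (G n x)\<^sup>2"
      using ae[of n] by eventually_elim simp
  qed simp
  moreover have "(\<integral>x. (G n x)\<^sup>2 \<partial>M n) = (\<integral>x. (F n x)\<^sup>2 \<partial>M n)" for n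
    by (rule integral_cong_AE) (use ae[of n] in auto)
  ultimately have "G \<in> hs M"
    using hsD(3)[OF F] by (auto simp: hs_def)
  then show ?thesis using F ae by (auto simp: hs_eq_def)
qed

lemma hs_eq_refl: "F \<in> hs M \<Longrightarrow> hs_eq M F F"
  by (simp add: hs_eq_def)

lemma hs_eq_sym: "hs_eq M F G \<Longrightarrow> hs_eq M G F"
  unfolding hs_eq_def by (auto elim!: allE eventually_mono)

lemma hs_eq_trans: "hs_eq M F G \<Longrightarrow> hs_eq M G H \<Longrightarrow> hs_eq M F H"
  unfolding hs_eq_def
proof safe
  fix n assume "\<forall>n. AE x in M n. F n x = G n x" "\<forall>n. AE x in M n. G n x = H n x"
  then have "AE x in M n. F n x = G n x" "AE x in M n. G n x = H n x" by auto
  then show "AE x in M n. F n x = H n x" by eventually_elim simp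
qed

lemma hs_eq_lincomb:
  assumes "hs_eq M F F'" "hs_eq M G G'"
  shows "hs_eq M (\<lambda>n x. c * F n x + G n x) (\<lambda>n x. c * F' n x + G' n x)"
  unfolding hs_eq_def
proof (intro conjI allI)
  fix n
  from assms have "AE x in M n. F n x = F' n x" "AE x in M n. G n x = G' n x"
    by (auto simp: hs_eq_def)
  then show "AE x in M n. c * F n x + G n x = c * F' n x + G' n x"
    by eventually_elim simp
qed (use assms in \<open>auto simp: hs_eq_def intro: hs_lincomb\<close>)

lemma hs_component_norm_le:
  assumes "F \<in> hs M"
  shows "(\<integral>x. (F n x)\<^sup>2 \<partial>M n) \<le> hs_inner M F F"
  using sum_le_suminf[OF hsD(3)[OF assms], of "{n}"] by (simp add: hs_inner_def power2_eq_square)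

lemma hs_inner_cong:
  assumes "hs_eq M F F'"
  shows "hs_inner M F F = hs_inner M F' F'"
proof -
  have [measurable]: "\<And>n. F n \<in> borel_measurable (M n)" "\<And>n. F' n \<in> borel_measurable (M n)"
    using assms by (auto simp: hs_eq_def hsD)
  have "(\<integral>x. F n x * F n x \<partial>M n) = (\<integral>x. F' n x * F' n x \<partial>M n)" for n
    using assms by (intro integral_cong_AE) (auto simp: hs_eq_def elim!: allE[of _ n])
  then show ?thesis by (simp add: hs_inner_def)
qed

text \<open>Almost everywhere equality is expressed by a norm because norms are what unitary maps preserve.\<close>

lemma hs_eq_iff_norm_diff:
  assumes F: "F \<in> hs M" and G: "G \<in> hs M"
  shows "hs_eq M F G \<longleftrightarrow> hs_inner M (\<lambda>n x. F n x - G n x) (\<lambda>n x. F n x - G n x) = 0"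
    (is "_ \<longleftrightarrow> hs_inner M ?D ?D = 0")
proof
  assume e: "hs_eq M F G"
  have "hs_eq M ?D (\<lambda>_ _. 0)"
    using hs_eq_lincomb[OF hs_eq_sym[OF e] hs_eq_refl[OF F], of "-1"] e
    by (intro hs_cong_AE hs_diff F G) (auto simp: hs_eq_def)
  from hs_inner_cong[OF this] show "hs_inner M ?D ?D = 0" by (simp add: hs_inner_def)
next
  assume z: "hs_inner M ?D ?D = 0"
  have D: "?D \<in> hs M" by (intro hs_diff F G)
  have "AE x in M n. F n x = G n x" for n
  proof -
    have "(\<integral>x. (?D n x)\<^sup>2 \<partial>M n) = 0"
      using hs_component_norm_le[OF D, of n] z
      by (intro antisym) (auto intro!: integral_nonneg_AE)
    with integral_nonneg_eq_0_iff_AE[OF hsD(2)[OF D, of n]] show ?thesis by auto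
  qed
  with F G show "hs_eq M F G" by (simp add: hs_eq_def)
qed

subsection \<open>Unitary maps\<close>

lemma hs_unitaryD:
  assumes "hs_unitary M N K"
  shows "F \<in> hs M \<Longrightarrow> K F \<in> hs N"
    and "F \<in> hs M \<Longrightarrow> G \<in> hs M \<Longrightarrow>
      hs_eq N (K (\<lambda>n x. c * F n x + G n x)) (\<lambda>n y. c * K F n y + K G n y)"
    and "F \<in> hs M \<Longrightarrow> G \<in> hs M \<Longrightarrow> hs_inner N (K F) (K G) = hs_inner M F G"
  using assms by (auto simp: hs_unitary_def)

lemma hs_unitary_norm_diff:
  assumes K: "hs_unitary M N K" and F: "F \<in> hs M" and G: "G \<in> hs M"
  shows "hs_inner N (\<lambda>n y. K F n y - K G n y) (\<lambda>n y. K F n y - K G n y) =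
    hs_inner M (\<lambda>n x. F n x - G n x) (\<lambda>n x. F n x - G n x)"
  using hs_inner_cong[OF hs_unitaryD(2)[OF K G F, of "-1"]]
    hs_unitaryD(3)[OF K hs_diff[OF F G] hs_diff[OF F G]] by simp

lemma hs_unitary_eq_iff:
  assumes K: "hs_unitary M N K" and F: "F \<in> hs M" and G: "G \<in> hs M"
  shows "hs_eq N (K F) (K G) \<longleftrightarrow> hs_eq M F G"
  using hs_unitary_norm_diff[OF assms] hs_eq_iff_norm_diff[OF F G]
    hs_eq_iff_norm_diff[OF hs_unitaryD(1)[OF K F] hs_unitaryD(1)[OF K G]] by simp

lemma hs_unitary_cong:
  assumes "hs_unitary M N K" "hs_eq M F G"
  shows "hs_eq N (K F) (K G)"
  using assms hs_unitary_eq_iff by (metis hs_eq_def)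

lemma hs_inv_eqI:
  assumes K: "hs_unitary M N K" and F: "F \<in> hs M" and e: "hs_eq N (K F) G"
  shows "hs_eq M (hs_inv M N K G) F"
proof -
  let ?F' = "hs_inv M N K G"
  have "?F' \<in> hs M \<and> hs_eq N (K ?F') G"
    unfolding hs_inv_def using someI[of "\<lambda>F. F \<in> hs M \<and> hs_eq N (K F) G" F] F e by blast
  then have F': "?F' \<in> hs M" and e': "hs_eq N (K ?F') G" by auto
  from hs_eq_trans[OF e' hs_eq_sym[OF e]] show ?thesis
    by (simp add: hs_unitary_eq_iff[OF K F' F])
qed

text \<open>A formula for \<open>K\<close> passes from a dense set to limits as soon as it is continuous under pointwise
  convergence: \<open>K H\<^sub>k\<close> tends to \<open>K H\<close> in square mean because \<open>K\<close> is an isometry, and Fatou's lemma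
  identifies the limit in square mean with the pointwise limit.\<close>

lemma hs_unitary_limit:
  assumes K: "hs_unitary M N K" and Hk: "\<And>k. H k \<in> hs M" and H: "G \<in> hs M"
    and lim: "(\<lambda>k. hs_inner M (\<lambda>n x. H k n x - G n x) (\<lambda>n x. H k n x - G n x)) \<longlonglongrightarrow> 0"
    and J: "\<And>k. hs_eq N (K (H k)) (J k)"
    and pt: "\<And>n y. y \<in> space (N n) \<Longrightarrow> (\<lambda>k. J k n y) \<longlonglongrightarrow> L n y"
  shows "hs_eq N (K G) L"
proof (rule hs_cong_AE)
  show KG: "K G \<in> hs N" by (rule hs_unitaryD(1)[OF K H])
  have Jhs: "J k \<in> hs N" for k using J by (auto simp: hs_eq_def)
  note [measurable] = hsD(1)[OF KG] hsD(1)[OF Jhs]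
  show L[measurable]: "L n \<in> borel_measurable (N n)" for n
    by (rule borel_measurable_LIMSEQ_real[where u = "\<lambda>k. J k n"]) (auto intro: pt)
  fix n
  have bound: "(\<integral>\<^sup>+y. ennreal ((J k n y - K G n y)\<^sup>2) \<partial>N n)
      \<le> ennreal (hs_inner M (\<lambda>n x. H k n x - G n x) (\<lambda>n x. H k n x - G n x))" for k
  proof -
    have D: "(\<lambda>n y. J k n y - K G n y) \<in> hs N" by (intro hs_diff Jhs KG)
    have "hs_eq N (\<lambda>n y. J k n y - K G n y) (\<lambda>n y. K (H k) n y - K G n y)"
      using hs_eq_lincomb[OF hs_eq_refl[OF KG] hs_eq_sym[OF J[of k]], of "-1"] by simp
    from hs_inner_cong[OF this] have
      "hs_inner N (\<lambda>n y. J k n y - K G n y) (\<lambda>n y. J k n y - K G n y)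
        = hs_inner M (\<lambda>n x. H k n x - G n x) (\<lambda>n x. H k n x - G n x)"
      by (simp add: hs_unitary_norm_diff[OF K Hk H])
    then show ?thesis
      using hs_component_norm_le[OF D, of n] hsD(2)[OF D, of n]
      by (subst nn_integral_eq_integral) (auto intro!: ennreal_leI)
  qed
  have "(\<integral>\<^sup>+y. ennreal ((L n y - K G n y)\<^sup>2) \<partial>N n)
      = (\<integral>\<^sup>+y. liminf (\<lambda>k. ennreal ((J k n y - K G n y)\<^sup>2)) \<partial>N n)"
    by (intro nn_integral_cong lim_imp_Liminf[symmetric] tendsto_ennrealI tendsto_power
        tendsto_diff tendsto_const pt) auto
  also have "\<dots> \<le> liminf (\<lambda>k. \<integral>\<^sup>+y. ennreal ((J k n y - K G n y)\<^sup>2) \<partial>N n)"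
    by (rule nn_integral_liminf) simp
  also have "\<dots> \<le> liminf (\<lambda>k. ennreal (hs_inner M (\<lambda>n x. H k n x - G n x) (\<lambda>n x. H k n x - G n x)))"
    by (rule Liminf_mono) (use bound in auto)
  also have "\<dots> = 0"
    using tendsto_ennrealI[OF lim] by (simp add: lim_imp_Liminf)
  finally have "(\<integral>\<^sup>+y. ennreal ((L n y - K G n y)\<^sup>2) \<partial>N n) = 0" by simp
  then have "AE y in N n. ennreal ((L n y - K G n y)\<^sup>2) = 0"
    by (subst (asm) nn_integral_0_iff_AE) auto
  then show "AE y in N n. K G n y = L n y"
    by eventually_elim (auto simp: ennreal_eq_0_iff)
qed

lemma single_in_hs:
  assumes "g \<in> borel_measurable (M n)" "integrable (M n) (\<lambda>x. (g x)\<^sup>2)"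
  shows "single n g \<in> hs M"
proof -
  have "summable (\<lambda>m. \<integral>x. (single n g m x)\<^sup>2 \<partial>M m)"
    by (rule summable_finite[of "{n}"]) (auto simp: single_def)
  with assms show ?thesis by (auto simp: hs_def single_def)
qed

lemma hs_inner_single_diff:
  "hs_inner M (\<lambda>m x. single n g m x - single n h m x) (\<lambda>m x. single n g m x - single n h m x)
    = (\<integral>x. (g x - h x)\<^sup>2 \<partial>M n)"
proof -
  have "hs_inner M (\<lambda>m x. single n g m x - single n h m x) (\<lambda>m x. single n g m x - single n h m x)
    = (\<Sum>m\<in>{n}. \<integral>x. (single n g m x - single n h m x) * (single n g m x - single n h m x) \<partial>M m)"
    unfolding hs_inner_def by (rule suminf_finite) (auto simp: single_def)
  then show ?thesis by (simp add: single_def power2_eq_square)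
qed


section \<open>Tuples\<close>

lemma tuple_cons_0 [simp]: "tuple_cons n y x 0 = y"
  by (simp add: tuple_cons_def)

lemma tuple_cons_Suc: "j < n \<Longrightarrow> tuple_cons n y x (Suc j) = x j"
  by (simp add: tuple_cons_def)

lemma tuple_cons_PiE: "tuple_cons n y x \<in> PiE {..<Suc n} (\<lambda>_. UNIV)"
  by (auto simp: tuple_cons_def)

lemma tuple_tail_PiE: "tuple_tail n x \<in> PiE {..<n} (\<lambda>_. UNIV)"
  by (auto simp: tuple_tail_def)

lemma tuple_tail_cons: "tuple_tail n (tuple_cons n y x) = restrict x {..<n}"
  by (auto simp: tuple_tail_def tuple_cons_def fun_eq_iff)

lemma tuple_tail_cons_PiE [simp]:
  "x \<in> PiE {..<n} (\<lambda>_. UNIV) \<Longrightarrow> tuple_tail n (tuple_cons n y x) = x"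
  by (simp add: tuple_tail_cons PiE_restrict)

lemma tuple_cons_tail:
  assumes "x \<in> PiE {..<Suc n} (\<lambda>_. UNIV)"
  shows "tuple_cons n (x 0) (tuple_tail n x) = x"
proof
  fix k show "tuple_cons n (x 0) (tuple_tail n x) k = x k"
    using assms PiE_arb[OF assms, of k]
    by (cases k) (auto simp: tuple_tail_def tuple_cons_def)
qed

lemma measurable_tuple_cons [measurable (raw)]:
  assumes f: "f \<in> N \<rightarrow>\<^sub>M M" and g: "g \<in> N \<rightarrow>\<^sub>M PiM {..<n} (\<lambda>_. M)"
  shows "(\<lambda>z. tuple_cons n (f z) (g z)) \<in> N \<rightarrow>\<^sub>M PiM {..<Suc n} (\<lambda>_. M)"
  unfolding tuple_cons_def
proof (rule measurable_restrict)
  fix k assume k: "k \<in> {..<Suc n}"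
  show "(\<lambda>z. case k of 0 \<Rightarrow> f z | Suc j \<Rightarrow> g z j) \<in> N \<rightarrow>\<^sub>M M"
    using k f by (cases k) (auto intro!: measurable_compose[OF g measurable_component_singleton])
qed

lemma measurable_tuple_tail [measurable (raw)]:
  assumes "g \<in> N \<rightarrow>\<^sub>M PiM {..<Suc n} (\<lambda>_. M)"
  shows "(\<lambda>z. tuple_tail n (g z)) \<in> N \<rightarrow>\<^sub>M PiM {..<n} (\<lambda>_. M)"
  unfolding tuple_tail_def
  by (intro measurable_restrict measurable_compose[OF assms measurable_component_singleton]) auto

lemma measurable_tuple_head: "(\<lambda>x. x 0) \<in> PiM {..<Suc n} (\<lambda>_. M) \<rightarrow>\<^sub>M M"
  by (rule measurable_component_singleton) simp

text \<open>Splitting off the first coordinate is an isomorphism of product measures; it carries Fubini's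
  theorem over to tuples.\<close>

lemma PiM_Suc_eq_distr_cons:
  assumes "sigma_finite_measure M"
  shows "PiM {..<Suc n} (\<lambda>_. M) =
    distr (PiM {..<n} (\<lambda>_. M) \<Otimes>\<^sub>M M) (PiM {..<Suc n} (\<lambda>_. M)) (\<lambda>(x, y). tuple_cons n y x)"
proof (rule sym)
  interpret sigma_finite_measure M by fact
  interpret P: product_sigma_finite "\<lambda>_::nat. M" by unfold_locales
  interpret I: finite_product_sigma_finite "\<lambda>_::nat. M" "{..<n}" by unfold_locales simp
  interpret Q: pair_sigma_finite "PiM {..<n} (\<lambda>_. M)" M by unfold_locales
  show "distr (PiM {..<n} (\<lambda>_. M) \<Otimes>\<^sub>M M) (PiM {..<Suc n} (\<lambda>_. M)) (\<lambda>(x, y). tuple_cons n y x)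
      = PiM {..<Suc n} (\<lambda>_. M)"
  proof (rule P.PiM_eqI)
    fix A assume A: "\<And>i. i \<in> {..<Suc n} \<Longrightarrow> A i \<in> sets M"
    have "(\<lambda>(x, y). tuple_cons n y x) -` (PiE {..<Suc n} A) \<inter> space (PiM {..<n} (\<lambda>_. M) \<Otimes>\<^sub>M M)
        = PiE {..<n} (\<lambda>j. A (Suc j)) \<times> A 0" (is "?L = ?R")
    proof (rule set_eqI, clarify, rule iffI)
      fix x y assume l: "(x, y) \<in> ?L"
      then have *: "tuple_cons n y x k \<in> A k" if "k < Suc n" for k
        using that by (auto simp: PiE_iff)
      from l have "x \<in> PiE {..<n} (\<lambda>_. space M)" by (auto simp: space_pair_measure space_PiM)
      then show "(x, y) \<in> ?R"
        using *[of 0] *[of "Suc _"] by (auto simp: PiE_iff tuple_cons_Suc)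
    next
      fix x y assume r: "(x, y) \<in> ?R"
      then have "(x, y) \<in> space (PiM {..<n} (\<lambda>_. M) \<Otimes>\<^sub>M M)"
        using A[THEN sets.sets_into_space] by (fastforce simp: space_pair_measure space_PiM PiE_iff)
      moreover have "tuple_cons n y x \<in> PiE {..<Suc n} A"
        using r by (auto simp: tuple_cons_def PiE_iff split: nat.splits)
      ultimately show "(x, y) \<in> ?L" by simp
    qed
    moreover have "emeasure (PiM {..<n} (\<lambda>_. M) \<Otimes>\<^sub>M M) ?R
        = emeasure (PiM {..<n} (\<lambda>_. M)) (PiE {..<n} (\<lambda>j. A (Suc j))) * emeasure M (A 0)"
      using A by (intro emeasure_pair_measure_Times sets_PiM_I_finite) auto
    moreover have "\<dots> = (\<Prod>i<Suc n. emeasure M (A i))"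
      using A by (subst P.emeasure_PiM)
        (auto simp: prod.lessThan_Suc_shift mult.commute simp del: prod.lessThan_Suc)
    ultimately show "emeasure (distr (PiM {..<n} (\<lambda>_. M) \<Otimes>\<^sub>M M) (PiM {..<Suc n} (\<lambda>_. M))
        (\<lambda>(x, y). tuple_cons n y x)) (PiE {..<Suc n} A) = (\<Prod>i<Suc n. emeasure M (A i))"
      using A by (subst emeasure_distr) (auto intro!: sets_PiM_I_finite)
  qed simp_all
qed

text \<open>Measurability of the exceptional set matters in the direction from iterated to joint null sets.\<close>

lemma AE_PiM_Suc_iff:
  assumes "sigma_finite_measure M"
    and P: "{x \<in> space (PiM {..<Suc n} (\<lambda>_. M)). P x} \<in> sets (PiM {..<Suc n} (\<lambda>_. M))"
  shows "(AE x in PiM {..<Suc n} (\<lambda>_. M). P x) \<longleftrightarrow>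
    (AE x in PiM {..<n} (\<lambda>_. M). AE y in M. P (tuple_cons n y x))"
proof -
  interpret sigma_finite_measure M by fact
  interpret P: product_sigma_finite "\<lambda>_::nat. M" by unfold_locales
  interpret I: finite_product_sigma_finite "\<lambda>_::nat. M" "{..<n}" by unfold_locales simp
  interpret Q: pair_sigma_finite "PiM {..<n} (\<lambda>_. M)" M by unfold_locales
  have m: "(\<lambda>(x, y). tuple_cons n y x) \<in> (PiM {..<n} (\<lambda>_. M) \<Otimes>\<^sub>M M) \<rightarrow>\<^sub>M PiM {..<Suc n} (\<lambda>_. M)"
    by measurable
  have "(AE x in PiM {..<Suc n} (\<lambda>_. M). P x) \<longleftrightarrow>
      (AE z in PiM {..<n} (\<lambda>_. M) \<Otimes>\<^sub>M M. P (tuple_cons n (snd z) (fst z)))"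
    by (subst PiM_Suc_eq_distr_cons[OF assms(1)], subst AE_distr_iff[OF m P])
       (simp add: case_prod_beta)
  also have "\<dots> \<longleftrightarrow> (AE x in PiM {..<n} (\<lambda>_. M). AE y in M. P (tuple_cons n y x))"
  proof (rule Q.AE_pair_iff[symmetric])
    have "{z \<in> space (PiM {..<n} (\<lambda>_. M) \<Otimes>\<^sub>M M). P (tuple_cons n (snd z) (fst z))} =
      (\<lambda>(x, y). tuple_cons n y x) -` {x \<in> space (PiM {..<Suc n} (\<lambda>_. M)). P x}
        \<inter> space (PiM {..<n} (\<lambda>_. M) \<Otimes>\<^sub>M M)"
      using measurable_space[OF m] by auto
    then show "{z \<in> space (PiM {..<n} (\<lambda>_. M) \<Otimes>\<^sub>M M). P (tuple_cons n (snd z) (fst z))}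
        \<in> sets (PiM {..<n} (\<lambda>_. M) \<Otimes>\<^sub>M M)"
      using measurable_sets[OF m P] by simp
  qed
  finally show ?thesis .
qed

subsection \<open>Diagonals\<close>

text \<open>The map onto a diagonal only repeats coordinates. Written as a reindexing by a surjection, its
  measurability and its behaviour on cubes are immediate.\<close>

lemma diag_eq_reindex:
  obtains \<phi> where "\<phi> ` {..<sum_list ls + length ls} = {..<length ls}"
    and "\<And>x :: nat \<Rightarrow> 'a. diag ls x = (\<lambda>k\<in>{..<sum_list ls + length ls}. x (\<phi> k))"
proof -
  define L where "L = concat (map (\<lambda>j. replicate (ls ! j + 1) j) [0..<length ls])"
  have len: "length L = sum_list ls + length ls"
    by (simp add: L_def length_concat comp_def sum_list_Suc map_nth)
  have "set L = {..<length ls}"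
    by (auto simp: L_def)
  then have 1: "(\<lambda>k. L ! k) ` {..<sum_list ls + length ls} = {..<length ls}"
    by (auto simp: set_conv_nth len image_iff)
  have "concat (map (\<lambda>j. replicate (ls ! j + 1) (x j)) [0..<length ls]) = map x L"
    for x :: "nat \<Rightarrow> 'a"
    by (simp add: L_def map_concat comp_def)
  then have 2: "diag ls x = (\<lambda>k\<in>{..<sum_list ls + length ls}. x (L ! k))" for x :: "nat \<Rightarrow> 'a"
    by (auto simp: diag_def len fun_eq_iff)
  from that[OF 1 2] show thesis .
qed

lemma diag_PiE: "diag ls x \<in> PiE {..<sum_list ls + length ls} (\<lambda>_. UNIV)"
  by (auto simp: diag_def)

lemma diag_cong:
  assumes "\<And>j. j < length ls \<Longrightarrow> x j = y j"
  shows "diag ls x = diag ls y"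
proof -
  obtain \<phi> where "\<phi> ` {..<sum_list ls + length ls} = {..<length ls}"
    "\<And>x :: nat \<Rightarrow> 'a. diag ls x = (\<lambda>k\<in>{..<sum_list ls + length ls}. x (\<phi> k))"
    by (rule diag_eq_reindex) blast
  with assms show ?thesis by (auto simp: fun_eq_iff)
qed

lemma diag_in_box_iff:
  "diag ls x \<in> PiE {..<sum_list ls + length ls} (\<lambda>_. B) \<longleftrightarrow> (\<forall>j<length ls. x j \<in> B)"
proof -
  obtain \<phi> where "\<phi> ` {..<sum_list ls + length ls} = {..<length ls}"
    "\<And>x :: nat \<Rightarrow> 'a. diag ls x = (\<lambda>k\<in>{..<sum_list ls + length ls}. x (\<phi> k))"
    by (rule diag_eq_reindex) blast
  note \<phi> = this
  have "diag ls x \<in> PiE {..<sum_list ls + length ls} (\<lambda>_. B) \<longleftrightarrow>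
      (\<forall>j\<in>\<phi> ` {..<sum_list ls + length ls}. x j \<in> B)"
    unfolding \<phi>(2) by auto
  then show ?thesis unfolding \<phi>(1) by auto
qed

lemma measurable_diag:
  assumes "\<And>j. j < length ls \<Longrightarrow> (\<lambda>z. g z j) \<in> N \<rightarrow>\<^sub>M M"
  shows "(\<lambda>z. diag ls (g z)) \<in> N \<rightarrow>\<^sub>M PiM {..<sum_list ls + length ls} (\<lambda>_. M)"
proof -
  obtain \<phi> where "\<phi> ` {..<sum_list ls + length ls} = {..<length ls}"
    "\<And>x :: nat \<Rightarrow> 'b. diag ls x = (\<lambda>k\<in>{..<sum_list ls + length ls}. x (\<phi> k))"
    by (rule diag_eq_reindex) blast
  note \<phi> = this
  show ?thesis unfolding \<phi>(2)
    by (intro measurable_restrict assms) (use \<phi>(1) in blast)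
qed

lemma diag_Nil: "diag [] x = (\<lambda>_. undefined)"
  by (simp add: diag_def fun_eq_iff)

lemma diag_Cons_list:
  "concat (map (\<lambda>j. replicate ((l # ls) ! j + 1) (x j)) [0..<length (l # ls)]) =
    replicate (Suc l) (x 0) @ concat (map (\<lambda>j. replicate (ls ! j + 1) (x (Suc j))) [0..<length ls])"
  by (simp add: map_upt_Suc del: upt_Suc)

lemma diag_Cons_0:
  "diag (0 # ls) x = tuple_cons (sum_list ls + length ls) (x 0) (diag ls (\<lambda>j. x (Suc j)))"
  unfolding diag_def[of "0 # ls"] diag_Cons_list
  by (auto simp: tuple_cons_def diag_def fun_eq_iff split: nat.splits)

lemma diag_Cons_Suc:
  "diag (Suc l # ls) x = tuple_cons (Suc (l + (sum_list ls + length ls))) (x 0) (diag (l # ls) x)"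
  unfolding diag_def[of "Suc l # ls"] diag_def[of "l # ls"] diag_Cons_list
  by (auto simp: tuple_cons_def fun_eq_iff split: nat.splits)

lemma annihilation_iterate_diag:
  "((point_annihilation (x 0)) ^^ Suc l) F (sum_list ls + length ls) (diag ls (\<lambda>j. x (Suc j))) =
    F (sum_list (l # ls) + length (l # ls)) (diag (l # ls) x)"
proof (induction l arbitrary: F)
  case 0
  then show ?case by (simp add: point_annihilation_def diag_Cons_0)
next
  case (Suc l)
  have "((point_annihilation (x 0)) ^^ Suc (Suc l)) F (sum_list ls + length ls) (diag ls (\<lambda>j. x (Suc j))) =
      ((point_annihilation (x 0)) ^^ Suc l) (point_annihilation (x 0) F)
        (sum_list ls + length ls) (diag ls (\<lambda>j. x (Suc j)))"
    by (subst funpow_Suc_right) (simp only: comp_def)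
  also have "\<dots> = point_annihilation (x 0) F (sum_list (l # ls) + length (l # ls)) (diag (l # ls) x)"
    by (rule Suc.IH)
  also have "\<dots> = F (sum_list (Suc l # ls) + length (Suc l # ls)) (diag (Suc l # ls) x)"
    by (simp only: point_annihilation_def diag_Cons_Suc) (simp add: add.assoc)
  finally show ?case .
qed

section \<open>The explicit formula for the isomorphism on finite sequences\<close>

text \<open>For \<open>F\<close> vanishing above degree \<open>N\<close> this is the sum of the images of all components of \<open>F\<close>.
  Summing over all lists with entries below \<open>N\<close>, instead of over compositions of each degree
  separately, lets the first entry be split off.\<close>

definition K_formula :: "(nat \<Rightarrow> 'a \<Rightarrow> real poly) \<Rightarrow> nat \<Rightarrow> 'a fock \<Rightarrow> ('a \<times> real) fock" where
  "K_formula p N F i x = (\<Sum>ls | set ls \<subseteq> {..<N} \<and> length ls = i.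
     F (sum_list ls + length ls) (diag ls (\<lambda>j. fst (x j))) *
       (\<Prod>j<i. poly (p (ls ! j) (fst (x j))) (snd (x j))))"

definition vanishes_above :: "nat \<Rightarrow> 'b fock \<Rightarrow> bool" where
  "vanishes_above N F \<longleftrightarrow> (\<forall>n>N. \<forall>x\<in>PiE {..<n} (\<lambda>_. UNIV). F n x = 0)"

lemma finite_index_lists: "finite {ls :: nat list. set ls \<subseteq> {..<N} \<and> length ls = i}"
  by (rule finite_lists_length_eq) simp

lemma finite_compositions: "finite (compositions n)"
proof (rule finite_subset)
  show "compositions n \<subseteq> {ls. set ls \<subseteq> {..n} \<and> length ls \<le> n}"
    by (auto simp: compositions_def dest: member_le_sum_list)
  show "finite {ls :: nat list. set ls \<subseteq> {..n} \<and> length ls \<le> n}"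
    by (rule finite_lists_length_le) simp
qed

lemma sum_K_image_eq_K_formula:
  assumes F: "vanishes_above N F"
  shows "(\<Sum>n\<le>N. K_image p n (F n) i x) = K_formula p N F i x"
proof -
  let ?h = "\<lambda>ls. F (sum_list ls + length ls) (diag ls (\<lambda>j. fst (x j))) *
       (\<Prod>j<i. poly (p (ls ! j) (fst (x j))) (snd (x j)))"
  let ?S = "\<lambda>n. {ls. ls \<in> compositions n \<and> length ls = i}"
  have "(\<Sum>n\<le>N. K_image p n (F n) i x) = (\<Sum>n\<le>N. sum ?h (?S n))"
    unfolding K_image_def by (intro sum.cong refl) (auto simp: compositions_def)
  also have "\<dots> = sum ?h (\<Union>n\<in>{..N}. ?S n)"
    by (rule sum.UNION_disjoint[symmetric])
       (auto intro: finite_subset[OF _ finite_compositions] simp: compositions_def)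
  also have "\<dots> = K_formula p N F i x"
    unfolding K_formula_def
  proof (rule sum.mono_neutral_left[OF finite_index_lists])
    show "(\<Union>n\<in>{..N}. ?S n) \<subseteq> {ls. set ls \<subseteq> {..<N} \<and> length ls = i}"
    proof safe
      fix ls n l assume *: "n \<le> N" "ls \<in> compositions n" "l \<in> set ls"
      then have "l \<le> sum_list ls" "0 < length ls" by (auto dest: member_le_sum_list)
      with * show "l < N" unfolding compositions_def mem_Collect_eq by linarith
    qed
    show "\<forall>ls\<in>{ls. set ls \<subseteq> {..<N} \<and> length ls = i} - (\<Union>n\<in>{..N}. ?S n). ?h ls = 0"
    proof
      fix ls assume "ls \<in> {ls. set ls \<subseteq> {..<N} \<and> length ls = i} - (\<Union>n\<in>{..N}. ?S n)"
      then have "sum_list ls + length ls > N"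
        by (auto simp: compositions_def not_le)
      then have "F (sum_list ls + length ls) (diag ls (\<lambda>j. fst (x j))) = 0"
        by (rule F[unfolded vanishes_above_def, rule_format, OF _ diag_PiE])
      then show "?h ls = 0" by simp
    qed
  qed
  finally show ?thesis .
qed

lemma K_formula_cong:
  assumes "\<And>n x. x \<in> PiE {..<n} (\<lambda>_. UNIV) \<Longrightarrow> F n x = G n x"
    and "\<And>j. j < i \<Longrightarrow> x j = y j"
  shows "K_formula p N F i x = K_formula p N G i y"
  unfolding K_formula_def
proof (rule sum.cong[OF refl])
  fix ls assume "ls \<in> {ls. set ls \<subseteq> {..<N} \<and> length ls = i}"
  then have "length ls = i" by simp
  with assms(2) have "diag ls (\<lambda>j. fst (x j)) = diag ls (\<lambda>j. fst (y j))"
    by (intro diag_cong) auto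
  with assms(2) show "F (sum_list ls + length ls) (diag ls (\<lambda>j. fst (x j))) *
       (\<Prod>j<i. poly (p (ls ! j) (fst (x j))) (snd (x j))) =
       G (sum_list ls + length ls) (diag ls (\<lambda>j. fst (y j))) *
       (\<Prod>j<i. poly (p (ls ! j) (fst (y j))) (snd (y j)))"
    by (simp add: assms(1)[OF diag_PiE])
qed

lemma K_formula_lincomb:
  "K_formula p N (\<lambda>n x. c * F n x + G n x) i x = c * K_formula p N F i x + K_formula p N G i x"
  by (simp add: K_formula_def sum.distrib sum_distrib_left algebra_simps)

lemma K_formula_0: "K_formula p N F 0 x = F 0 (\<lambda>_. undefined)"
proof -
  have "{ls :: nat list. set ls \<subseteq> {..<N} \<and> length ls = 0} = {[]}" by auto
  then show ?thesis by (simp add: K_formula_def diag_Nil)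
qed

text \<open>Splitting off the first entry of a composition: a block of \<open>l + 1\<close> equal coordinates \<open>t\<close> is
  produced by applying \<open>\<partial>\<^sub>t\<close> \<open>l + 1\<close> times.\<close>

lemma K_formula_Suc:
  "K_formula p N F (Suc k) x =
    (\<Sum>l<N. poly (p l (fst (x 0))) (snd (x 0)) *
      K_formula p N (((point_annihilation (fst (x 0))) ^^ Suc l) F) k (tuple_tail k x))"
proof -
  let ?A = "\<lambda>l. ((point_annihilation (fst (x 0))) ^^ Suc l) F"
  let ?L = "\<lambda>k. {ls :: nat list. set ls \<subseteq> {..<N} \<and> length ls = k}"
  let ?h = "\<lambda>ls. F (sum_list ls + length ls) (diag ls (\<lambda>j. fst (x j))) *
       (\<Prod>j<Suc k. poly (p (ls ! j) (fst (x j))) (snd (x j)))"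
  have "K_formula p N F (Suc k) x = sum ?h ((\<lambda>(ls, l). l # ls) ` (?L k \<times> {..<N}))"
    by (simp only: K_formula_def lists_length_Suc_eq)
  also have "\<dots> = (\<Sum>z\<in>?L k \<times> {..<N}. ?h (snd z # fst z))"
  proof -
    have "inj_on (\<lambda>(ls, l). l # ls) (?L k \<times> {..<N})" by (auto simp: inj_on_def)
    from sum.reindex[OF this] show ?thesis by (simp only: comp_def split_def)
  qed
  also have "\<dots> = (\<Sum>ls\<in>?L k. \<Sum>l<N. ?h (l # ls))"
    by (simp only: sum.cartesian_product split_def)
  also have "\<dots> = (\<Sum>l<N. \<Sum>ls\<in>?L k. ?h (l # ls))"
    by (rule sum.swap)
  also have "\<dots> = (\<Sum>l<N. poly (p l (fst (x 0))) (snd (x 0)) *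
      K_formula p N (?A l) k (tuple_tail k x))"
  proof (intro sum.cong refl)
    fix l
    have h: "?h (l # ls) = poly (p l (fst (x 0))) (snd (x 0)) *
       (?A l (sum_list ls + length ls) (diag ls (\<lambda>j. fst (x (Suc j)))) *
       (\<Prod>j<k. poly (p (ls ! j) (fst (x (Suc j)))) (snd (x (Suc j)))))" for ls
    proof -
      have "(\<Prod>j<Suc k. poly (p ((l # ls) ! j) (fst (x j))) (snd (x j))) =
          poly (p l (fst (x 0))) (snd (x 0)) * (\<Prod>j<k. poly (p (ls ! j) (fst (x (Suc j)))) (snd (x (Suc j))))"
        by (subst prod.lessThan_Suc_shift) (simp only: nth_Cons_0 nth_Cons_Suc)
      then show ?thesis
        by (simp only: annihilation_iterate_diag[where x = "\<lambda>j. fst (x j)"] mult.left_commute)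
    qed
    have "(\<Sum>ls\<in>?L k. ?h (l # ls)) = poly (p l (fst (x 0))) (snd (x 0)) *
      K_formula p N (?A l) k (\<lambda>j. x (Suc j))"
      unfolding K_formula_def sum_distrib_left by (rule sum.cong[OF refl h])
    also have "K_formula p N (?A l) k (\<lambda>j. x (Suc j)) = K_formula p N (?A l) k (tuple_tail k x)"
      by (rule K_formula_cong) (auto simp: tuple_tail_def)
    finally show "(\<Sum>ls\<in>?L k. ?h (l # ls)) = poly (p l (fst (x 0))) (snd (x 0)) *
      K_formula p N (?A l) k (tuple_tail k x)" .
  qed
  finally show ?thesis .
qed


section \<open>Bounded measurable functions of compact support as limits of test functions\<close>

lemma Hausdorff_space_euclidean_t2: "Hausdorff_space (euclidean :: 'a::t2_space topology)"
  unfolding Hausdorff_space_def disjnt_def by (metis hausdorff open_openin)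

lemma compact_closure_subset:
  fixes C :: "'a::t2_space set"
  assumes "A \<subseteq> C" "compact C"
  shows "compact (closure A)"
  using assms closure_minimal[of A C]
  by (metis closed_closure compact_Int_closed compact_imp_closed inf.absorb_iff2)

lemma locally_compact_exhaustion:
  assumes "locally_compact_space (euclidean :: 'a::{second_countable_topology, t2_space} topology)"
  obtains Q :: "nat \<Rightarrow> 'a::{second_countable_topology, t2_space} set" where "\<And>m. open (Q m)" "\<And>m. compact (closure (Q m))"
    "incseq Q" "(\<Union>m. Q m) = UNIV"
proof -
  obtain B :: "'a set set" where B: "countable B" "topological_basis B"
    using ex_countable_basis by blast
  define B' where "B' = {b \<in> B. compact (closure b)}"
  have cov: "\<exists>b\<in>B'. x \<in> b" for x
  proof -
    obtain U K where U: "open U" "compact K" "x \<in> U" "U \<subseteq> K"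
      using assms unfolding locally_compact_space_def
      by (metis UNIV_I compactin_euclidean_iff open_openin topspace_euclidean)
    obtain b where b: "b \<in> B" "x \<in> b" "b \<subseteq> U"
      using topological_basisE[OF B(2) U(1,3)] by metis
    have "compact (closure b)"
      using b U by (intro compact_closure_subset[of b K]) auto
    with b show ?thesis by (auto simp: B'_def)
  qed
  have ne: "B' \<noteq> {}" using cov by auto
  have cnt: "countable B'" using B(1) by (auto simp: B'_def)
  let ?e = "from_nat_into B'"
  have e: "?e i \<in> B'" for i using ne by (rule from_nat_into)
  show thesis
  proof (rule that[of "\<lambda>m. \<Union>i\<le>m. ?e i"])
    show "open (\<Union>i\<le>m. ?e i)" for m
      using e B(2) by (auto simp: B'_def topological_basis_open)
    show "compact (closure (\<Union>i\<le>m. ?e i))" for m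
    proof (rule compact_closure_subset)
      show "(\<Union>i\<le>m. ?e i) \<subseteq> (\<Union>i\<le>m. closure (?e i))"
        using closure_subset by (intro UN_mono) auto
      show "compact (\<Union>i\<le>m. closure (?e i))"
        using e by (intro compact_UN) (auto simp: B'_def)
    qed
    show "incseq (\<lambda>m. \<Union>i\<le>m. ?e i)" by (force simp: incseq_def)
    show "(\<Union>m. \<Union>i\<le>m. ?e i) = UNIV"
    proof -
      have "x \<in> (\<Union>m. \<Union>i\<le>m. ?e i)" for x
      proof -
        obtain b where "b \<in> B'" "x \<in> b" using cov by blast
        moreover then obtain m where "?e m = b" using from_nat_into_surj[OF cnt] by blast
        ultimately show ?thesis by (intro UN_I[of m]) auto
      qed
      then show ?thesis by blast
    qed
  qed
qed

lemma compact_subset_exhaustion: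
  fixes Q :: "nat \<Rightarrow> 'a::topological_space set"
  assumes Q: "\<And>m. open (Q m)" "incseq Q" "(\<Union>m. Q m) = UNIV" and C: "compact C"
  obtains m where "C \<subseteq> Q m"
proof -
  obtain I where I: "finite I" "C \<subseteq> (\<Union>m\<in>I. Q m)"
    using compactE_image[OF C, of UNIV Q] Q by (metis UNIV_I subset_UNIV)
  have "(\<Union>m\<in>I. Q m) \<subseteq> Q (Max (insert 0 I))"
  proof (rule UN_least)
    fix m assume "m \<in> I"
    with I(1) show "Q m \<subseteq> Q (Max (insert 0 I))" by (intro incseqD[OF Q(2)] Max_ge) auto
  qed
  with I(2) that show thesis by blast
qed

lemma compact_subset_relatively_compact_open:
  fixes C :: "'a::{second_countable_topology, t2_space} set"
  assumes "locally_compact_space (euclidean :: 'a topology)" "compact C"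
  obtains U where "open U" "compact (closure U)" "C \<subseteq> U"
  by (rule locally_compact_exhaustion[OF assms(1)])
     (metis assms(2) compact_subset_exhaustion)

text \<open>A relatively compact open set is the increasing union of compact sets, and Urysohn functions of
  these sets converge to its indicator.\<close>

lemma indicator_open_limit:
  fixes U :: "'a::{second_countable_topology, t2_space} set"
  assumes lc: "locally_compact_space (euclidean :: 'a topology)"
    and U: "open U" "compact (closure U)"
  obtains \<phi> :: "nat \<Rightarrow> 'a \<Rightarrow> real" where "\<And>k. continuous_on UNIV (\<phi> k)"
    "\<And>k t. 0 \<le> \<phi> k t" "\<And>k t. \<phi> k t \<le> 1" "\<And>k t. t \<notin> U \<Longrightarrow> \<phi> k t = 0"
    "\<And>t. (\<lambda>k. \<phi> k t) \<longlonglongrightarrow> indicator U t"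
proof -
  have H: "Hausdorff_space (euclidean :: 'a topology)" by (rule Hausdorff_space_euclidean_t2)
  have reg: "regular_space (euclidean :: 'a topology)"
    by (rule locally_compact_Hausdorff_imp_regular_space[OF lc H])
  have creg: "completely_regular_space (euclidean :: 'a topology)"
    using lc H by (intro locally_compact_regular_imp_completely_regular_space) auto
  obtain B :: "'a set set" where B: "countable B" "topological_basis B"
    using ex_countable_basis by blast
  define B' where "B' = insert {} {b \<in> B. closure b \<subseteq> U}"
  have cov: "\<exists>b\<in>B'. x \<in> b" if "x \<in> U" for x
  proof -
    have "closedin euclidean (- U) \<and> x \<in> topspace euclidean - (- U)"
      using U(1) that by (auto simp: closed_Compl)
    then obtain V W where V: "open V" "open W" "x \<in> V" "- U \<subseteq> W" "disjnt V W"
      using reg unfolding regular_space_def by (metis open_openin)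
    obtain b where b: "b \<in> B" "x \<in> b" "b \<subseteq> V"
      using topological_basisE[OF B(2) V(1,3)] by metis
    have "closure b \<subseteq> - W"
      using b V by (intro closure_minimal) (auto simp: disjnt_def closed_Compl)
    with V b show ?thesis by (auto simp: B'_def)
  qed
  let ?e = "from_nat_into B'"
  have e: "?e i \<in> B'" for i by (rule from_nat_into) (simp add: B'_def)
  have cnt: "countable B'" using B(1) by (auto simp: B'_def)
  define C where "C m = (\<Union>i\<le>m. closure (?e i))" for m
  have CU: "C m \<subseteq> U" for m
    unfolding C_def
  proof (rule UN_least)
    show "closure (?e i) \<subseteq> U" for i using e[of i] by (auto simp: B'_def)
  qed
  have Ccpt: "compact (C m)" for m
  proof -
    have "closed (C m)" by (auto simp: C_def)
    moreover have "C m \<subseteq> closure U" using CU[of m] closure_subset by blast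
    ultimately show ?thesis using U(2) by (metis compact_Int_closed inf.absorb_iff2)
  qed
  have "\<exists>\<phi>::'a \<Rightarrow> real. continuous_on UNIV \<phi> \<and> (\<forall>t. 0 \<le> \<phi> t \<and> \<phi> t \<le> 1) \<and>
      (\<forall>t. t \<notin> U \<longrightarrow> \<phi> t = 0) \<and> (\<forall>t\<in>C m. \<phi> t = 1)" for m
  proof -
    obtain f :: "'a \<Rightarrow> real" where f: "continuous_map euclidean (subtopology euclidean {0..1}) f"
      "f ` (- U) \<subseteq> {0}" "f ` (C m) \<subseteq> {1}"
      by (rule Urysohn_completely_regular_compact_closed[of 0 1 "euclidean :: 'a topology" "C m" "- U"])
         (use creg Ccpt CU U(1) in \<open>auto simp: disjnt_def closed_Compl
            intro: Urysohn_completely_regular_closed_compact[of 0 1 "euclidean :: 'a topology" "- U" "C m"]\<close>)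
    have "continuous_on UNIV f" "\<And>t. f t \<in> {0..1}"
      using f(1) by (auto simp: continuous_map_in_subtopology)
    with f(2,3) show ?thesis by (intro exI[of _ f]) auto
  qed
  then obtain \<phi> :: "nat \<Rightarrow> 'a \<Rightarrow> real" where \<phi>: "\<And>k. continuous_on UNIV (\<phi> k)"
    "\<And>k t. 0 \<le> \<phi> k t" "\<And>k t. \<phi> k t \<le> 1" "\<And>k t. t \<notin> U \<Longrightarrow> \<phi> k t = 0"
    "\<And>k t. t \<in> C k \<Longrightarrow> \<phi> k t = 1"
    by metis
  have "(\<lambda>k. \<phi> k t) \<longlonglongrightarrow> indicator U t" for t
  proof (cases "t \<in> U")
    case True
    then obtain b where "b \<in> B'" "t \<in> b" using cov by blast
    then obtain i where "t \<in> ?e i" using from_nat_into_surj[OF cnt] by metis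
    then have "t \<in> C k" if "i \<le> k" for k
      using that closure_subset by (auto simp: C_def)
    then have "eventually (\<lambda>k. \<phi> k t = 1) sequentially"
      using \<phi>(5) by (auto simp: eventually_sequentially)
    with True show ?thesis by (simp add: tendsto_eventually)
  qed (simp add: \<phi>(4))
  with \<phi> that show thesis by blast
qed

text \<open>Open sets of the product topology are measurable for the product \<open>\<sigma>\<close>-algebra because there are
  only countably many boxes with sides in a countable base.\<close>

lemma continuous_map_PiM_measurable:
  fixes g :: "(nat \<Rightarrow> 'a::second_countable_topology) \<Rightarrow> real"
  assumes "continuous_map (product_topology (\<lambda>_. euclidean) {..<n}) euclideanreal g"
  shows "g \<in> borel_measurable (PiM {..<n} (\<lambda>_. borel))"
proof -
  let ?X = "product_topology (\<lambda>_. euclidean :: 'a topology) {..<n}"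
  obtain B :: "'a set set" where B: "countable B" "topological_basis B"
    using ex_countable_basis by blast
  have op: "W \<in> sets (PiM {..<n} (\<lambda>_. borel))" if W: "openin ?X W" for W
  proof -
    define R where "R = {V \<in> PiE {..<n} (\<lambda>_. B). PiE {..<n} V \<subseteq> W}"
    have "countable R"
      unfolding R_def using B(1) by (intro countable_Collect countable_PiE) auto
    moreover have "W = (\<Union>V\<in>R. PiE {..<n} V)"
    proof (intro antisym subsetI)
      fix x assume x: "x \<in> W"
      then obtain U where U: "\<And>i. i < n \<Longrightarrow> open (U i)" "x \<in> PiE {..<n} U" "PiE {..<n} U \<subseteq> W"
        using W unfolding openin_product_topology_alt by (metis lessThan_iff open_openin)
      have "\<exists>b\<in>B. x i \<in> b \<and> b \<subseteq> U i" if "i < n" for i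
        using topological_basisE[OF B(2) U(1)[OF that], of "x i"] U(2) that by (metis PiE_mem lessThan_iff)
      then obtain b where b: "\<And>i. i < n \<Longrightarrow> b i \<in> B \<and> x i \<in> b i \<and> b i \<subseteq> U i"
        by metis
      let ?b = "restrict b {..<n}"
      have "PiE {..<n} ?b \<subseteq> PiE {..<n} U" using b by (intro PiE_mono) auto
      with U(3) b have "?b \<in> R" by (auto simp: R_def)
      moreover have "x \<in> PiE {..<n} ?b" using U(2) b by (auto simp: PiE_iff)
      ultimately show "x \<in> (\<Union>V\<in>R. PiE {..<n} V)" by blast
    qed (auto simp: R_def)
    moreover have "PiE {..<n} V \<in> sets (PiM {..<n} (\<lambda>_. borel))" if "V \<in> R" for V
      using that topological_basis_open[OF B(2)]
      by (intro sets_PiM_I_finite) (auto simp: R_def PiE_iff intro!: borel_open)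
    ultimately show ?thesis by auto
  qed
  show ?thesis
  proof (rule borel_measurableI)
    fix S :: "real set" assume "open S"
    then have "openin ?X {x \<in> topspace ?X. g x \<in> S}"
      using openin_continuous_map_preimage[OF assms] by simp
    from op[OF this] show "g -` S \<inter> space (PiM {..<n} (\<lambda>_. borel)) \<in> sets (PiM {..<n} (\<lambda>_. borel))"
      by (simp add: space_PiM vimage_def Int_def conj_commute)
  qed
qed

text \<open>This is \<open>B\<^sub>0(T\<^sup>n)\<close>: every compact set of tuples lies in a cube with compact side, so compactness of
  the support may be expressed by cubes.\<close>

definition B0_tuples :: "nat \<Rightarrow> ((nat \<Rightarrow> 'a::topological_space) \<Rightarrow> real) set" where
  "B0_tuples n = {g. g \<in> borel_measurable (PiM {..<n} (\<lambda>_. borel)) \<and>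
     (\<exists>c. \<forall>x\<in>PiE {..<n} (\<lambda>_. UNIV). \<bar>g x\<bar> \<le> c) \<and>
     (\<exists>C. compact C \<and> (\<forall>x\<in>PiE {..<n} (\<lambda>_. UNIV). g x \<noteq> 0 \<longrightarrow> x \<in> PiE {..<n} (\<lambda>_. C)))}"

lemma B0_tuplesI:
  assumes "g \<in> borel_measurable (PiM {..<n} (\<lambda>_. borel))"
    and "\<And>x. x \<in> PiE {..<n} (\<lambda>_. UNIV) \<Longrightarrow> \<bar>g x\<bar> \<le> c"
    and "compact C" "\<And>x. x \<in> PiE {..<n} (\<lambda>_. UNIV) \<Longrightarrow> g x \<noteq> 0 \<Longrightarrow> x \<in> PiE {..<n} (\<lambda>_. C)"
  shows "g \<in> B0_tuples n"
  using assms unfolding B0_tuples_def by blast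

lemma B0_tuplesE:
  assumes "g \<in> B0_tuples n"
  obtains c C where "g \<in> borel_measurable (PiM {..<n} (\<lambda>_. borel))"
    and "\<And>x. x \<in> PiE {..<n} (\<lambda>_. UNIV) \<Longrightarrow> \<bar>g x\<bar> \<le> c" "0 \<le> c"
    and "compact C" "\<And>x. x \<in> PiE {..<n} (\<lambda>_. UNIV) \<Longrightarrow> g x \<noteq> 0 \<Longrightarrow> x \<in> PiE {..<n} (\<lambda>_. C)"
proof -
  obtain c C where g: "g \<in> borel_measurable (PiM {..<n} (\<lambda>_. borel))"
    "\<forall>x\<in>PiE {..<n} (\<lambda>_. UNIV). \<bar>g x\<bar> \<le> c"
    "compact C" "\<forall>x\<in>PiE {..<n} (\<lambda>_. UNIV). g x \<noteq> 0 \<longrightarrow> x \<in> PiE {..<n} (\<lambda>_. C)"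
    using assms unfolding B0_tuples_def by blast
  obtain x :: "nat \<Rightarrow> 'a" where "x \<in> PiE {..<n} (\<lambda>_. UNIV)"
    by (meson restrict_PiE_iff UNIV_I)
  with g(2) have "0 \<le> c" by (meson abs_ge_zero order_trans)
  with g show thesis by (intro that[of c C]) auto
qed

lemma B0_tuples_measurable: "g \<in> B0_tuples n \<Longrightarrow> g \<in> borel_measurable (PiM {..<n} (\<lambda>_. borel))"
  by (simp add: B0_tuples_def)

lemma B0_tuples_lincomb:
  fixes g h :: "(nat \<Rightarrow> 'a::topological_space) \<Rightarrow> real"
  assumes "g \<in> B0_tuples n" "h \<in> B0_tuples n"
  shows "(\<lambda>x. c * g x + h x) \<in> B0_tuples n"
proof -
  obtain a A where g: "g \<in> borel_measurable (PiM {..<n} (\<lambda>_. borel))"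
    "\<And>x. x \<in> PiE {..<n} (\<lambda>_. UNIV) \<Longrightarrow> \<bar>g x\<bar> \<le> a" "0 \<le> a" "compact A"
    "\<And>x. x \<in> PiE {..<n} (\<lambda>_. UNIV) \<Longrightarrow> g x \<noteq> 0 \<Longrightarrow> x \<in> PiE {..<n} (\<lambda>_. A)"
    using assms(1) by (rule B0_tuplesE) blast
  obtain b B where h: "h \<in> borel_measurable (PiM {..<n} (\<lambda>_. borel))"
    "\<And>x. x \<in> PiE {..<n} (\<lambda>_. UNIV) \<Longrightarrow> \<bar>h x\<bar> \<le> b" "0 \<le> b" "compact B"
    "\<And>x. x \<in> PiE {..<n} (\<lambda>_. UNIV) \<Longrightarrow> h x \<noteq> 0 \<Longrightarrow> x \<in> PiE {..<n} (\<lambda>_. B)"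
    using assms(2) by (rule B0_tuplesE) blast
  show ?thesis
  proof (rule B0_tuplesI)
    show "(\<lambda>x. c * g x + h x) \<in> borel_measurable (PiM {..<n} (\<lambda>_. borel))"
      using g(1) h(1) by measurable
    show "compact (A \<union> B)" using g(4) h(4) by (rule compact_Un)
    fix x :: "nat \<Rightarrow> 'a" assume x: "x \<in> PiE {..<n} (\<lambda>_. UNIV)"
    have "\<bar>c * g x + h x\<bar> \<le> \<bar>c\<bar> * \<bar>g x\<bar> + \<bar>h x\<bar>"
      by (metis abs_mult abs_triangle_ineq)
    also have "\<dots> \<le> \<bar>c\<bar> * a + b"
      using g(2)[OF x] h(2)[OF x] by (intro add_mono mult_left_mono) auto
    finally show "\<bar>c * g x + h x\<bar> \<le> \<bar>c\<bar> * a + b" .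
    assume "c * g x + h x \<noteq> 0"
    then have "g x \<noteq> 0 \<or> h x \<noteq> 0" by auto
    then show "x \<in> PiE {..<n} (\<lambda>_. A \<union> B)"
      using g(5)[OF x] h(5)[OF x] by (auto simp: PiE_iff)
  qed
qed

lemma test_functions_subset_B0_tuples:
  "test_functions n \<subseteq> (B0_tuples n :: ((nat \<Rightarrow> 'a::{second_countable_topology, t2_space}) \<Rightarrow> real) set)"
proof
  fix g :: "(nat \<Rightarrow> 'a) \<Rightarrow> real" assume "g \<in> test_functions n"
  let ?X = "product_topology (\<lambda>_. euclidean :: 'a topology) {..<n}"
  let ?S = "?X closure_of {x \<in> topspace ?X. g x \<noteq> 0}"
  from \<open>g \<in> test_functions n\<close> have g: "continuous_map ?X euclideanreal g" "compactin ?X ?S"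
    by (auto simp: test_functions_def Let_def)
  have S: "x \<in> ?S" if "x \<in> PiE {..<n} (\<lambda>_. UNIV)" "g x \<noteq> 0" for x
    using closure_of_subset[of "{x \<in> topspace ?X. g x \<noteq> 0}" ?X] that by auto
  have "compact (g ` ?S)"
    using image_compactin[OF g(2) g(1)] by (simp only: compactin_euclidean_iff)
  then have "bounded (g ` ?S)" by (rule compact_imp_bounded)
  then obtain c where "\<forall>y\<in>g ` ?S. norm y \<le> c" unfolding bounded_iff by (rule exE)
  then have c: "\<And>x. x \<in> ?S \<Longrightarrow> \<bar>g x\<bar> \<le> c" by simp
  have "compact ((\<lambda>x. x i) ` ?S)" if "i < n" for i
  proof -
    have "continuous_map ?X euclidean (\<lambda>x. x i)"
      by (rule continuous_map_product_projection[of i "{..<n}" "\<lambda>_. euclidean"]) (use that in simp)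
    from image_compactin[OF g(2) this] show ?thesis by (simp only: compactin_euclidean_iff)
  qed
  then have C: "compact (\<Union>i<n. (\<lambda>x. x i) ` ?S)"
    by (intro compact_UN) auto
  show "g \<in> B0_tuples n"
  proof (rule B0_tuplesI[OF continuous_map_PiM_measurable[OF g(1)] _ C])
    fix x :: "nat \<Rightarrow> 'a" assume x: "x \<in> PiE {..<n} (\<lambda>_. UNIV)"
    show "\<bar>g x\<bar> \<le> \<bar>c\<bar>"
    proof (cases "g x = 0")
      case False
      from c[OF S[OF x False]] show ?thesis by simp
    qed simp
    show "x \<in> PiE {..<n} (\<lambda>_. \<Union>i<n. (\<lambda>x. x i) ` ?S)" if "g x \<noteq> 0"
      using S[OF x that] x by (auto simp: PiE_iff)
  qed
qed

lemma prod_in_test_functions: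
  fixes \<phi> :: "nat \<Rightarrow> 'a::t2_space \<Rightarrow> real"
  assumes "\<And>j. j < n \<Longrightarrow> continuous_on UNIV (\<phi> j)" "compact C"
    and "\<And>j t. j < n \<Longrightarrow> t \<notin> C \<Longrightarrow> \<phi> j t = 0"
  shows "(\<lambda>x. \<Prod>j<n. \<phi> j (x j)) \<in> test_functions n"
proof -
  let ?X = "product_topology (\<lambda>_. euclidean :: 'a topology) {..<n}"
  let ?g = "\<lambda>x. \<Prod>j<n. \<phi> j (x j)"
  have "continuous_map ?X euclideanreal ?g"
  proof (intro continuous_map_prod)
    fix j assume j: "j \<in> {..<n}"
    have "continuous_map ?X euclideanreal (\<phi> j \<circ> (\<lambda>x. x j))"
      using j assms(1) by (intro continuous_map_compose[of _ euclidean] continuous_map_product_projection) auto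
    then show "continuous_map ?X euclideanreal (\<lambda>x. \<phi> j (x j))" by (simp add: comp_def)
  qed simp
  moreover have "compactin ?X (?X closure_of {x \<in> topspace ?X. ?g x \<noteq> 0})"
  proof (rule closed_compactin)
    show c: "compactin ?X (PiE {..<n} (\<lambda>_. C))" using assms(2) by (simp add: compactin_PiE)
    have "{x \<in> topspace ?X. ?g x \<noteq> 0} \<subseteq> PiE {..<n} (\<lambda>_. C)"
    proof
      fix x assume "x \<in> {x \<in> topspace ?X. ?g x \<noteq> 0}"
      then have x: "x \<in> topspace ?X" "?g x \<noteq> 0" by auto
      have "x j \<in> C" if "j < n" for j
        using x(2) assms(3)[of j "x j"] that by auto
      with x(1) show "x \<in> PiE {..<n} (\<lambda>_. C)" by (auto simp: PiE_iff)
    qed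
    moreover have "closedin ?X (PiE {..<n} (\<lambda>_. C))"
      by (rule compactin_imp_closedin[OF _ c])
        (simp add: Hausdorff_space_product_topology Hausdorff_space_euclidean_t2)
    ultimately show "?X closure_of {x \<in> topspace ?X. ?g x \<noteq> 0} \<subseteq> PiE {..<n} (\<lambda>_. C)"
      by (rule closure_of_minimal)
  qed simp
  ultimately show ?thesis by (simp add: test_functions_def Let_def)
qed

lemma sets_PiM_eq_open_rectangles:
  "sets (PiM {..<n :: nat} (\<lambda>_. borel :: 'a::topological_space measure)) =
    sigma_sets (PiE {..<n} (\<lambda>_. UNIV)) {PiE {..<n} U |U. \<forall>j<n. open (U j)}"
proof -
  let ?P = "{{f \<in> PiE {..<n} (\<lambda>_. UNIV :: 'a set). \<forall>i\<in>j. f i \<in> A i} |A j. j \<in> {{..<n}} \<and> A \<in> Pi j (\<lambda>_. {S. open S})}"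
  have "sets (PiM {..<n} (\<lambda>_. borel :: 'a measure)) = sets (sigma (PiE {..<n} (\<lambda>_. UNIV :: 'a set)) ?P)"
    unfolding borel_def by (rule sets_PiM_sigma) (auto intro!: exI[of _ "{UNIV}"])
  also have "?P = {PiE {..<n} U |U. \<forall>j<n. open (U j)}"
  proof -
    have "{f \<in> PiE {..<n} (\<lambda>_. UNIV). \<forall>i\<in>{..<n}. f i \<in> A i} = PiE {..<n} A" for A :: "nat \<Rightarrow> 'a set"
      by (auto simp: PiE_def)
    then show ?thesis by (simp add: Pi_iff Ball_def)
  qed
  also have "sets (sigma (PiE {..<n} (\<lambda>_. UNIV :: 'a set)) {PiE {..<n} U |U. \<forall>j<n. open (U j)}) =
      sigma_sets (PiE {..<n} (\<lambda>_. UNIV)) {PiE {..<n} U |U. \<forall>j<n. open (U j)}"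
    by (rule sets_measure_of) (auto simp: PiE_def)
  finally show ?thesis .
qed

text \<open>A monotone class theorem: closure under bounded pointwise limits leads from products of
  continuous functions to indicators of open cuboids, then to measurable subsets of a fixed
  relatively compact open cube by Dynkin's argument, and from there to all bounded functions.\<close>

lemma B0_tuples_induct [consumes 2, case_names test lincomb limit]:
  fixes g :: "(nat \<Rightarrow> 'a::{second_countable_topology, t2_space}) \<Rightarrow> real"
  assumes lc: "locally_compact_space (euclidean :: 'a topology)" and g: "g \<in> B0_tuples n"
    and test: "\<And>h. h \<in> test_functions n \<Longrightarrow> P h"
    and lincomb: "\<And>c h k. h \<in> B0_tuples n \<Longrightarrow> k \<in> B0_tuples n \<Longrightarrow> P h \<Longrightarrow> P k \<Longrightarrow>
      P (\<lambda>x. c * h x + k x)"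
    and limit: "\<And>H h c C. (\<And>k. H k \<in> B0_tuples n) \<Longrightarrow> (\<And>k. P (H k)) \<Longrightarrow> h \<in> B0_tuples n \<Longrightarrow>
      (\<And>k x. x \<in> PiE {..<n} (\<lambda>_. UNIV) \<Longrightarrow> \<bar>H k x\<bar> \<le> c) \<Longrightarrow> compact C \<Longrightarrow>
      (\<And>k x. x \<in> PiE {..<n} (\<lambda>_. UNIV) \<Longrightarrow> H k x \<noteq> 0 \<Longrightarrow> x \<in> PiE {..<n} (\<lambda>_. C)) \<Longrightarrow>
      (\<And>x. x \<in> PiE {..<n} (\<lambda>_. UNIV) \<Longrightarrow> (\<lambda>k. H k x) \<longlonglongrightarrow> h x) \<Longrightarrow> P h"
  shows "P g"
proof -
  let ?T = "PiE {..<n} (\<lambda>_. UNIV :: 'a set)"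
  let ?M = "PiM {..<n} (\<lambda>_. borel :: 'a measure)"
  obtain b C where gm: "g \<in> borel_measurable ?M" and gb: "\<And>x. x \<in> ?T \<Longrightarrow> \<bar>g x\<bar> \<le> b"
    and C: "compact C" and gC: "\<And>x. x \<in> ?T \<Longrightarrow> g x \<noteq> 0 \<Longrightarrow> x \<in> PiE {..<n} (\<lambda>_. C)"
    using g by (rule B0_tuplesE) blast
  obtain Q where Q: "open Q" "compact (closure Q)" "C \<subseteq> Q"
    using compact_subset_relatively_compact_open[OF lc C] by blast
  \<comment> \<open>All functions below are cut off by this cube, which keeps their supports in one compact set.\<close>
  let ?Q = "PiE {..<n} (\<lambda>_. Q)"
  have QT: "?Q \<subseteq> ?T" by (auto simp: PiE_iff)
  have Qm: "?Q \<in> sets ?M" using Q(1) by (intro sets_PiM_I_finite) auto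
  have Qcl: "?Q \<subseteq> PiE {..<n} (\<lambda>_. closure Q)" using closure_subset by (intro PiE_mono) auto
  have B0I: "(\<lambda>x. u x * indicator ?Q x) \<in> B0_tuples n"
    if "u \<in> borel_measurable ?M" "\<And>x. x \<in> ?T \<Longrightarrow> \<bar>u x\<bar> \<le> c" "0 \<le> c" for u :: "_ \<Rightarrow> real" and c
  proof (rule B0_tuplesI[OF _ _ Q(2)])
    show "(\<lambda>x. u x * indicator ?Q x) \<in> borel_measurable ?M"
      using that(1) Qm by measurable
    show "\<bar>u x * indicator ?Q x\<bar> \<le> c" if "x \<in> ?T" for x
      using \<open>x \<in> ?T \<Longrightarrow> \<bar>u x\<bar> \<le> c\<close> \<open>0 \<le> c\<close> that by (auto simp: indicator_def)
    show "x \<in> PiE {..<n} (\<lambda>_. closure Q)" if "u x * indicator ?Q x \<noteq> 0" for x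
      using that Qcl by (auto simp: indicator_def split: if_splits)
  qed
  have lim: "P (\<lambda>x. u x * indicator ?Q x)"
    if "\<And>k. H k \<in> borel_measurable ?M" "\<And>k. P (\<lambda>x. H k x * indicator ?Q x)"
      "u \<in> borel_measurable ?M" "\<And>k x. x \<in> ?T \<Longrightarrow> \<bar>H k x\<bar> \<le> c"
      "\<And>x. x \<in> ?T \<Longrightarrow> \<bar>u x\<bar> \<le> c" "\<And>x. x \<in> ?Q \<Longrightarrow> (\<lambda>k. H k x) \<longlonglongrightarrow> u x" "0 \<le> c"
    for H u and c :: real
  proof (rule limit[of "\<lambda>k x. H k x * indicator ?Q x" _ c "closure Q"])
    show "(\<lambda>x. H k x * indicator ?Q x) \<in> B0_tuples n" for k
      by (rule B0I[OF that(1) that(4) that(7)])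
    show "(\<lambda>x. u x * indicator ?Q x) \<in> B0_tuples n"
      by (rule B0I[OF that(3) that(5) that(7)])
    show "\<bar>H k x * indicator ?Q x\<bar> \<le> c" if "x \<in> ?T" for k x
      using \<open>\<And>k x. x \<in> ?T \<Longrightarrow> \<bar>H k x\<bar> \<le> c\<close>[OF that] \<open>0 \<le> c\<close> by (auto simp: indicator_def)
    show "x \<in> PiE {..<n} (\<lambda>_. closure Q)" if "H k x * indicator ?Q x \<noteq> 0" for k x
      using that Qcl by (auto simp: indicator_def split: if_splits)
    show "(\<lambda>k. H k x * indicator ?Q x) \<longlonglongrightarrow> u x * indicator ?Q x" for x
      using \<open>x \<in> ?Q \<Longrightarrow> (\<lambda>k. H k x) \<longlonglongrightarrow> u x\<close> by (cases "x \<in> ?Q") auto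
  qed (fact that Q)+
  have cong: "P (\<lambda>x. u x * indicator ?Q x)"
    if "P (\<lambda>x. v x * indicator ?Q x)" "\<And>x. x \<in> ?Q \<Longrightarrow> v x = u x"
      "v \<in> borel_measurable ?M" "\<And>x. x \<in> ?T \<Longrightarrow> \<bar>v x\<bar> \<le> c"
      "u \<in> borel_measurable ?M" "\<And>x. x \<in> ?T \<Longrightarrow> \<bar>u x\<bar> \<le> c" "0 \<le> c" for u v :: "_ \<Rightarrow> real" and c
    by (rule lim[of "\<lambda>_. v" u c]) (use that in auto)
  have lin: "P (\<lambda>x. (d * u x + v x) * indicator ?Q x)"
    if "P (\<lambda>x. u x * indicator ?Q x)" "P (\<lambda>x. v x * indicator ?Q x)"
      "v \<in> borel_measurable ?M" "\<And>x. x \<in> ?T \<Longrightarrow> \<bar>v x\<bar> \<le> c"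
      "u \<in> borel_measurable ?M" "\<And>x. x \<in> ?T \<Longrightarrow> \<bar>u x\<bar> \<le> c" "0 \<le> c" for u v :: "_ \<Rightarrow> real" and c d
    using lincomb[OF B0I[of u c] B0I[of v c], of d] that by (simp add: algebra_simps)
  have rect: "P (\<lambda>x. indicator (PiE {..<n} U) x * indicator ?Q x)" if U: "\<And>j. j < n \<Longrightarrow> open (U j)" for U
  proof -
    define approx where "approx j \<phi> \<longleftrightarrow> (\<forall>k. continuous_on UNIV (\<phi> k)) \<and>
      (\<forall>k t. 0 \<le> \<phi> k t \<and> \<phi> k t \<le> 1) \<and> (\<forall>k t. t \<notin> U j \<inter> Q \<longrightarrow> \<phi> k t = 0) \<and>
      (\<forall>t. (\<lambda>k. \<phi> k t) \<longlonglongrightarrow> indicator (U j \<inter> Q) t)" for j and \<phi> :: "nat \<Rightarrow> 'a \<Rightarrow> real"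
    have "\<exists>\<phi>. approx j \<phi>" if j: "j < n" for j
    proof -
      have "compact (closure (U j \<inter> Q))"
        using closure_subset[of Q] by (intro compact_closure_subset[OF _ Q(2)]) blast
      then obtain \<phi> :: "nat \<Rightarrow> 'a \<Rightarrow> real" where "\<And>k. continuous_on UNIV (\<phi> k)"
        "\<And>k t. 0 \<le> \<phi> k t" "\<And>k t. \<phi> k t \<le> 1" "\<And>k t. t \<notin> U j \<inter> Q \<Longrightarrow> \<phi> k t = 0"
        "\<And>t. (\<lambda>k. \<phi> k t) \<longlonglongrightarrow> indicator (U j \<inter> Q) t"
        using indicator_open_limit[OF lc open_Int[OF U[OF j] Q(1)]] by blast
      then show ?thesis by (intro exI[of _ \<phi>]) (auto simp: approx_def)
    qed
    then obtain \<phi> where "\<And>j. j < n \<Longrightarrow> approx j (\<phi> j)" by metis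
    then have
      \<phi>: "\<And>j k. j < n \<Longrightarrow> continuous_on UNIV (\<phi> j k)" "\<And>j k t. j < n \<Longrightarrow> 0 \<le> \<phi> j k t"
        "\<And>j k t. j < n \<Longrightarrow> \<phi> j k t \<le> 1" "\<And>j k t. j < n \<Longrightarrow> t \<notin> U j \<inter> Q \<Longrightarrow> \<phi> j k t = 0"
        "\<And>j t. j < n \<Longrightarrow> (\<lambda>k. \<phi> j k t) \<longlonglongrightarrow> indicator (U j \<inter> Q) t"
      by (auto simp: approx_def)
    have test\<phi>: "(\<lambda>x. \<Prod>j<n. \<phi> j k (x j)) \<in> test_functions n" for k
      using \<phi>(1,4) closure_subset[of Q] by (intro prod_in_test_functions[OF _ Q(2)]) blast+
    show ?thesis
    proof (rule limit[of "\<lambda>k x. \<Prod>j<n. \<phi> j k (x j)" _ 1 "closure Q"])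
      show "(\<lambda>x. \<Prod>j<n. \<phi> j k (x j)) \<in> B0_tuples n" for k
        using test\<phi> test_functions_subset_B0_tuples by blast
      show "P (\<lambda>x. \<Prod>j<n. \<phi> j k (x j))" for k by (rule test[OF test\<phi>])
      show "(\<lambda>x. indicator (PiE {..<n} U) x * indicator ?Q x) \<in> B0_tuples n"
        using U by (intro B0I[of _ 1] borel_measurable_indicator sets_PiM_I_finite) auto
      show "\<bar>\<Prod>j<n. \<phi> j k (x j)\<bar> \<le> 1" for k x
      proof -
        have "0 \<le> (\<Prod>j<n. \<phi> j k (x j))" using \<phi>(2) by (intro prod_nonneg) auto
        moreover have "(\<Prod>j<n. \<phi> j k (x j)) \<le> 1" using \<phi>(2,3) by (intro prod_le_1) auto
        ultimately show ?thesis by simp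
      qed
      show "x \<in> PiE {..<n} (\<lambda>_. closure Q)" if "x \<in> ?T" "(\<Prod>j<n. \<phi> j k (x j)) \<noteq> 0" for x k
      proof -
        have "x j \<in> Q" if "j < n" for j
          using \<open>(\<Prod>j<n. \<phi> j k (x j)) \<noteq> 0\<close> \<phi>(4)[of j "x j" k] that by auto
        then show ?thesis using that(1) closure_subset[of Q] by (auto simp: PiE_iff)
      qed
      show "(\<lambda>k. \<Prod>j<n. \<phi> j k (x j)) \<longlonglongrightarrow> indicator (PiE {..<n} U) x * indicator ?Q x"
        if "x \<in> ?T" for x
      proof -
        have "(\<Prod>j<n. indicator (U j \<inter> Q) (x j) :: real) = indicator (PiE {..<n} U) x * indicator ?Q x"
        proof (cases "\<forall>j<n. x j \<in> U j \<inter> Q")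
          case True
          then have "x \<in> PiE {..<n} U" "x \<in> ?Q" using that by (auto simp: PiE_def)
          moreover have "(\<Prod>j<n. indicator (U j \<inter> Q) (x j) :: real) = (\<Prod>j<n. 1)"
            using True by (intro prod.cong) auto
          ultimately show ?thesis by (simp only: indicator_simps prod.neutral_const mult_1)
        next
          case False
          then obtain j where "j < n" "x j \<notin> U j \<inter> Q" by auto
          then have "(\<Prod>j<n. indicator (U j \<inter> Q) (x j) :: real) = 0"
            by (intro prod_zero) (auto intro!: bexI[of _ j])
          moreover have "x \<notin> PiE {..<n} U \<or> x \<notin> ?Q" using False by (auto simp: PiE_iff)
          ultimately show ?thesis
            by (metis indicator_simps(2) mult_zero_left mult_zero_right)
        qed
        moreover have "(\<lambda>k. \<Prod>j<n. \<phi> j k (x j)) \<longlonglongrightarrow> (\<Prod>j<n. indicator (U j \<inter> Q) (x j))"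
          using \<phi>(5) by (intro tendsto_prod) auto
        ultimately show ?thesis by simp
      qed
    qed (fact Q)
  qed
  have one: "P (\<lambda>x. 1 * indicator ?Q x)"
    using rect[of "\<lambda>_. UNIV"]
    by (rule cong[where c = 1]) (use QT in \<open>auto intro!: borel_measurable_indicator sets_PiM_I_finite\<close>)
  have zero: "P (\<lambda>x. 0 * indicator ?Q x)"
    using lin[OF one one, of 1 "-1"] by simp
  have sets: "P (\<lambda>x. indicator A x * indicator ?Q x)" if "A \<in> sets ?M" for A
  proof -
    have A: "A \<in> sigma_sets ?T {PiE {..<n} U |U. \<forall>j<n. open (U j)}"
      using that by (simp only: sets_PiM_eq_open_rectangles)
    have Pow: "{PiE {..<n} U |U. \<forall>j<n. open (U j)} \<subseteq> Pow ?T" by (auto simp: PiE_iff)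
    have "Int_stable {PiE {..<n} U |U. \<forall>j<n. open ((U :: nat \<Rightarrow> 'a set) j)}"
    proof (rule Int_stableI, safe)
      fix U V :: "nat \<Rightarrow> 'a set" assume "\<forall>j<n. open (U j)" "\<forall>j<n. open (V j)"
      then show "\<exists>W. PiE {..<n} U \<inter> PiE {..<n} V = PiE {..<n} W \<and> (\<forall>j<n. open (W j))"
        by (intro exI[of _ "\<lambda>j. U j \<inter> V j"]) (auto simp: PiE_Int)
    qed
    from this Pow A show ?thesis
    proof (induction rule: sigma_sets_induct_disjoint)
      case (basic A)
      then show ?case using rect by auto
    next
      case empty
      then show ?case using zero by simp
    next
      case (compl A)
      then have A: "A \<in> sets ?M" by (simp only: sets_PiM_eq_open_rectangles)
      then have cA: "?T - A \<in> sets ?M"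
        using sets.compl_sets[OF A] by (simp add: space_PiM)
      have "P (\<lambda>x. (-1 * indicator A x + 1) * indicator ?Q x)"
        using A by (intro lin[OF compl.IH one, where c = 1]) (auto simp: indicator_def)
      then show ?case
        by (rule cong[where c = 1]) (use A cA QT in \<open>auto simp: indicator_def\<close>)
    next
      case (union A)
      then have A: "A i \<in> sets ?M" for i
        using range_subsetD[OF union(2), of i] by (simp only: sets_PiM_eq_open_rectangles)
      have le1: "(\<Sum>i<k. indicator (A i) x :: real) = indicator (\<Union>i<k. A i) x" for k x
        using union(1) by (subst indicator_UN_disjoint) (auto simp: disjoint_family_on_def)
      have part: "P (\<lambda>x. (\<Sum>i<k. indicator (A i) x) * indicator ?Q x)" for k
      proof (induction k)
        case 0
        then show ?case using zero by simp
      next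
        case (Suc k)
        have "P (\<lambda>x. (1 * indicator (A k) x + (\<Sum>i<k. indicator (A i) x)) * indicator ?Q x)"
          using A le1[where k = k] by (intro lin[OF union.IH Suc, where c = 1]) auto
        then show ?case by (simp add: add.commute)
      qed
      show ?case
      proof (rule lim[OF _ part _ _ _ _ zero_le_one])
        show "(\<lambda>x. \<Sum>i<k. indicator (A i) x :: real) \<in> borel_measurable ?M" for k
          using A by measurable
        show "(indicator (\<Union>i. A i) :: _ \<Rightarrow> real) \<in> borel_measurable ?M"
          using A by (intro borel_measurable_indicator) auto
        show "\<bar>\<Sum>i<k. indicator (A i) x :: real\<bar> \<le> 1" for k x
          unfolding le1 by (simp add: indicator_def)
        show "\<bar>indicator (\<Union>i. A i) x :: real\<bar> \<le> 1" for x
          by (simp add: indicator_def)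
        show "(\<lambda>k. \<Sum>i<k. indicator (A i) x :: real) \<longlonglongrightarrow> indicator (\<Union>i. A i) x" for x
          unfolding le1 by (rule LIMSEQ_indicator_UN)
      qed
    qed
  qed
  have nonneg: "P (\<lambda>x. u x * indicator ?Q x)"
    if "u \<in> borel_measurable ?M" "\<And>x. 0 \<le> u x" "\<And>x. x \<in> ?T \<Longrightarrow> u x \<le> c" for u c
    using that
  proof (induction u arbitrary: c rule: borel_measurable_induct_real)
    case (set A)
    then show ?case using sets by simp
  next
    case (mult u d)
    show ?case
    proof (cases "d = 0")
      case True
      then show ?thesis using zero by simp
    next
      case False
      with mult have "d > 0" by simp
      then have u: "u x \<le> c / d" if "x \<in> ?T" for x
        using mult.prems[OF that] by (simp add: field_simps)
      have "0 \<le> c / d" using u by (meson mult(3) order_trans restrict_PiE_iff UNIV_I)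
      then have "P (\<lambda>x. (d * u x + 0) * indicator ?Q x)"
        using u mult by (intro lin[OF mult.IH[OF u] zero, where c = "c / d"]) auto
      then show ?thesis by simp
    qed
  next
    case (add u v)
    have le: "u x \<le> c" "v x \<le> c" if "x \<in> ?T" for x
      using add.prems[OF that] add.hyps(2)[of x] add.hyps(4)[of x] by simp_all
    have "0 \<le> c" using le by (meson add.hyps(2) order_trans restrict_PiE_iff UNIV_I)
    then have "P (\<lambda>x. (1 * v x + u x) * indicator ?Q x)"
      using le add by (intro lin[OF add.IH(2) add.IH(1), where c = c]) auto
    then show ?case by simp
  next
    case (seq U)
    have mono: "U i x \<le> u x" if "x \<in> ?T" for i x
      using seq.hyps(3) seq.hyps(4)[of x] that
      by (intro incseq_le[of "\<lambda>i. U i x"]) (auto simp: space_PiM incseq_def le_fun_def)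
    have "0 \<le> c" using seq.prems that(2) by (meson \<open>\<And>x. 0 \<le> u x\<close> order_trans restrict_PiE_iff UNIV_I)
    show ?case
    proof (rule lim[of U, where c = c])
      show "P (\<lambda>x. U k x * indicator ?Q x)" for k
        by (rule seq.IH[where c = c]) (rule order_trans[OF mono seq.prems])
      show "\<bar>U k x\<bar> \<le> c" if "x \<in> ?T" for k x
        using mono[OF that, of k] seq.prems[OF that] seq.hyps(2)[of k x] by simp
      show "\<bar>u x\<bar> \<le> c" if "x \<in> ?T" for x
        using seq.prems[OF that] \<open>\<And>x. 0 \<le> u x\<close> by simp
      show "(\<lambda>k. U k x) \<longlonglongrightarrow> u x" if "x \<in> ?Q" for x
        using seq.hyps(4)[of x] that QT by (auto simp: space_PiM)
    qed (use seq \<open>0 \<le> c\<close> \<open>u \<in> _\<close> in auto)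
  qed
  have "0 \<le> b" using gb by (meson abs_ge_zero order_trans restrict_PiE_iff UNIV_I)
  \<comment> \<open>The positive and the negative part are treated separately; the cut-off changes nothing because the support of \<open>g\<close> lies in the cube.\<close>
  have "P (\<lambda>x. (-1 * max 0 (- g x) + max 0 (g x)) * indicator ?Q x)"
    using gm gb \<open>0 \<le> b\<close>
    by (intro lin[OF nonneg[where c = b] nonneg[where c = b], where c = b]) (auto simp: abs_le_iff)
  then show "P g"
  proof (rule limit[rotated, where H = "\<lambda>_ x. (-1 * max 0 (- g x) + max 0 (g x)) * indicator ?Q x"])
    have eq: "(-1 * max 0 (- g x) + max 0 (g x)) * indicator ?Q x = g x" if "x \<in> ?T" for x
      using gC[OF that] Q(3) by (auto simp: max_def indicator_def PiE_iff)
    show "(\<lambda>x. (-1 * max 0 (- g x) + max 0 (g x)) * indicator ?Q x) \<in> B0_tuples n"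
    proof (rule B0I[where c = b])
      show "\<bar>-1 * max 0 (- g x) + max 0 (g x)\<bar> \<le> b" if "x \<in> ?T" for x
        using gb[OF that] by (auto simp: max_def)
    qed (use gm \<open>0 \<le> b\<close> in auto)
    show "g \<in> B0_tuples n" by fact
    show "compact C" by fact
    show "\<bar>(-1 * max 0 (- g x) + max 0 (g x)) * indicator ?Q x\<bar> \<le> b" if "x \<in> ?T" for x
      unfolding eq[OF that] by (rule gb[OF that])
    show "x \<in> PiE {..<n} (\<lambda>_. C)"
      if "x \<in> ?T" "(-1 * max 0 (- g x) + max 0 (g x)) * indicator ?Q x \<noteq> 0" for x
      using that gC[OF that(1)] unfolding eq[OF that(1)] by simp
    show "(\<lambda>k. (-1 * max 0 (- g x) + max 0 (g x)) * indicator ?Q x) \<longlonglongrightarrow> g x" if "x \<in> ?T" for x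
      unfolding eq[OF that] by simp
  qed
qed


section \<open>Orthogonal polynomials with constant Jacobi coefficients\<close>

text \<open>The roots of \<open>r\<close> form a finite set of full measure, from which those of measure zero may be dropped.\<close>

lemma supported_on_exactly_if_poly_zero:
  assumes M: "sets M = sets borel" and r: "r \<noteq> 0" "AE s in M. poly r s = 0"
  shows "\<exists>N. supported_on_exactly M N"
proof -
  let ?R = "{s. poly r s = 0}"
  let ?S = "{s \<in> ?R. 0 < emeasure M {s}}"
  have fin: "finite ?R" using r(1) by (rule poly_roots_finite)
  have "AE x in M. \<forall>s\<in>?R - ?S. x \<noteq> s"
  proof (rule AE_finite_allI)
    show "finite (?R - ?S)" using fin by auto
    fix s assume "s \<in> ?R - ?S"
    then have "{s} \<in> null_sets M" using M by (auto simp: null_sets_def)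
    then show "AE x in M. x \<noteq> s" by (drule_tac AE_not_in) simp
  qed
  with r(2) have "AE s in M. s \<in> ?S" by eventually_elim blast
  moreover have "finite ?S" using fin by auto
  ultimately show ?thesis unfolding supported_on_exactly_def by blast
qed

text \<open>One fibre \<open>\<mu>(t, \<cdot>)\<close>, with \<open>L = \<lambda>(t)\<close> and \<open>e = \<eta>(t)\<close>. The last assumption is the convention
  \<open>a\<^sup>(\<^sup>n\<^sup>) = 0\<close> beyond a finite support, which for constant coefficients forces \<open>e = 0\<close>.\<close>

locale constant_jacobi = prob_space M for M :: "real measure" +
  fixes p :: "nat \<Rightarrow> real poly" and L e R :: real
  assumes sets_M [measurable_cong]: "sets M = sets borel"
    and bounded_support: "AE s in M. \<bar>s\<bar> \<le> R"
    and monic: "monic_orthogonal M p"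
    and recurrence: "\<And>n. AE s in M. s * poly (p n) s = poly (p (Suc n)) s + L * poly (p n) s +
      (case n of 0 \<Rightarrow> 0 | Suc k \<Rightarrow> e * poly (p k) s)"
    and e_zero: "\<And>N n. supported_on_exactly M N \<Longrightarrow> N \<le> Suc n \<Longrightarrow> e = 0"
begin

lemma measurable_poly [measurable]: "poly q \<in> borel_measurable M"
  unfolding measurable_cong_sets[OF sets_M refl]
  by (intro borel_measurable_continuous_onI continuous_on_poly continuous_on_id)

lemma integrable_poly: "integrable M (poly q)"
proof -
  have "compact (poly q ` {-R..R})"
    by (intro compact_continuous_image continuous_on_poly continuous_on_id compact_Icc)
  then obtain c where c: "\<forall>y\<in>poly q ` {-R..R}. norm y \<le> c"
    using compact_imp_bounded bounded_iff by metis
  show ?thesis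
  proof (rule integrable_const_bound[where B = c])
    show "AE s in M. norm (poly q s) \<le> c"
      using bounded_support by eventually_elim (use c in \<open>auto simp: abs_le_iff\<close>)
  qed simp
qed

lemma not_supported_on_0: "\<not> supported_on_exactly M 0"
proof
  assume "supported_on_exactly M 0"
  then have "AE s in M. False" unfolding supported_on_exactly_def by auto
  then show False by simp
qed

lemma p_0: "p 0 = 1"
proof -
  have "degree (p 0) = 0" "lead_coeff (p 0) = 1"
    using monic not_supported_on_0 unfolding monic_orthogonal_def by (auto elim!: allE[of _ 0])
  then show ?thesis by (metis degree_0_id one_pCons)
qed

lemma orthogonal: "m \<noteq> n \<Longrightarrow> (\<integral>s. poly (p n * p m) s \<partial>M) = 0"
proof (induction m n rule: linorder_wlog)
  case (le m n)
  then have "m < n" by simp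
  with monic show ?case
    unfolding monic_orthogonal_def by (cases "\<exists>N\<le>n. supported_on_exactly M N") auto
next
  case (sym m n)
  then show ?case by (simp add: mult.commute)
qed

lemma integral_p_Suc: "(\<integral>s. poly (p (Suc n)) s \<partial>M) = 0"
  using orthogonal[of 0 "Suc n"] by (simp add: p_0)

lemma integral_recurrence:
  "(\<integral>s. poly ([:0, 1:] * p n * r) s \<partial>M) = (\<integral>s. poly (p (Suc n) * r) s \<partial>M) +
    L * (\<integral>s. poly (p n * r) s \<partial>M) + (case n of 0 \<Rightarrow> 0 | Suc k \<Rightarrow> e * (\<integral>s. poly (p k * r) s \<partial>M))"
proof -
  let ?q = "case n of 0 \<Rightarrow> 0 | Suc k \<Rightarrow> smult e (p k * r)"
  have "(\<integral>s. poly ([:0, 1:] * p n * r) s \<partial>M) =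
      (\<integral>s. poly (p (Suc n) * r) s + (L * poly (p n * r) s + poly ?q s) \<partial>M)"
  proof (rule integral_cong_AE)
    show "AE s in M. poly ([:0, 1:] * p n * r) s =
      poly (p (Suc n) * r) s + (L * poly (p n * r) s + poly ?q s)"
      using recurrence[of n]
    proof eventually_elim
      fix s assume rec: "s * poly (p n) s = poly (p (Suc n)) s + L * poly (p n) s +
        (case n of 0 \<Rightarrow> 0 | Suc k \<Rightarrow> e * poly (p k) s)"
      have "poly ([:0, 1:] * p n * r) s = (s * poly (p n) s) * poly r s" by simp
      also have "\<dots> = poly (p (Suc n) * r) s + (L * poly (p n * r) s + poly ?q s)"
        unfolding rec by (cases n) (simp_all add: algebra_simps)
      finally show "poly ([:0, 1:] * p n * r) s =
        poly (p (Suc n) * r) s + (L * poly (p n * r) s + poly ?q s)" .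
    qed
  qed measurable
  also have "\<dots> = (\<integral>s. poly (p (Suc n) * r) s \<partial>M) + (L * (\<integral>s. poly (p n * r) s \<partial>M) + (\<integral>s. poly ?q s \<partial>M))"
    by (subst Bochner_Integration.integral_add, (intro integrable_poly
        Bochner_Integration.integrable_add integrable_mult_right)+)
       (simp only: Bochner_Integration.integral_add[OF integrable_mult_right[OF integrable_poly] integrable_poly] integral_mult_right_zero)
  also have "(\<integral>s. poly ?q s \<partial>M) = (case n of 0 \<Rightarrow> 0 | Suc k \<Rightarrow> e * (\<integral>s. poly (p k * r) s \<partial>M))"
    by (cases n) (simp_all del: poly_mult)
  finally show ?thesis by simp
qed

text \<open>Evaluating \<open>\<integral> s p\<^sub>n p\<^sub>n\<^sub>+\<^sub>1\<close> by the recurrence at \<open>n\<close> and at \<open>n + 1\<close> relates consecutive norms.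
  A finite support fits in: there \<open>e = 0\<close>, and the norms are \<open>0\<^sup>0 = 1\<close> for \<open>n = 0\<close> and \<open>0\<close> afterwards.\<close>

lemma norm_p: "(\<integral>s. (poly (p n) s)\<^sup>2 \<partial>M) = e ^ n"
proof -
  have "(\<integral>s. poly (p n * p n) s \<partial>M) = e ^ n"
  proof (induction n)
    case 0
    then show ?case by (simp add: p_0 prob_space)
  next
    case (Suc n)
    have "(\<integral>s. poly (p (Suc n) * p (Suc n)) s \<partial>M) = (\<integral>s. poly ([:0, 1:] * p n * p (Suc n)) s \<partial>M)"
      by (subst integral_recurrence) (auto simp: orthogonal simp del: poly_mult split: nat.split)
    also have "\<dots> = (\<integral>s. poly ([:0, 1:] * p (Suc n) * p n) s \<partial>M)"
      by (simp add: mult_ac)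
    also have "\<dots> = e * (\<integral>s. poly (p n * p n) s \<partial>M)"
      by (subst integral_recurrence) (simp add: orthogonal del: poly_mult)
    finally show ?case using Suc by simp
  qed
  then show ?thesis by (simp add: power2_eq_square)
qed

lemma degenerate:
  assumes "AE s in M. s = L"
  shows "p (Suc n) = 0" "e = 0"
proof -
  have "supported_on_exactly M 1"
    unfolding supported_on_exactly_def
  proof (intro exI[of _ "{L}"] conjI ballI)
    fix s assume "s \<in> {L}"
    have "emeasure M {L} = emeasure M (space M)"
      by (rule emeasure_eq_AE) (use assms sets_M in auto)
    then show "0 < emeasure M {s}" using \<open>s \<in> {L}\<close> emeasure_space_1 by simp
  qed (use assms in auto)
  then have "\<exists>N\<le>Suc n. supported_on_exactly M N" and "e = 0"
    using e_zero[of 1 0] by auto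
  with monic show "p (Suc n) = 0" "e = 0" unfolding monic_orthogonal_def by presburger+
qed

text \<open>Constant coefficients leave no room between a point mass and an infinite support: on a finite
  support \<open>e = 0\<close>, hence \<open>p\<^sub>1\<close>, almost everywhere equal to \<open>s - L\<close>, has norm zero.\<close>

lemma nondegenerate_infinite_support:
  assumes "\<not> (AE s in M. s = L)"
  shows "\<not> supported_on_exactly M N"
proof
  assume N: "supported_on_exactly M N"
  then obtain k where "N = Suc k" using not_supported_on_0 by (cases N) auto
  with N have "e = 0" using e_zero[of N k] by simp
  then have "(\<integral>s. (poly (p 1) s)\<^sup>2 \<partial>M) = 0" by (simp add: norm_p)
  moreover have "integrable M (\<lambda>s. (poly (p 1) s)\<^sup>2)"
  proof -
    have "(\<lambda>s. (poly (p 1) s)\<^sup>2) = poly (p 1 * p 1)" by (auto simp: fun_eq_iff power2_eq_square)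
    then show ?thesis by (simp only: integrable_poly)
  qed
  ultimately have "AE s in M. poly (p 1) s = 0"
    by (subst (asm) integral_nonneg_eq_0_iff_AE) auto
  with recurrence[of 0] have "AE s in M. s = L"
    by eventually_elim (simp add: p_0)
  with assms show False by simp
qed

lemma nondegenerate_recurrence:
  assumes "\<not> (AE s in M. s = L)"
  shows "p (Suc 0) = [:-L, 1:]" "p (Suc (Suc n)) = [:-L, 1:] * p (Suc n) - smult e (p n)"
proof -
  have zero: "r = 0" if "AE s in M. poly r s = 0" for r
    using supported_on_exactly_if_poly_zero[OF sets_M _ that] nondegenerate_infinite_support[OF assms]
    by blast
  have "AE s in M. poly (p (Suc 0) - [:-L, 1:]) s = 0"
    using recurrence[of 0] by eventually_elim (simp add: p_0 algebra_simps)
  from zero[OF this] show "p (Suc 0) = [:-L, 1:]" by simp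
  have "AE s in M. poly (p (Suc (Suc n)) - ([:-L, 1:] * p (Suc n) - smult e (p n))) s = 0"
    using recurrence[of "Suc n"] by eventually_elim (simp add: algebra_simps)
  from zero[OF this] show "p (Suc (Suc n)) = [:-L, 1:] * p (Suc n) - smult e (p n)" by simp
qed

end

text \<open>The polynomials given by the recurrence; they are jointly measurable in the parameters and the
  variable, which cannot be read off from the definition of \<open>p\<close> by orthogonality.\<close>

fun jacobi_poly :: "real \<Rightarrow> real \<Rightarrow> nat \<Rightarrow> real \<Rightarrow> real" where
  "jacobi_poly L e 0 s = 1"
| "jacobi_poly L e (Suc 0) s = s - L"
| "jacobi_poly L e (Suc (Suc n)) s = (s - L) * jacobi_poly L e (Suc n) s - e * jacobi_poly L e n s"

lemma measurable_jacobi_poly [measurable (raw)]: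
  assumes [measurable]: "f \<in> borel_measurable N" "g \<in> borel_measurable N" "h \<in> borel_measurable N"
  shows "(\<lambda>x. jacobi_poly (f x) (g x) n (h x)) \<in> borel_measurable N"
proof -
  have "(\<lambda>x. jacobi_poly (f x) (g x) n (h x)) \<in> borel_measurable N \<and>
    (\<lambda>x. jacobi_poly (f x) (g x) (Suc n) (h x)) \<in> borel_measurable N"
    by (induction n) auto
  then show ?thesis ..
qed

lemma (in constant_jacobi) poly_p_eq:
  "poly (p n) s = (if AE s in M. s = L then if n = 0 then 1 else 0 else jacobi_poly L e n s)"
proof (cases "AE s in M. s = L")
  case True
  then show ?thesis using degenerate(1) by (cases n) (simp_all add: p_0)
next
  case False
  have "poly (p n) s = jacobi_poly L e n s \<and> poly (p (Suc n)) s = jacobi_poly L e (Suc n) s"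
    by (induction n) (simp_all add: p_0 nondegenerate_recurrence[OF False] algebra_simps)
  with False show ?thesis by simp
qed


section \<open>The measure on the product of the space and the line\<close>

locale jacobi_field =
  fixes \<sigma> :: "'a::{second_countable_topology, t2_space} measure"
    and \<mu> :: "'a \<Rightarrow> real measure"
    and p :: "nat \<Rightarrow> 'a \<Rightarrow> real poly"
    and lam \<eta> :: "'a \<Rightarrow> real"
  assumes locally_compact: "locally_compact_space (euclidean :: 'a topology)"
    and radon: "radon_measure \<sigma>"
    and kernel: "\<mu> \<in> borel \<rightarrow>\<^sub>M prob_algebra borel"
    and constant_jacobi: "\<And>t. \<exists>R. constant_jacobi (\<mu> t) (\<lambda>n. p n t) (lam t) (\<eta> t) R"
    and continuous_lam: "continuous_on UNIV lam"
    and continuous_eta: "continuous_on UNIV \<eta>"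
    and eta_nonneg: "\<And>t. 0 \<le> \<eta> t"
begin

abbreviation "\<rho> \<equiv> sigma_tilde \<sigma> \<mu>"

lemma sets_sigma [measurable_cong]: "sets \<sigma> = sets borel"
  using radon by (simp add: radon_measure_def)

lemma emeasure_compact_finite: "compact C \<Longrightarrow> emeasure \<sigma> C < \<infinity>"
  using radon by (simp add: radon_measure_def)

lemma measurable_lam [measurable]: "lam \<in> borel_measurable borel"
  by (rule borel_measurable_continuous_onI[OF continuous_lam])

lemma measurable_eta [measurable]: "\<eta> \<in> borel_measurable borel"
  by (rule borel_measurable_continuous_onI[OF continuous_eta])

lemma kernel_subprob: "\<mu> \<in> borel \<rightarrow>\<^sub>M subprob_algebra borel"
  by (rule measurable_prob_algebraD[OF kernel])

lemma sets_mu: "sets (\<mu> t) = sets borel"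
  using constant_jacobi[of t] by (auto simp: constant_jacobi_def constant_jacobi_axioms_def)

lemma prob_mu: "prob_space (\<mu> t)"
  using constant_jacobi[of t] by (auto simp: constant_jacobi_def)

lemma measurable_nn_integral_mu:
  assumes "f \<in> borel_measurable (borel \<Otimes>\<^sub>M borel)"
  shows "(\<lambda>t. \<integral>\<^sup>+s. f (t, s) \<partial>\<mu> t) \<in> borel_measurable borel"
  by (rule nn_integral_measurable_subprob_algebra2[OF _ kernel_subprob]) (use assms in simp)

lemma measurable_section:
  assumes "f \<in> (borel \<Otimes>\<^sub>M borel) \<rightarrow>\<^sub>M N"
  shows "(\<lambda>s. f (t, s)) \<in> \<mu> t \<rightarrow>\<^sub>M N"
  unfolding measurable_cong_sets[OF sets_mu refl] using assms by measurable

lemma exhaustion: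
  obtains Q :: "nat \<Rightarrow> 'a set" where "\<And>m. open (Q m)" "\<And>m. compact (closure (Q m))"
    "incseq Q" "(\<Union>m. Q m) = UNIV"
  using locally_compact_exhaustion[OF locally_compact] by blast

lemma sigma_finite_if_finite_on_compacts:
  assumes M: "sets M = sets borel" and fin: "\<And>C :: 'a set. compact C \<Longrightarrow> emeasure M C < \<infinity>"
  shows "sigma_finite_measure M"
proof -
  obtain Q :: "nat \<Rightarrow> 'a set" where Q: "\<And>m. open (Q m)" "\<And>m. compact (closure (Q m))"
    "(\<Union>m. Q m) = UNIV"
    by (rule exhaustion) blast
  have "emeasure M (Q m) < \<infinity>" for m
    using emeasure_mono[OF closure_subset, of "Q m" M] fin[OF Q(2)] M
    by (simp add: le_less_trans)
  then show ?thesis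
    using Q sets_eq_imp_space_eq[OF M]
    by (intro sigma_finite_measure.intro exI[of _ "range Q"]) (auto simp: M less_top)
qed

sublocale sigma: sigma_finite_measure \<sigma>
  by (rule sigma_finite_if_finite_on_compacts[OF sets_sigma emeasure_compact_finite])

lemma sets_rho [measurable_cong]: "sets \<rho> = sets (borel \<Otimes>\<^sub>M borel)"
proof -
  have "sets (borel \<Otimes>\<^sub>M borel) \<subseteq> Pow (UNIV :: ('a \<times> real) set)" by simp
  from sets_measure_of[OF this] show ?thesis
    using sets.sigma_sets_eq[of "borel \<Otimes>\<^sub>M borel :: ('a \<times> real) measure"]
    by (simp add: sigma_tilde_def space_pair_measure)
qed

lemma space_rho: "space \<rho> = UNIV"
  using sets_eq_imp_space_eq[OF sets_rho] by (simp add: space_pair_measure)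

lemma emeasure_rho:
  assumes A: "A \<in> sets (borel \<Otimes>\<^sub>M borel)"
  shows "emeasure \<rho> A = (\<integral>\<^sup>+ t. (\<integral>\<^sup>+ s. indicator A (t, s) \<partial>\<mu> t) \<partial>\<sigma>)"
  unfolding sigma_tilde_def
proof (rule emeasure_measure_of_sigma[OF _ _ _ A])
  show "sigma_algebra (UNIV :: ('a \<times> real) set) (sets (borel \<Otimes>\<^sub>M borel))"
    using sets.sigma_algebra_axioms[of "borel \<Otimes>\<^sub>M borel :: ('a \<times> real) measure"]
    by (simp add: space_pair_measure)
  show "positive (sets (borel \<Otimes>\<^sub>M borel)) (\<lambda>A. \<integral>\<^sup>+ t. (\<integral>\<^sup>+ s. indicator A (t, s) \<partial>\<mu> t) \<partial>\<sigma>)"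
    by (simp add: positive_def)
  show "countably_additive (sets (borel \<Otimes>\<^sub>M borel)) (\<lambda>A. \<integral>\<^sup>+ t. (\<integral>\<^sup>+ s. indicator A (t, s) \<partial>\<mu> t) \<partial>\<sigma>)"
  proof (rule countably_additiveI)
    fix A :: "nat \<Rightarrow> ('a \<times> real) set"
    assume r: "range A \<subseteq> sets (borel \<Otimes>\<^sub>M borel)" and d: "disjoint_family A"
    have A: "A i \<in> sets (borel \<Otimes>\<^sub>M borel)" for i using r by auto
    have m: "(\<lambda>t. \<integral>\<^sup>+ s. indicator (A i) (t, s) \<partial>\<mu> t) \<in> borel_measurable \<sigma>" for i
      unfolding measurable_cong_sets[OF sets_sigma refl]
      by (rule measurable_nn_integral_mu) (use A in measurable)
    have "(\<Sum>i. \<integral>\<^sup>+ t. (\<integral>\<^sup>+ s. indicator (A i) (t, s) \<partial>\<mu> t) \<partial>\<sigma>)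
        = (\<integral>\<^sup>+ t. (\<Sum>i. \<integral>\<^sup>+ s. indicator (A i) (t, s) \<partial>\<mu> t) \<partial>\<sigma>)"
      by (rule nn_integral_suminf[symmetric, OF m])
    also have "\<dots> = (\<integral>\<^sup>+ t. (\<integral>\<^sup>+ s. (\<Sum>i. indicator (A i) (t, s)) \<partial>\<mu> t) \<partial>\<sigma>)"
      by (intro nn_integral_cong nn_integral_suminf[symmetric] measurable_section
          borel_measurable_indicator A)
    also have "\<dots> = (\<integral>\<^sup>+ t. (\<integral>\<^sup>+ s. indicator (\<Union>i. A i) (t, s) \<partial>\<mu> t) \<partial>\<sigma>)"
      by (simp add: suminf_indicator[OF d])
    finally show "(\<Sum>i. \<integral>\<^sup>+ t. (\<integral>\<^sup>+ s. indicator (A i) (t, s) \<partial>\<mu> t) \<partial>\<sigma>)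
        = (\<integral>\<^sup>+ t. (\<integral>\<^sup>+ s. indicator (\<Union>i. A i) (t, s) \<partial>\<mu> t) \<partial>\<sigma>)" .
  qed
qed

text \<open>Tonelli's theorem for the kernel \<open>\<mu>\<close>, by the usual extension from indicators.\<close>

lemma nn_integral_rho:
  assumes "f \<in> borel_measurable (borel \<Otimes>\<^sub>M borel)"
  shows "(\<integral>\<^sup>+z. f z \<partial>\<rho>) = (\<integral>\<^sup>+ t. (\<integral>\<^sup>+ s. f (t, s) \<partial>\<mu> t) \<partial>\<sigma>)"
  using assms
proof (induction rule: borel_measurable_induct)
  case (cong f g)
  then have "f = g" by (auto simp: space_pair_measure fun_eq_iff)
  with cong show ?case by simp
next
  case (set A)
  then show ?case by (simp add: nn_integral_indicator sets_rho emeasure_rho)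
next
  case (mult u c)
  have "(\<integral>\<^sup>+z. c * u z \<partial>\<rho>) = c * (\<integral>\<^sup>+z. u z \<partial>\<rho>)"
    by (rule nn_integral_cmult) (use mult(2) in simp)
  also have "\<dots> = (\<integral>\<^sup>+ t. c * (\<integral>\<^sup>+ s. u (t, s) \<partial>\<mu> t) \<partial>\<sigma>)"
    unfolding mult.IH using measurable_nn_integral_mu[OF mult(2)]
    by (subst nn_integral_cmult) auto
  also have "\<dots> = (\<integral>\<^sup>+ t. (\<integral>\<^sup>+ s. c * u (t, s) \<partial>\<mu> t) \<partial>\<sigma>)"
    by (intro nn_integral_cong nn_integral_cmult[symmetric] measurable_section mult(2))
  finally show ?case .
next
  case (add u v)
  note m = add.hyps(1) add.hyps(3)
  have "(\<integral>\<^sup>+z. v z + u z \<partial>\<rho>) = (\<integral>\<^sup>+z. v z \<partial>\<rho>) + (\<integral>\<^sup>+z. u z \<partial>\<rho>)"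
    by (rule nn_integral_add) (use m in simp_all)
  also have "\<dots> = (\<integral>\<^sup>+ t. (\<integral>\<^sup>+ s. v (t, s) \<partial>\<mu> t) + (\<integral>\<^sup>+ s. u (t, s) \<partial>\<mu> t) \<partial>\<sigma>)"
    unfolding add.IH using measurable_nn_integral_mu[OF m(1)] measurable_nn_integral_mu[OF m(2)]
    by (subst nn_integral_add) auto
  also have "\<dots> = (\<integral>\<^sup>+ t. (\<integral>\<^sup>+ s. v (t, s) + u (t, s) \<partial>\<mu> t) \<partial>\<sigma>)"
    by (intro nn_integral_cong nn_integral_add[symmetric] measurable_section m)
  finally show ?case .
next
  case (seq U)
  note m = seq.hyps(1) and inc = seq.hyps(3)
  have inc': "incseq (\<lambda>i s. U i (t, s))" for t
    using inc by (auto simp: incseq_def le_fun_def)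
  have "(\<integral>\<^sup>+z. (SUP i. U i) z \<partial>\<rho>) = (SUP i. \<integral>\<^sup>+z. U i z \<partial>\<rho>)"
    unfolding SUP_apply
    by (rule nn_integral_monotone_convergence_SUP) (use m inc in simp_all)
  also have "\<dots> = (\<integral>\<^sup>+ t. (SUP i. \<integral>\<^sup>+ s. U i (t, s) \<partial>\<mu> t) \<partial>\<sigma>)"
    unfolding seq.IH
  proof (rule nn_integral_monotone_convergence_SUP[symmetric])
    show "incseq (\<lambda>i t. \<integral>\<^sup>+ s. U i (t, s) \<partial>\<mu> t)"
      using inc by (auto simp: incseq_def le_fun_def intro!: nn_integral_mono)
    show "(\<lambda>t. \<integral>\<^sup>+ s. U i (t, s) \<partial>\<mu> t) \<in> borel_measurable \<sigma>" for i
      using measurable_nn_integral_mu[OF m] by simp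
  qed
  also have "\<dots> = (\<integral>\<^sup>+ t. (\<integral>\<^sup>+ s. (SUP i. U i (t, s)) \<partial>\<mu> t) \<partial>\<sigma>)"
    by (intro nn_integral_cong nn_integral_monotone_convergence_SUP[symmetric] inc'
        measurable_section m)
  finally show ?case by (simp add: SUP_apply image_comp)
qed

sublocale rho: sigma_finite_measure \<rho>
proof -
  obtain Q :: "nat \<Rightarrow> 'a set" where Q: "\<And>m. open (Q m)" "\<And>m. compact (closure (Q m))"
    "(\<Union>m. Q m) = UNIV"
    by (rule exhaustion) blast
  have Qs: "Q m \<times> UNIV \<in> sets (borel \<Otimes>\<^sub>M borel :: ('a \<times> real) measure)" for m
    using Q(1) by (intro pair_measureI) auto
  have "emeasure \<rho> (Q m \<times> UNIV) \<noteq> \<infinity>" for m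
  proof -
    have "emeasure \<rho> (Q m \<times> UNIV) = (\<integral>\<^sup>+ t. (\<integral>\<^sup>+ s. indicator (Q m) t \<partial>\<mu> t) \<partial>\<sigma>)"
      unfolding emeasure_rho[OF Qs] by (simp add: indicator_times)
    also have "\<dots> = (\<integral>\<^sup>+ t. indicator (Q m) t \<partial>\<sigma>)"
      using prob_space.emeasure_space_1[OF prob_mu] by (simp add: nn_integral_const)
    also have "\<dots> = emeasure \<sigma> (Q m)" using Q(1) by (simp add: sets_sigma)
    also have "\<dots> \<le> emeasure \<sigma> (closure (Q m))"
      by (rule emeasure_mono[OF closure_subset]) (simp add: sets_sigma)
    finally show ?thesis using emeasure_compact_finite[OF Q(2)[of m]] by (auto simp: top_unique)
  qed
  then show "sigma_finite_measure \<rho>"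
    using Q(3) Qs
    by (intro sigma_finite_measure.intro exI[of _ "range (\<lambda>m. Q m \<times> UNIV)"])
       (auto simp: space_rho sets_rho set_eq_iff)
qed

lemma AE_rho:
  assumes P: "{z. P z} \<in> sets (borel \<Otimes>\<^sub>M borel)" and ae: "\<And>t. AE s in \<mu> t. P (t, s)"
  shows "AE z in \<rho>. P z"
proof (rule AE_I)
  let ?N = "{z. \<not> P z}"
  have N: "?N \<in> sets (borel \<Otimes>\<^sub>M borel)"
    using sets.compl_sets[OF P] by (simp add: space_pair_measure Compl_eq_Diff_UNIV[symmetric] Collect_neg_eq)
  then show "?N \<in> sets \<rho>" by (simp add: sets_rho)
  have "(\<integral>\<^sup>+ s. indicator ?N (t, s) \<partial>\<mu> t) = 0" for t
  proof -
    have "(\<integral>\<^sup>+ s. indicator ?N (t, s) \<partial>\<mu> t) = (\<integral>\<^sup>+ s. 0 \<partial>\<mu> t)"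
      by (rule nn_integral_cong_AE) (use ae[of t] in \<open>eventually_elim, simp\<close>)
    then show ?thesis by simp
  qed
  then show "emeasure \<rho> ?N = 0" by (simp add: emeasure_rho[OF N])
qed (simp add: space_rho)

lemma fubini_rho_nonneg:
  fixes g :: "'a \<times> real \<Rightarrow> real"
  assumes g: "integrable \<rho> g" "\<And>z. 0 \<le> g z" and sec: "\<And>t. integrable (\<mu> t) (\<lambda>s. g (t, s))"
  shows "integrable \<sigma> (\<lambda>t. \<integral>s. g (t, s) \<partial>\<mu> t)"
    and "(\<integral>z. g z \<partial>\<rho>) = (\<integral>t. (\<integral>s. g (t, s) \<partial>\<mu> t) \<partial>\<sigma>)"
proof -
  have gm: "g \<in> borel_measurable (borel \<Otimes>\<^sub>M borel)"
    using g(1) by (simp add: measurable_cong_sets[OF sets_rho refl] borel_measurable_integrable)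
  have inner: "(\<integral>\<^sup>+ s. ennreal (g (t, s)) \<partial>\<mu> t) = ennreal (\<integral>s. g (t, s) \<partial>\<mu> t)" for t
    by (rule nn_integral_eq_integral[OF sec]) (simp add: g(2))
  have "(\<lambda>t. enn2real (\<integral>\<^sup>+ s. ennreal (g (t, s)) \<partial>\<mu> t)) \<in> borel_measurable borel"
    using gm by (intro borel_measurable_enn2real measurable_nn_integral_mu) simp
  then have m: "(\<lambda>t. \<integral>s. g (t, s) \<partial>\<mu> t) \<in> borel_measurable \<sigma>"
    by (simp add: inner integral_nonneg_AE g(2) measurable_cong_sets[OF sets_sigma refl])
  have e: "(\<integral>\<^sup>+z. ennreal (g z) \<partial>\<rho>) = (\<integral>\<^sup>+t. ennreal (\<integral>s. g (t, s) \<partial>\<mu> t) \<partial>\<sigma>)"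
    using gm by (subst nn_integral_rho) (simp_all add: inner)
  have "(\<integral>\<^sup>+z. ennreal (g z) \<partial>\<rho>) < \<infinity>"
    using g by (simp add: integrable_iff_bounded)
  with e m show "integrable \<sigma> (\<lambda>t. \<integral>s. g (t, s) \<partial>\<mu> t)"
    by (simp add: integrable_iff_bounded integral_nonneg_AE g(2))
  show "(\<integral>z. g z \<partial>\<rho>) = (\<integral>t. (\<integral>s. g (t, s) \<partial>\<mu> t) \<partial>\<sigma>)"
    using g m by (subst (1 2) integral_eq_nn_integral)
      (auto simp: e integral_nonneg_AE borel_measurable_integrable)
qed

lemma fubini_rho:
  fixes g :: "'a \<times> real \<Rightarrow> real"
  assumes g: "integrable \<rho> g" and sec: "\<And>t. integrable (\<mu> t) (\<lambda>s. g (t, s))"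
  shows "(\<integral>z. g z \<partial>\<rho>) = (\<integral>t. (\<integral>s. g (t, s) \<partial>\<mu> t) \<partial>\<sigma>)"
proof -
  let ?P = "\<lambda>z. max 0 (g z)" and ?N = "\<lambda>z. max 0 (- g z)"
  have eq: "g z = ?P z - ?N z" for z by simp
  have i: "integrable \<rho> ?P" "integrable \<rho> ?N" using g by auto
  have s: "integrable (\<mu> t) (\<lambda>s. ?P (t, s))" "integrable (\<mu> t) (\<lambda>s. ?N (t, s))" for t
    using sec[of t] by auto
  note P = fubini_rho_nonneg[OF i(1) _ s(1)] and N = fubini_rho_nonneg[OF i(2) _ s(2)]
  have "(\<integral>z. g z \<partial>\<rho>) = (\<integral>z. ?P z \<partial>\<rho>) - (\<integral>z. ?N z \<partial>\<rho>)"
    using i by (subst eq) (rule Bochner_Integration.integral_diff)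
  also have "\<dots> = (\<integral>t. (\<integral>s. ?P (t, s) \<partial>\<mu> t) - (\<integral>s. ?N (t, s) \<partial>\<mu> t) \<partial>\<sigma>)"
    using P N by simp
  also have "\<dots> = (\<integral>t. (\<integral>s. g (t, s) \<partial>\<mu> t) \<partial>\<sigma>)"
    using s by (intro Bochner_Integration.integral_cong refl)
      (simp only: Bochner_Integration.integral_diff[symmetric] eq[symmetric])
  finally show ?thesis .
qed

subsection \<open>The orthogonal polynomials as functions on the product\<close>

lemma measurable_p [measurable (raw)]:
  assumes [measurable]: "f \<in> N \<rightarrow>\<^sub>M borel" "g \<in> borel_measurable N"
  shows "(\<lambda>x. poly (p l (f x)) (g x)) \<in> borel_measurable N"
proof -
  let ?v = "\<lambda>t. \<integral>\<^sup>+s. ennreal ((s - lam t)\<^sup>2) \<partial>\<mu> t"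
  have v [measurable]: "?v \<in> borel_measurable borel"
    by (rule measurable_nn_integral_mu[of "\<lambda>(t, s). ennreal ((s - lam t)\<^sup>2)", simplified]) measurable
  \<comment> \<open>The set of points with a degenerate fibre is measurable, being the zero set of a variance.\<close>
  have Z: "(AE s in \<mu> t. s = lam t) \<longleftrightarrow> ?v t = 0" for t
  proof -
    have "(\<lambda>s. ennreal ((s - lam t)\<^sup>2)) \<in> borel_measurable (\<mu> t)"
      unfolding measurable_cong_sets[OF sets_mu refl] by measurable
    then show ?thesis by (subst nn_integral_0_iff_AE) (auto simp: ennreal_eq_0_iff)
  qed
  have "poly (p l t) s = (if ?v t = 0 then if l = 0 then 1 else 0 else jacobi_poly (lam t) (\<eta> t) l s)"
    for t s
  proof -
    obtain R where "constant_jacobi (\<mu> t) (\<lambda>n. p n t) (lam t) (\<eta> t) R"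
      using constant_jacobi by blast
    from constant_jacobi.poly_p_eq[OF this, of l s] show ?thesis by (simp only: Z)
  qed
  then show ?thesis by simp
qed

lemma p_0: "p 0 t = 1"
  using constant_jacobi[of t] constant_jacobi.p_0 by blast

lemma integrable_p: "integrable (\<mu> t) (\<lambda>s. poly (p l t) s)"
  using constant_jacobi[of t] constant_jacobi.integrable_poly by blast

lemma integral_p: "(\<integral>s. poly (p l t) s \<partial>\<mu> t) = (if l = 0 then 1 else 0)"
proof -
  obtain R where c: "constant_jacobi (\<mu> t) (\<lambda>n. p n t) (lam t) (\<eta> t) R"
    using constant_jacobi by blast
  show ?thesis
    using constant_jacobi.integral_p_Suc[OF c] prob_space.prob_space[OF prob_mu[of t]]
    by (cases l) (auto simp: p_0)
qed

lemma norm_p: "(\<integral>s. (poly (p l t) s)\<^sup>2 \<partial>\<mu> t) = \<eta> t ^ l"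
  using constant_jacobi[of t] constant_jacobi.norm_p by blast

lemma integrable_p_square: "integrable (\<mu> t) (\<lambda>s. (poly (p l t) s)\<^sup>2)"
proof -
  obtain R where c: "constant_jacobi (\<mu> t) (\<lambda>n. p n t) (lam t) (\<eta> t) R"
    using constant_jacobi by blast
  have "(\<lambda>s. (poly (p l t) s)\<^sup>2) = poly (p l t * p l t)"
    by (auto simp: fun_eq_iff power2_eq_square)
  then show ?thesis by (simp only: constant_jacobi.integrable_poly[OF c])
qed

lemma AE_recurrence:
  "AE z in \<rho>. snd z * poly (p n (fst z)) (snd z) = poly (p (Suc n) (fst z)) (snd z) +
    lam (fst z) * poly (p n (fst z)) (snd z) +
    (case n of 0 \<Rightarrow> 0 | Suc k \<Rightarrow> \<eta> (fst z) * poly (p k (fst z)) (snd z))"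
proof (rule AE_rho)
  fix t
  obtain R where "constant_jacobi (\<mu> t) (\<lambda>n. p n t) (lam t) (\<eta> t) R"
    using constant_jacobi by blast
  from constant_jacobi.recurrence[OF this, of n]
  show "AE s in \<mu> t. snd (t, s) * poly (p n (fst (t, s))) (snd (t, s)) = poly (p (Suc n) (fst (t, s))) (snd (t, s)) +
    lam (fst (t, s)) * poly (p n (fst (t, s))) (snd (t, s)) +
    (case n of 0 \<Rightarrow> 0 | Suc k \<Rightarrow> \<eta> (fst (t, s)) * poly (p k (fst (t, s))) (snd (t, s)))"
    by (simp cong: nat.case_cong)
next
  have "Measurable.pred (borel \<Otimes>\<^sub>M borel) (\<lambda>z. snd z * poly (p n (fst z)) (snd z) = poly (p (Suc n) (fst z)) (snd z) +
    lam (fst z) * poly (p n (fst z)) (snd z) +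
    (case n of 0 \<Rightarrow> 0 | Suc k \<Rightarrow> \<eta> (fst z) * poly (p k (fst z)) (snd z)))"
    by (cases n) simp_all
  then show "{z. snd z * poly (p n (fst z)) (snd z) = poly (p (Suc n) (fst z)) (snd z) +
    lam (fst z) * poly (p n (fst z)) (snd z) +
    (case n of 0 \<Rightarrow> 0 | Suc k \<Rightarrow> \<eta> (fst z) * poly (p k (fst z)) (snd z))} \<in> sets (borel \<Otimes>\<^sub>M borel)"
    by (simp add: pred_def space_pair_measure)
qed

lemma continuous_bounded_on_compact:
  fixes h :: "'a \<Rightarrow> real"
  assumes "continuous_on UNIV h" "compact C"
  obtains b where "\<And>t. t \<in> C \<Longrightarrow> \<bar>h t\<bar> \<le> b" "0 \<le> b"
proof -
  have "compact (h ` C)"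
    by (intro compact_continuous_image continuous_on_subset[OF assms(1)] assms(2)) auto
  then obtain b where b: "\<forall>y\<in>h ` C. norm y \<le> b"
    using compact_imp_bounded bounded_iff by metis
  then show thesis by (intro that[of "max 0 b"]) force+
qed

lemma integrable_sigma_compact_support:
  fixes \<phi> :: "'a \<Rightarrow> real"
  assumes "\<phi> \<in> borel_measurable borel" "compact C" "\<And>t. \<bar>\<phi> t\<bar> \<le> c" "\<And>t. \<phi> t \<noteq> 0 \<Longrightarrow> t \<in> C"
  shows "integrable \<sigma> \<phi>"
proof (rule Bochner_Integration.integrable_bound)
  show "integrable \<sigma> (\<lambda>t. c * indicator C t)"
    using assms(2) emeasure_compact_finite[OF assms(2)]
    by (intro integrable_mult_right integrable_real_indicator) (auto simp: sets_sigma compact_imp_closed)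
  have "\<bar>\<phi> t\<bar> \<le> c * indicator C t" for t
    using assms(3)[of t] assms(4)[of t] by (cases "t \<in> C") auto
  then show "AE t in \<sigma>. norm (\<phi> t) \<le> norm (c * indicator C t)"
    by (auto intro: order_trans[OF _ abs_ge_self])
qed (use assms(1) in simp)

text \<open>Integrating a polynomial \<open>p\<^sup>(\<^sup>l\<^sup>)\<close> over its variable leaves only \<open>l = 0\<close>; this is why the
  annihilation part of the field is the bare \<open>\<partial>\<^sub>t\<close>.\<close>

lemma integral_rho_p:
  fixes \<phi> :: "'a \<Rightarrow> real"
  assumes \<phi>: "\<phi> \<in> borel_measurable borel" "compact C" "\<And>t. \<bar>\<phi> t\<bar> \<le> c" "\<And>t. \<phi> t \<noteq> 0 \<Longrightarrow> t \<in> C"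
  shows "integrable \<rho> (\<lambda>z. \<phi> (fst z) * poly (p l (fst z)) (snd z))"
    and "(\<integral>z. \<phi> (fst z) * poly (p l (fst z)) (snd z) \<partial>\<rho>) = (if l = 0 then \<integral>t. \<phi> t \<partial>\<sigma> else 0)"
proof -
  note [measurable] = \<phi>(1)
  let ?g = "\<lambda>z. \<phi> (fst z) * poly (p l (fst z)) (snd z)"
  have gm: "?g \<in> borel_measurable (borel \<Otimes>\<^sub>M borel)" by measurable
  have abs_le: "(\<integral>\<^sup>+s. ennreal \<bar>?g (t, s)\<bar> \<partial>\<mu> t) \<le> ennreal (\<bar>\<phi> t\<bar> * (1 + \<eta> t ^ l))" for t
  proof -
    interpret prob_space "\<mu> t" by (rule prob_mu)
    have "(\<integral>\<^sup>+s. ennreal \<bar>?g (t, s)\<bar> \<partial>\<mu> t) \<le> (\<integral>\<^sup>+s. ennreal (\<bar>\<phi> t\<bar> * (1 + (poly (p l t) s)\<^sup>2)) \<partial>\<mu> t)"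
    proof (intro nn_integral_mono ennreal_leI)
      fix s
      \<comment> \<open>Only the square norms are known, so they have to dominate the first absolute moments.\<close>
      have "\<bar>poly (p l t) s\<bar> \<le> 1 + (poly (p l t) s)\<^sup>2"
        using sum_squares_bound[of 1 "\<bar>poly (p l t) s\<bar>"] by simp
      then show "\<bar>?g (t, s)\<bar> \<le> \<bar>\<phi> t\<bar> * (1 + (poly (p l t) s)\<^sup>2)"
        by (simp add: abs_mult mult_left_mono)
    qed
    also have "\<dots> = ennreal (\<integral>s. \<bar>\<phi> t\<bar> * (1 + (poly (p l t) s)\<^sup>2) \<partial>\<mu> t)"
      using integrable_p_square[of t l] by (intro nn_integral_eq_integral) auto
    also have "(\<integral>s. \<bar>\<phi> t\<bar> * (1 + (poly (p l t) s)\<^sup>2) \<partial>\<mu> t) = \<bar>\<phi> t\<bar> * (1 + \<eta> t ^ l)"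
      using integrable_p_square[of t l] by (simp add: norm_p prob_space)
    finally show ?thesis .
  qed
  have "continuous_on UNIV (\<lambda>t. 1 + \<eta> t ^ l)"
    by (intro continuous_intros continuous_eta)
  then obtain b where b: "\<And>t. t \<in> C \<Longrightarrow> \<bar>1 + \<eta> t ^ l\<bar> \<le> b" "0 \<le> b"
    using continuous_bounded_on_compact[OF _ \<phi>(2)] by blast
  have "0 \<le> c" using \<phi>(3) by (meson abs_ge_zero order_trans)
  have "integrable \<sigma> (\<lambda>t. \<bar>\<phi> t\<bar> * (1 + \<eta> t ^ l))"
  proof (rule integrable_sigma_compact_support[OF _ \<phi>(2)])
    show "\<bar>\<bar>\<phi> t\<bar> * (1 + \<eta> t ^ l)\<bar> \<le> c * b" for t
    proof (cases "t \<in> C")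
      case True
      then show ?thesis unfolding abs_mult abs_abs using \<phi>(3)[of t] b(1)[of t] \<open>0 \<le> c\<close>
        by (intro mult_mono) auto
    next
      case False
      then have "\<phi> t = 0" using \<phi>(4) by blast
      then show ?thesis using \<open>0 \<le> c\<close> b(2) by simp
    qed
  qed (use \<phi>(4) in auto)
  then have "(\<integral>\<^sup>+t. ennreal (\<bar>\<phi> t\<bar> * (1 + \<eta> t ^ l)) \<partial>\<sigma>) < \<infinity>"
    using eta_nonneg by (simp add: integrable_iff_bounded abs_mult)
  moreover have "(\<integral>\<^sup>+z. ennreal \<bar>?g z\<bar> \<partial>\<rho>) \<le> (\<integral>\<^sup>+t. ennreal (\<bar>\<phi> t\<bar> * (1 + \<eta> t ^ l)) \<partial>\<sigma>)"
    using gm by (subst nn_integral_rho) (auto intro!: nn_integral_mono abs_le[simplified])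
  ultimately show i: "integrable \<rho> ?g"
    using gm by (auto simp: integrable_iff_bounded)
  show "(\<integral>z. ?g z \<partial>\<rho>) = (if l = 0 then \<integral>t. \<phi> t \<partial>\<sigma> else 0)"
    using integrable_p by (subst fubini_rho[OF i]) (auto simp: integral_p)
qed

end


section \<open>The isomorphism on bounded functions of compact support\<close>

context jacobi_field
begin

lemma sigma_l_eq: "sigma_l \<sigma> \<mu> p l = density \<sigma> (\<lambda>t. ennreal (\<eta> t ^ l))"
  by (simp add: sigma_l_def norm_p)

lemma sets_sigma_l [measurable_cong]: "sets (sigma_l \<sigma> \<mu> p l) = sets borel"
  by (simp add: sigma_l_eq sets_sigma)

lemma space_sigma_l: "space (sigma_l \<sigma> \<mu> p l) = UNIV"
  using sets_eq_imp_space_eq[OF sets_sigma_l] by simp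

lemma emeasure_sigma_l_finite:
  assumes C: "compact C"
  shows "emeasure (sigma_l \<sigma> \<mu> p l) C < \<infinity>"
proof -
  have Cm: "C \<in> sets borel" using C by (simp add: compact_imp_closed)
  have "continuous_on UNIV (\<lambda>t. \<eta> t ^ l)" by (intro continuous_intros continuous_eta)
  then obtain b where b: "\<And>t. t \<in> C \<Longrightarrow> \<bar>\<eta> t ^ l\<bar> \<le> b" "0 \<le> b"
    using continuous_bounded_on_compact[OF _ C] by blast
  have "emeasure (sigma_l \<sigma> \<mu> p l) C = (\<integral>\<^sup>+t. ennreal (\<eta> t ^ l) * indicator C t \<partial>\<sigma>)"
    unfolding sigma_l_eq using Cm by (subst emeasure_density) (simp_all add: sets_sigma)
  also have "\<dots> \<le> (\<integral>\<^sup>+t. ennreal b * indicator C t \<partial>\<sigma>)"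
    using b(1) by (intro nn_integral_mono) (auto simp: indicator_def abs_le_iff intro!: ennreal_leI)
  also have "\<dots> = ennreal b * emeasure \<sigma> C"
    using Cm by (simp add: nn_integral_cmult_indicator sets_sigma)
  also have "\<dots> < \<infinity>"
    using emeasure_compact_finite[OF C] by (simp add: ennreal_mult_less_top)
  finally show ?thesis .
qed

lemma sigma_finite_sigma_l: "sigma_finite_measure (sigma_l \<sigma> \<mu> p l)"
  by (rule sigma_finite_if_finite_on_compacts[OF sets_sigma_l emeasure_sigma_l_finite])

lemma measurable_diag_sigma_l:
  "diag ls \<in> PiM {..<length ls} (\<lambda>j. sigma_l \<sigma> \<mu> p (ls ! j)) \<rightarrow>\<^sub>M
    PiM {..<sum_list ls + length ls} (\<lambda>_. borel)"
proof (rule measurable_diag[where g = "\<lambda>x. x"])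
  fix j assume "j < length ls"
  then have "(\<lambda>x. x j) \<in> PiM {..<length ls} (\<lambda>j. sigma_l \<sigma> \<mu> p (ls ! j)) \<rightarrow>\<^sub>M sigma_l \<sigma> \<mu> p (ls ! j)"
    by (intro measurable_component_singleton) simp
  then show "(\<lambda>x. x j) \<in> PiM {..<length ls} (\<lambda>j. sigma_l \<sigma> \<mu> p (ls ! j)) \<rightarrow>\<^sub>M borel"
    by (simp add: measurable_cong_sets[OF refl sets_sigma_l])
qed

lemma emeasure_gamma_list_cube_finite:
  assumes C: "compact C"
  shows "emeasure (gamma_list \<sigma> \<mu> p ls) (PiE {..<sum_list ls + length ls} (\<lambda>_. C)) < \<infinity>"
proof -
  interpret P: product_sigma_finite "\<lambda>j. sigma_l \<sigma> \<mu> p (ls ! j)"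
    by (intro product_sigma_finite.intro sigma_finite_sigma_l)
  have Cm: "C \<in> sets borel" using C by (simp add: compact_imp_closed)
  let ?P = "PiM {..<length ls} (\<lambda>j. sigma_l \<sigma> \<mu> p (ls ! j))"
  have "diag ls -` (PiE {..<sum_list ls + length ls} (\<lambda>_. C)) \<inter> space ?P = PiE {..<length ls} (\<lambda>_. C)"
    using diag_in_box_iff[of ls _ C]
    by (simp add: set_eq_iff space_PiM space_sigma_l PiE_def Pi_iff) blast
  moreover have "PiE {..<sum_list ls + length ls} (\<lambda>_. C) \<in> sets (PiM {..<sum_list ls + length ls} (\<lambda>_. borel))"
    using Cm by (intro sets_PiM_I_finite) auto
  ultimately have "emeasure (gamma_list \<sigma> \<mu> p ls) (PiE {..<sum_list ls + length ls} (\<lambda>_. C)) =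
      emeasure ?P (PiE {..<length ls} (\<lambda>_. C))"
    unfolding gamma_list_def by (simp add: emeasure_distr[OF measurable_diag_sigma_l])
  also have "\<dots> = (\<Prod>j<length ls. emeasure (sigma_l \<sigma> \<mu> p (ls ! j)) C)"
    using Cm by (intro P.emeasure_PiM) (auto simp: sets_sigma_l)
  also have "\<dots> < \<infinity>"
  proof -
    have "(\<Prod>j<n. emeasure (sigma_l \<sigma> \<mu> p (ls ! j)) C) < \<infinity>" for n
      using emeasure_sigma_l_finite[OF C] by (induction n) (auto simp: ennreal_mult_less_top)
    then show ?thesis .
  qed
  finally show ?thesis .
qed

abbreviation "\<Gamma> \<equiv> gamma \<sigma> \<mu> p"

lemma sets_gamma [measurable_cong]: "sets (\<Gamma> n) = sets (PiM {..<n} (\<lambda>_. borel))"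
proof -
  have "sets (PiM {..<n} (\<lambda>_. borel)) \<subseteq> Pow (PiE {..<n} (\<lambda>_. UNIV :: 'a set))"
    using sets.space_closed[of "PiM {..<n} (\<lambda>_. borel :: 'a measure)"] by (simp add: space_PiM)
  from sets_measure_of[OF this] show ?thesis
    using sets.sigma_sets_eq[of "PiM {..<n} (\<lambda>_. borel :: 'a measure)"]
    by (simp add: gamma_def space_PiM)
qed

lemma space_gamma: "space (\<Gamma> n) = PiE {..<n} (\<lambda>_. UNIV)"
  using sets_eq_imp_space_eq[OF sets_gamma, of n] by (simp add: space_PiM)

lemma emeasure_gamma:
  assumes A: "A \<in> sets (PiM {..<n} (\<lambda>_. borel))"
  shows "emeasure (\<Gamma> n) A = (\<Sum>ls\<in>compositions n. emeasure (gamma_list \<sigma> \<mu> p ls) A)"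
  unfolding gamma_def
proof (rule emeasure_measure_of_sigma[OF _ _ _ A])
  show "sigma_algebra (PiE {..<n} (\<lambda>_. UNIV :: 'a set)) (sets (PiM {..<n} (\<lambda>_. borel)))"
    using sets.sigma_algebra_axioms[of "PiM {..<n} (\<lambda>_. borel :: 'a measure)"] by (simp add: space_PiM)
  show "positive (sets (PiM {..<n} (\<lambda>_. borel))) (\<lambda>A. \<Sum>ls\<in>compositions n. emeasure (gamma_list \<sigma> \<mu> p ls) A)"
    by (simp add: positive_def)
  show "countably_additive (sets (PiM {..<n} (\<lambda>_. borel)))
      (\<lambda>A. \<Sum>ls\<in>compositions n. emeasure (gamma_list \<sigma> \<mu> p ls) A)"
  proof (rule countably_additiveI)
    fix A :: "nat \<Rightarrow> (nat \<Rightarrow> 'a) set"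
    assume A: "range A \<subseteq> sets (PiM {..<n} (\<lambda>_. borel))" and d: "disjoint_family A"
    have "(\<Sum>i. \<Sum>ls\<in>compositions n. emeasure (gamma_list \<sigma> \<mu> p ls) (A i)) =
        (\<Sum>ls\<in>compositions n. \<Sum>i. emeasure (gamma_list \<sigma> \<mu> p ls) (A i))"
      by (intro suminf_sum summableI)
    also have "\<dots> = (\<Sum>ls\<in>compositions n. emeasure (gamma_list \<sigma> \<mu> p ls) (\<Union>i. A i))"
      by (intro sum.cong refl suminf_emeasure d)
        (use A in \<open>auto simp: gamma_list_def compositions_def\<close>)
    finally show "(\<Sum>i. \<Sum>ls\<in>compositions n. emeasure (gamma_list \<sigma> \<mu> p ls) (A i)) =
        (\<Sum>ls\<in>compositions n. emeasure (gamma_list \<sigma> \<mu> p ls) (\<Union>i. A i))" .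
  qed
qed

lemma cube_in_sets: "compact C \<Longrightarrow> PiE {..<n :: nat} (\<lambda>_. C :: 'a set) \<in> sets (PiM {..<n} (\<lambda>_. borel))"
  by (intro sets_PiM_I_finite) (auto simp: compact_imp_closed)

text \<open>A tuple is mapped into a cube only if all its coordinates lie in the side of the cube, so the
  value is a finite sum of finite products.\<close>

lemma emeasure_gamma_cube_finite:
  assumes C: "compact C"
  shows "emeasure (\<Gamma> n) (PiE {..<n} (\<lambda>_. C)) < \<infinity>"
  unfolding emeasure_gamma[OF cube_in_sets[OF C]]
  using emeasure_gamma_list_cube_finite[OF C] finite_compositions[of n]
  by (auto simp: compositions_def ennreal_sum_less_top)

lemma B0_tuples_square_integrable:
  assumes "g \<in> B0_tuples n"
  shows "integrable (\<Gamma> n) (\<lambda>x. (g x)\<^sup>2)"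
proof -
  obtain c C where g: "g \<in> borel_measurable (PiM {..<n} (\<lambda>_. borel))"
    "\<And>x. x \<in> PiE {..<n} (\<lambda>_. UNIV) \<Longrightarrow> \<bar>g x\<bar> \<le> c" "0 \<le> c"
    "compact C" "\<And>x. x \<in> PiE {..<n} (\<lambda>_. UNIV) \<Longrightarrow> g x \<noteq> 0 \<Longrightarrow> x \<in> PiE {..<n} (\<lambda>_. C)"
    using assms by (rule B0_tuplesE) blast
  show ?thesis
  proof (rule Bochner_Integration.integrable_bound)
    show "integrable (\<Gamma> n) (\<lambda>x. c\<^sup>2 * indicator (PiE {..<n} (\<lambda>_. C)) x)"
      using emeasure_gamma_cube_finite[OF g(4)] cube_in_sets[OF g(4)]
      by (intro integrable_mult_right integrable_real_indicator) (auto simp: sets_gamma)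
    show "(\<lambda>x. (g x)\<^sup>2) \<in> borel_measurable (\<Gamma> n)"
      using g(1) by measurable
    have "(g x)\<^sup>2 \<le> c\<^sup>2 * indicator (PiE {..<n} (\<lambda>_. C)) x" if x: "x \<in> PiE {..<n} (\<lambda>_. UNIV)" for x
    proof (cases "g x = 0")
      case False
      have "(g x)\<^sup>2 \<le> c\<^sup>2" using g(2)[OF x] abs_le_square_iff[of "g x" c] g(3) by simp
      with g(5)[OF x False] show ?thesis by (simp only: indicator_simps mult_1_right)
    qed (simp add: indicator_def)
    then show "AE x in \<Gamma> n. norm ((g x)\<^sup>2) \<le> norm (c\<^sup>2 * indicator (PiE {..<n} (\<lambda>_. C)) x)"
      by (intro AE_I2) (auto simp: space_gamma intro: order_trans[OF _ abs_ge_self])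
  qed
qed

lemma single_B0_in_hs: "g \<in> B0_tuples n \<Longrightarrow> single n g \<in> hs \<Gamma>"
  by (rule single_in_hs)
     (simp_all add: B0_tuples_square_integrable B0_tuples_measurable measurable_cong_sets[OF sets_gamma refl])

lemma B0_tuples_L2_convergence:
  fixes H :: "nat \<Rightarrow> (nat \<Rightarrow> 'a) \<Rightarrow> real"
  assumes H: "\<And>k. H k \<in> B0_tuples n" and h: "h \<in> B0_tuples n"
    and bd: "\<And>k x. x \<in> PiE {..<n} (\<lambda>_. UNIV) \<Longrightarrow> \<bar>H k x\<bar> \<le> c"
    and C: "compact C" "\<And>k x. x \<in> PiE {..<n} (\<lambda>_. UNIV) \<Longrightarrow> H k x \<noteq> 0 \<Longrightarrow> x \<in> PiE {..<n} (\<lambda>_. C)"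
    and lim: "\<And>x. x \<in> PiE {..<n} (\<lambda>_. UNIV) \<Longrightarrow> (\<lambda>k. H k x) \<longlonglongrightarrow> h x"
  shows "(\<lambda>k. \<integral>x. (H k x - h x)\<^sup>2 \<partial>\<Gamma> n) \<longlonglongrightarrow> 0"
proof -
  let ?I = "indicator (PiE {..<n} (\<lambda>_. C)) :: _ \<Rightarrow> real"
  note m = B0_tuples_measurable[OF H] B0_tuples_measurable[OF h]
  have "(\<lambda>k. \<integral>x. (H k x - h x)\<^sup>2 \<partial>\<Gamma> n) \<longlonglongrightarrow> (\<integral>x. 0 \<partial>\<Gamma> n)"
  proof (rule integral_dominated_convergence[where w = "\<lambda>x. (2 * c)\<^sup>2 * ?I x"])
    show "(\<lambda>x. (H k x - h x)\<^sup>2) \<in> borel_measurable (\<Gamma> n)" for k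
      using m by (simp add: measurable_cong_sets[OF sets_gamma refl])
    show "integrable (\<Gamma> n) (\<lambda>x. (2 * c)\<^sup>2 * ?I x)"
      using emeasure_gamma_cube_finite[OF C(1)] cube_in_sets[OF C(1)]
      by (intro integrable_mult_right integrable_real_indicator) (auto simp: sets_gamma)
    show "AE x in \<Gamma> n. (\<lambda>k. (H k x - h x)\<^sup>2) \<longlonglongrightarrow> 0"
    proof (intro AE_I2)
      fix x assume "x \<in> space (\<Gamma> n)"
      then have x: "x \<in> PiE {..<n} (\<lambda>_. UNIV)" by (simp only: space_gamma)
      have "(\<lambda>k. (H k x - h x)\<^sup>2) \<longlonglongrightarrow> (h x - h x)\<^sup>2"
        by (intro tendsto_power tendsto_diff lim[OF x] tendsto_const)
      then show "(\<lambda>k. (H k x - h x)\<^sup>2) \<longlonglongrightarrow> 0" by simp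
    qed
    show "AE x in \<Gamma> n. norm ((H k x - h x)\<^sup>2) \<le> (2 * c)\<^sup>2 * ?I x" for k
    proof (intro AE_I2)
      fix x assume "x \<in> space (\<Gamma> n)"
      then have x: "x \<in> PiE {..<n} (\<lambda>_. UNIV)" by (simp only: space_gamma)
      show "norm ((H k x - h x)\<^sup>2) \<le> (2 * c)\<^sup>2 * ?I x"
      proof (cases "x \<in> PiE {..<n} (\<lambda>_. C)")
        case True
        have "\<bar>h x\<bar> \<le> c"
          by (rule Lim_bounded[OF tendsto_rabs[OF lim[OF x]]]) (use bd[OF x] in auto)
        then have "\<bar>H k x - h x\<bar> \<le> \<bar>2 * c\<bar>" using bd[OF x, of k] by linarith
        then have "(H k x - h x)\<^sup>2 \<le> (2 * c)\<^sup>2" by (simp only: abs_le_square_iff)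
        with True show ?thesis by (simp only: indicator_simps mult_1_right real_norm_def abs_power2)
      next
        case False
        then have z: "H j x = 0" for j using C(2)[OF x] by blast
        then have "h x = 0" using LIMSEQ_unique[OF lim[OF x]] by simp
        with z show ?thesis by simp
      qed
    qed
  qed simp_all
  then show ?thesis by simp
qed

end

lemma K_image_lincomb:
  "K_image p n (\<lambda>x. c * g x + h x) i x = c * K_image p n g i x + K_image p n h i x"
  by (simp add: K_image_def sum.distrib sum_distrib_left algebra_simps)

lemma K_image_tendsto:
  assumes "\<And>x. x \<in> PiE {..<n} (\<lambda>_. UNIV) \<Longrightarrow> (\<lambda>k. H k x) \<longlonglongrightarrow> h x"
  shows "(\<lambda>k. K_image p n (H k) i x) \<longlonglongrightarrow> K_image p n h i x"
  unfolding K_image_def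
proof (intro tendsto_sum tendsto_mult tendsto_const assms)
  fix ls assume "ls \<in> {ls \<in> compositions n. length ls = i}"
  then have n: "n = sum_list ls + length ls" by (simp add: compositions_def)
  show "diag ls (\<lambda>j. fst (x j)) \<in> PiE {..<n} (\<lambda>_. UNIV)"
    unfolding n by (rule diag_PiE)
qed

text \<open>The smeared operators multiply by functions that are only bounded and measurable, so they lead
  out of \<open>F_fin\<close>; these larger spaces are stable under them. The degree bound is part of the
  definition because creation raises it.\<close>

definition B0_fin :: "nat \<Rightarrow> ('a::topological_space) fock set" where
  "B0_fin N = {F. (\<forall>n. F n \<in> B0_tuples n) \<and> vanishes_above N F}"

lemma F_fin_subset_B0_fin:
  fixes F :: "('a::{second_countable_topology, t2_space}) fock"
  assumes "F \<in> F_fin"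
  obtains N where "F \<in> B0_fin N"
  using assms test_functions_subset_B0_tuples
  unfolding F_fin_def B0_fin_def vanishes_above_def by blast

locale jacobi_field_K = jacobi_field +
  fixes K :: "'a fock \<Rightarrow> ('a \<times> real) fock"
  assumes K: "is_K \<sigma> \<mu> p K"
begin

abbreviation "\<Phi> \<equiv> full_fock \<rho>"

lemma K_unitary: "hs_unitary \<Gamma> \<Phi> K"
  using K by (simp add: is_K_def)

text \<open>The formula holds on test functions by the choice of \<open>K\<close>; the monotone class theorem extends it.
  Measurability of the formula for a general \<open>g\<close> comes out as well, as that of a pointwise limit.\<close>

lemma K_single_pos:
  assumes n: "n \<ge> 1" and g: "g \<in> B0_tuples n"
  shows "hs_eq \<Phi> (K (single n g)) (K_image p n g)"
  using locally_compact g
proof (induction rule: B0_tuples_induct)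
  case (test h)
  then show ?case using K n by (simp add: is_K_def)
next
  case (lincomb c h k)
  have "hs_eq \<Phi> (K (\<lambda>m x. c * single n h m x + single n k m x))
      (\<lambda>m y. c * K (single n h) m y + K (single n k) m y)"
    by (intro hs_unitaryD(2)[OF K_unitary] single_B0_in_hs lincomb)
  also have "(\<lambda>m x. c * single n h m x + single n k m x) = single n (\<lambda>x. c * h x + k x)"
    by (auto simp: single_def fun_eq_iff)
  finally have "hs_eq \<Phi> (K (single n (\<lambda>x. c * h x + k x)))
      (\<lambda>m y. c * K (single n h) m y + K (single n k) m y)" .
  from hs_eq_trans[OF this hs_eq_lincomb[OF lincomb.IH]]
  show ?case by (simp add: K_image_lincomb[abs_def])
next
  case (limit H h c C)
  show ?case
  proof (rule hs_unitary_limit[OF K_unitary])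
    show "single n (H k) \<in> hs \<Gamma>" for k by (intro single_B0_in_hs limit)
    show "single n h \<in> hs \<Gamma>" by (intro single_B0_in_hs limit)
    show "hs_eq \<Phi> (K (single n (H k))) (K_image p n (H k))" for k by (rule limit.IH)
    show "(\<lambda>k. K_image p n (H k) m y) \<longlonglongrightarrow> K_image p n h m y" for m y
      by (rule K_image_tendsto[OF limit.hyps(6)])
    show "(\<lambda>k. hs_inner \<Gamma> (\<lambda>m x. single n (H k) m x - single n h m x)
        (\<lambda>m x. single n (H k) m x - single n h m x)) \<longlonglongrightarrow> 0"
      unfolding hs_inner_single_diff by (rule B0_tuples_L2_convergence) (use limit.hyps in blast)+
  qed
qed

lemma vacuum_B0: "(\<lambda>_. 1) \<in> B0_tuples 0"
  by (rule B0_tuplesI[where C = "{}" and c = 1]) auto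

text \<open>In degree 0 there is only one tuple, so \<open>g\<close> is a multiple of the vacuum in the Hilbert space; its
  values elsewhere need not agree with that multiple.\<close>

lemma K_single_0:
  assumes g: "g \<in> B0_tuples 0"
  shows "hs_eq \<Phi> (K (single 0 g)) (K_image p 0 g)"
proof -
  let ?c = "g (\<lambda>_. undefined)"
  have v: "vacuum \<in> hs \<Gamma>" unfolding vacuum_def by (rule single_B0_in_hs[OF vacuum_B0])
  have z: "(\<lambda>_ _. 0) \<in> hs \<Gamma>" by (rule hs_zero)
  have "hs_eq \<Gamma> (\<lambda>m x. ?c * vacuum m x + 0) (single 0 g)"
  proof (rule hs_cong_AE)
    show "(\<lambda>m x. ?c * vacuum m x + 0) \<in> hs \<Gamma>" by (rule hs_lincomb[OF v z])
    show "single 0 g m \<in> borel_measurable (\<Gamma> m)" for m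
      using hsD(1)[OF single_B0_in_hs[OF g]] .
    show "AE x in \<Gamma> m. ?c * vacuum m x + 0 = single 0 g m x" for m
      by (intro AE_I2) (auto simp: vacuum_def single_def space_gamma)
  qed
  from hs_eq_trans[OF hs_eq_sym[OF hs_unitary_cong[OF K_unitary this]] hs_unitaryD(2)[OF K_unitary v z]]
  have 1: "hs_eq \<Phi> (K (single 0 g)) (\<lambda>n y. ?c * K vacuum n y + K (\<lambda>_ _. 0) n y)" .
  have "hs_eq \<Phi> (K (\<lambda>_ _. 0)) (\<lambda>_ _. 0)"
    using hs_unitaryD(3)[OF K_unitary z z] hs_eq_iff_norm_diff[OF hs_unitaryD(1)[OF K_unitary z] hs_zero]
    by (simp add: hs_inner_def)
  moreover have "hs_eq \<Phi> (K vacuum) vacuum" using K by (simp add: is_K_def)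
  ultimately have "hs_eq \<Phi> (\<lambda>n y. ?c * K vacuum n y + K (\<lambda>_ _. 0) n y) (\<lambda>n y. ?c * vacuum n y + 0)"
    by (intro hs_eq_lincomb)
  moreover have "(\<lambda>n y. ?c * vacuum n y + 0) = K_image p 0 g"
  proof (intro ext)
    fix i y
    have "{ls. ls \<in> compositions 0 \<and> length ls = i} = (if i = 0 then {[]} else {})"
      by (auto simp: compositions_def)
    then show "?c * vacuum i y + 0 = K_image p 0 g i y"
      by (simp add: K_image_def vacuum_def single_def diag_Nil)
  qed
  ultimately show ?thesis using hs_eq_trans[OF 1] by simp
qed

lemma K_single: "g \<in> B0_tuples n \<Longrightarrow> hs_eq \<Phi> (K (single n g)) (K_image p n g)"
  by (cases "n = 0") (auto intro: K_single_0 K_single_pos)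

lemma K_B0_fin:
  assumes F: "F \<in> B0_fin N"
  shows "F \<in> hs \<Gamma>" "hs_eq \<Phi> (K F) (K_formula p N F)"
proof -
  \<comment> \<open>Adding the components one at a time; linearity of \<open>K\<close> is available only for two summands.\<close>
  let ?tr = "\<lambda>k m x. if m < k then F m x else 0"
  have FB: "F n \<in> B0_tuples n" for n using F by (simp add: B0_fin_def)
  have tr: "?tr k \<in> hs \<Gamma> \<and> hs_eq \<Phi> (K (?tr k)) (\<lambda>i x. \<Sum>n<k. K_image p n (F n) i x)" for k
  proof (induction k)
    case 0
    have "hs_eq \<Phi> (K (\<lambda>_ _. 0)) (\<lambda>_ _. 0)"
      using hs_unitaryD(3)[OF K_unitary hs_zero hs_zero]
        hs_eq_iff_norm_diff[OF hs_unitaryD(1)[OF K_unitary hs_zero] hs_zero]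
      by (simp add: hs_inner_def)
    then show ?case by (simp add: hs_zero)
  next
    case (Suc k)
    note s = single_B0_in_hs[OF FB[of k]]
    have eq: "?tr (Suc k) = (\<lambda>m x. 1 * single k (F k) m x + ?tr k m x)"
      by (auto simp: single_def fun_eq_iff)
    have "hs_eq \<Phi> (K (?tr (Suc k))) (\<lambda>n y. 1 * K (single k (F k)) n y + K (?tr k) n y)"
      unfolding eq by (rule hs_unitaryD(2)[OF K_unitary s]) (use Suc in simp)
    from hs_eq_trans[OF this hs_eq_lincomb[OF K_single[OF FB] conjunct2[OF Suc]]]
    have "hs_eq \<Phi> (K (?tr (Suc k))) (\<lambda>i x. \<Sum>n<Suc k. K_image p n (F n) i x)"
      by (simp add: add.commute)
    moreover have "?tr (Suc k) \<in> hs \<Gamma>"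
      unfolding eq by (rule hs_lincomb[OF s]) (use Suc in simp)
    ultimately show ?case by (intro conjI)
  qed
  have e: "hs_eq \<Gamma> (?tr (Suc N)) F"
  proof (rule hs_cong_AE)
    show "?tr (Suc N) \<in> hs \<Gamma>" using tr by blast
    show "F n \<in> borel_measurable (\<Gamma> n)" for n
      using B0_tuples_measurable[OF FB] by (simp add: measurable_cong_sets[OF sets_gamma refl])
    show "AE x in \<Gamma> n. ?tr (Suc N) n x = F n x" for n
      using F by (intro AE_I2) (auto simp: B0_fin_def vanishes_above_def space_gamma)
  qed
  then show "F \<in> hs \<Gamma>" by (simp add: hs_eq_def)
  have "(\<lambda>i x. \<Sum>n<Suc N. K_image p n (F n) i x) = K_formula p N F"
    using F sum_K_image_eq_K_formula[of N F p]
    by (simp only: lessThan_Suc_atMost B0_fin_def mem_Collect_eq)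
  then show "hs_eq \<Phi> (K F) (K_formula p N F)"
    using hs_eq_trans[OF hs_eq_sym[OF hs_unitary_cong[OF K_unitary e]] conjunct2[OF tr[of "Suc N"]]]
    by (simp only:)
qed

end


section \<open>The smeared operators on bounded functions of compact support\<close>

lemma B0_tuples_cong:
  assumes "g \<in> B0_tuples n" and "\<And>x. x \<in> PiE {..<n} (\<lambda>_. UNIV) \<Longrightarrow> g x = h x"
  shows "h \<in> B0_tuples n"
proof -
  have "h \<in> borel_measurable (PiM {..<n} (\<lambda>_. borel)) \<longleftrightarrow> g \<in> borel_measurable (PiM {..<n} (\<lambda>_. borel))"
    by (rule measurable_cong) (simp add: assms(2) space_PiM)
  with assms show ?thesis by (simp add: B0_tuples_def)
qed

lemma B0_tuples_zero: "(\<lambda>_. 0) \<in> B0_tuples n"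
  by (rule B0_tuplesI[where C = "{}" and c = 0]) auto

lemma B0_tuples_mult_bounded:
  fixes g w :: "(nat \<Rightarrow> 'a::topological_space) \<Rightarrow> real"
  assumes g: "g \<in> B0_tuples n" and w: "w \<in> borel_measurable (PiM {..<n} (\<lambda>_. borel))"
    and b: "\<And>x. \<bar>w x\<bar> \<le> b"
  shows "(\<lambda>x. w x * g x) \<in> B0_tuples n"
proof -
  obtain a C where g': "g \<in> borel_measurable (PiM {..<n} (\<lambda>_. borel))"
    "\<And>x. x \<in> PiE {..<n} (\<lambda>_. UNIV) \<Longrightarrow> \<bar>g x\<bar> \<le> a" "0 \<le> a" "compact C"
    "\<And>x. x \<in> PiE {..<n} (\<lambda>_. UNIV) \<Longrightarrow> g x \<noteq> 0 \<Longrightarrow> x \<in> PiE {..<n} (\<lambda>_. C)"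
    using g by (rule B0_tuplesE) blast
  show ?thesis
  proof (rule B0_tuplesI[where c = "b * a" and C = C])
    show "\<bar>w x * g x\<bar> \<le> b * a" if "x \<in> PiE {..<n} (\<lambda>_. UNIV)" for x
      unfolding abs_mult using b[of x] g'(2)[OF that] by (intro mult_mono) auto
    show "x \<in> PiE {..<n} (\<lambda>_. C)" if "x \<in> PiE {..<n} (\<lambda>_. UNIV)" "w x * g x \<noteq> 0" for x
      using g'(5)[OF that(1)] that(2) by simp
  qed (use g' w in measurable)
qed

lemma B0_functionsE:
  assumes "u \<in> B0_functions"
  obtains c C where "u \<in> borel_measurable borel" "\<And>t. \<bar>u t\<bar> \<le> c" "0 \<le> c" "compact C"
    "\<And>t. u t \<noteq> 0 \<Longrightarrow> t \<in> C"
proof -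
  from assms have u: "u \<in> borel_measurable borel" "bounded (range u)" "compact (closure {t. u t \<noteq> 0})"
    by (auto simp: B0_functions_def)
  from u(2) obtain c where "\<And>t. \<bar>u t\<bar> \<le> c" unfolding bounded_iff by auto
  moreover from this have "0 \<le> c" by (meson abs_ge_zero order_trans)
  ultimately show thesis using u closure_subset[of "{t. u t \<noteq> 0}"] by (intro that) blast+
qed

lemma B0_functions_mult_continuous:
  fixes u h :: "'a::t2_space \<Rightarrow> real"
  assumes u: "u \<in> B0_functions" and h: "continuous_on UNIV h"
  shows "(\<lambda>t. u t * h t) \<in> B0_functions"
proof -
  obtain c C where u': "u \<in> borel_measurable borel" "\<And>t. \<bar>u t\<bar> \<le> c" "0 \<le> c" "compact C"
    "\<And>t. u t \<noteq> 0 \<Longrightarrow> t \<in> C"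
    using u by (rule B0_functionsE) blast
  have "compact (h ` C)"
    by (intro compact_continuous_image continuous_on_subset[OF h] u'(4)) auto
  then obtain b where b: "\<forall>y\<in>h ` C. norm y \<le> b"
    using compact_imp_bounded bounded_iff by metis
  have "\<bar>u t * h t\<bar> \<le> c * \<bar>b\<bar>" for t
  proof (cases "t \<in> C")
    case True
    with b have "\<bar>h t\<bar> \<le> \<bar>b\<bar>" by force
    then show ?thesis unfolding abs_mult using u'(2,3) by (intro mult_mono) auto
  next
    case False
    then have "u t = 0" using u'(5) by blast
    then show ?thesis using u'(3) by simp
  qed
  then have "bounded (range (\<lambda>t. u t * h t))" unfolding bounded_iff by auto
  moreover have "compact (closure {t. u t * h t \<noteq> 0})"
    using u'(5) by (intro compact_closure_subset[OF _ u'(4)]) auto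
  ultimately show ?thesis
    using u'(1) borel_measurable_continuous_onI[OF h] by (simp add: B0_functions_def)
qed

lemma vanishes_above_mono: "vanishes_above N F \<Longrightarrow> N \<le> M \<Longrightarrow> vanishes_above M F"
  by (auto simp: vanishes_above_def)

lemma B0_fin_mono: "F \<in> B0_fin N \<Longrightarrow> N \<le> M \<Longrightarrow> F \<in> B0_fin M"
  by (auto simp: B0_fin_def intro: vanishes_above_mono)

lemma B0_fin_add: "F \<in> B0_fin N \<Longrightarrow> G \<in> B0_fin N \<Longrightarrow> (\<lambda>n x. F n x + G n x) \<in> B0_fin N"
  using B0_tuples_lincomb[of "F _" _ "G _" 1] by (auto simp: B0_fin_def vanishes_above_def)

lemma smeared_creation_B0_fin:
  fixes F :: "('a::topological_space) fock"
  assumes u: "u \<in> B0_functions" and F: "F \<in> B0_fin N"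
  shows "smeared_creation u (\<lambda>t. F) \<in> B0_fin (Suc N)"
proof -
  obtain c C where u': "u \<in> borel_measurable borel" "\<And>t. \<bar>u t\<bar> \<le> c" "0 \<le> c" "compact C"
    "\<And>t. u t \<noteq> 0 \<Longrightarrow> t \<in> C"
    using u by (rule B0_functionsE) blast
  have "smeared_creation u (\<lambda>t. F) n \<in> B0_tuples n" for n
  proof (cases n)
    case 0
    then show ?thesis by (simp add: smeared_creation_def B0_tuples_zero)
  next
    case (Suc k)
    have "F k \<in> B0_tuples k" using F by (simp add: B0_fin_def)
    then obtain a A where F': "F k \<in> borel_measurable (PiM {..<k} (\<lambda>_. borel))"
      "\<And>x. x \<in> PiE {..<k} (\<lambda>_. UNIV) \<Longrightarrow> \<bar>F k x\<bar> \<le> a" "0 \<le> a" "compact A"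
      "\<And>x. x \<in> PiE {..<k} (\<lambda>_. UNIV) \<Longrightarrow> F k x \<noteq> 0 \<Longrightarrow> x \<in> PiE {..<k} (\<lambda>_. A)"
      by (rule B0_tuplesE) blast
    have "(\<lambda>x. u (x 0) * F k (tuple_tail k x)) \<in> B0_tuples (Suc k)"
    proof (rule B0_tuplesI[where c = "c * a" and C = "C \<union> A"])
      have "(\<lambda>x. u (x 0)) \<in> borel_measurable (PiM {..<Suc k} (\<lambda>_. borel))"
        by (rule measurable_compose[OF measurable_tuple_head u'(1)])
      moreover have "(\<lambda>x. F k (tuple_tail k x)) \<in> borel_measurable (PiM {..<Suc k} (\<lambda>_. borel))"
        by (rule measurable_compose[OF measurable_tuple_tail[OF measurable_ident[unfolded id_def]] F'(1)])
      ultimately show "(\<lambda>x. u (x 0) * F k (tuple_tail k x)) \<in> borel_measurable (PiM {..<Suc k} (\<lambda>_. borel))"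
        by (rule borel_measurable_times)
      show "compact (C \<union> A)" using u'(4) F'(4) by (rule compact_Un)
      fix x :: "nat \<Rightarrow> 'a" assume x: "x \<in> PiE {..<Suc k} (\<lambda>_. UNIV)"
      show "\<bar>u (x 0) * F k (tuple_tail k x)\<bar> \<le> c * a"
        unfolding abs_mult using u'(2)[of "x 0"] F'(2)[OF tuple_tail_PiE] u'(3)
        by (intro mult_mono) auto
      assume "u (x 0) * F k (tuple_tail k x) \<noteq> 0"
      then have nz: "x 0 \<in> C" "tuple_tail k x \<in> PiE {..<k} (\<lambda>_. A)"
        using u'(5) F'(5)[OF tuple_tail_PiE] by auto
      have "x j \<in> C \<union> A" if "j < Suc k" for j
      proof (cases j)
        case (Suc i)
        then have "i \<in> {..<k}" using that by simp
        from PiE_mem[OF nz(2) this] show ?thesis using Suc \<open>i \<in> _\<close> by (simp add: tuple_tail_def)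
      qed (use nz(1) in simp)
      then show "x \<in> PiE {..<Suc k} (\<lambda>_. C \<union> A)" using x by (simp add: PiE_def Pi_iff)
    qed
    then show ?thesis using Suc by (simp add: smeared_creation_def)
  qed
  moreover have "vanishes_above (Suc N) (smeared_creation u (\<lambda>t. F))"
    unfolding vanishes_above_def
  proof (intro allI ballI impI)
    fix n x assume "Suc N < n"
    then obtain k where k: "n = Suc k" "N < k" by (cases n) auto
    have "F k (tuple_tail k x) = 0"
      using F k(2) tuple_tail_PiE unfolding B0_fin_def vanishes_above_def mem_Collect_eq by metis
    then show "smeared_creation u (\<lambda>t. F) n x = 0" by (simp add: smeared_creation_def k(1))
  qed
  ultimately show ?thesis by (simp add: B0_fin_def)
qed

lemma smeared_number_B0_fin:
  fixes F :: "('a::topological_space) fock"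
  assumes u: "u \<in> B0_functions" and F: "F \<in> B0_fin N"
  shows "smeared_creation u (\<lambda>t. point_annihilation t F) \<in> B0_fin N"
proof -
  obtain c C where u': "u \<in> borel_measurable borel" "\<And>t. \<bar>u t\<bar> \<le> c"
    using u by (rule B0_functionsE) blast
  have eq: "smeared_creation u (\<lambda>t. point_annihilation t F) (Suc k) x = u (x 0) * F (Suc k) x"
    if "x \<in> PiE {..<Suc k} (\<lambda>_. UNIV)" for k x
    by (simp add: smeared_creation_def point_annihilation_def tuple_cons_tail[OF that])
  have "smeared_creation u (\<lambda>t. point_annihilation t F) n \<in> B0_tuples n" for n
  proof (cases n)
    case 0
    then show ?thesis by (simp add: smeared_creation_def B0_tuples_zero)
  next
    case (Suc k)
    have "(\<lambda>x. u (x 0) * F (Suc k) x) \<in> B0_tuples (Suc k)"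
    proof (rule B0_tuples_mult_bounded)
      show "(\<lambda>x. u (x 0)) \<in> borel_measurable (PiM {..<Suc k} (\<lambda>_. borel))"
        by (rule measurable_compose[OF measurable_tuple_head u'(1)])
    qed (use F u'(2) in \<open>auto simp: B0_fin_def\<close>)
    then show ?thesis unfolding Suc by (rule B0_tuples_cong) (simp add: eq)
  qed
  moreover have "vanishes_above N (smeared_creation u (\<lambda>t. point_annihilation t F))"
    unfolding vanishes_above_def
  proof (intro allI ballI impI)
    fix n :: nat and x :: "nat \<Rightarrow> 'a" assume n: "N < n" and x: "x \<in> PiE {..<n} (\<lambda>_. UNIV)"
    then obtain k where k: "n = Suc k" by (cases n) auto
    have "F n x = 0" using F n x by (auto simp: B0_fin_def vanishes_above_def)
    then show "smeared_creation u (\<lambda>t. point_annihilation t F) n x = 0"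
      using x unfolding k by (simp add: eq)
  qed
  ultimately show ?thesis by (simp add: B0_fin_def)
qed

text \<open>Freezing the first argument at the second one, \<open>g(t\<^sub>1, t\<^sub>1, t\<^sub>2, \<dots>)\<close>, is described by
  \<open>x \<mapsto> g (tuple_cons n (x 0) x)\<close>.\<close>

lemma smeared_double_annihilation_B0_fin:
  fixes F :: "('a::topological_space) fock"
  assumes u: "u \<in> B0_functions" and F: "F \<in> B0_fin N"
  shows "smeared_creation u (\<lambda>t. point_annihilation t (point_annihilation t F)) \<in> B0_fin N"
proof -
  obtain c C where u': "u \<in> borel_measurable borel" "\<And>t. \<bar>u t\<bar> \<le> c"
    using u by (rule B0_functionsE) blast
  let ?G = "smeared_creation u (\<lambda>t. point_annihilation t (point_annihilation t F))"
  have eq: "?G (Suc k) x = u (x 0) * F (Suc (Suc k)) (tuple_cons (Suc k) (x 0) x)"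
    if "x \<in> PiE {..<Suc k} (\<lambda>_. UNIV)" for k x
    by (simp add: smeared_creation_def point_annihilation_def tuple_cons_tail[OF that])
  have "?G n \<in> B0_tuples n" for n
  proof (cases n)
    case 0
    then show ?thesis by (simp add: smeared_creation_def B0_tuples_zero)
  next
    case (Suc k)
    have "F (Suc (Suc k)) \<in> B0_tuples (Suc (Suc k))" using F by (simp add: B0_fin_def)
    then obtain a A where F': "F (Suc (Suc k)) \<in> borel_measurable (PiM {..<Suc (Suc k)} (\<lambda>_. borel))"
      "\<And>x. x \<in> PiE {..<Suc (Suc k)} (\<lambda>_. UNIV) \<Longrightarrow> \<bar>F (Suc (Suc k)) x\<bar> \<le> a" "0 \<le> a" "compact A"
      "\<And>x. x \<in> PiE {..<Suc (Suc k)} (\<lambda>_. UNIV) \<Longrightarrow> F (Suc (Suc k)) x \<noteq> 0 \<Longrightarrow>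
        x \<in> PiE {..<Suc (Suc k)} (\<lambda>_. A)"
      by (rule B0_tuplesE) blast
    let ?g = "\<lambda>x. F (Suc (Suc k)) (tuple_cons (Suc k) (x 0) x)"
    have g: "?g \<in> B0_tuples (Suc k)"
    proof (rule B0_tuplesI[where c = a and C = A])
      show "?g \<in> borel_measurable (PiM {..<Suc k} (\<lambda>_. borel))"
        by (rule measurable_compose[OF measurable_tuple_cons[OF measurable_tuple_head measurable_ident[unfolded id_def]] F'(1)])
      fix x :: "nat \<Rightarrow> 'a" assume x: "x \<in> PiE {..<Suc k} (\<lambda>_. UNIV)"
      show "\<bar>?g x\<bar> \<le> a" by (rule F'(2)[OF tuple_cons_PiE])
      assume "?g x \<noteq> 0"
      then have m: "tuple_cons (Suc k) (x 0) x \<in> PiE {..<Suc (Suc k)} (\<lambda>_. A)"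
        by (rule F'(5)[OF tuple_cons_PiE])
      have "x j \<in> A" if "j < Suc k" for j
        using PiE_mem[OF m, of "Suc j"] that by (simp add: tuple_cons_Suc)
      then show "x \<in> PiE {..<Suc k} (\<lambda>_. A)" using x by (simp add: PiE_def Pi_iff)
    qed (fact F'(4))
    have "(\<lambda>x. u (x 0) * ?g x) \<in> B0_tuples (Suc k)"
    proof (rule B0_tuples_mult_bounded[OF g])
      show "(\<lambda>x. u (x 0)) \<in> borel_measurable (PiM {..<Suc k} (\<lambda>_. borel))"
        by (rule measurable_compose[OF measurable_tuple_head u'(1)])
    qed (rule u'(2))
    then show ?thesis unfolding Suc by (rule B0_tuples_cong) (simp add: eq)
  qed
  moreover have "vanishes_above N ?G"
    unfolding vanishes_above_def
  proof (intro allI ballI impI)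
    fix n :: nat and x :: "nat \<Rightarrow> 'a" assume n: "N < n" and x: "x \<in> PiE {..<n} (\<lambda>_. UNIV)"
    then obtain k where k: "n = Suc k" by (cases n) auto
    have "F (Suc (Suc k)) (tuple_cons (Suc k) (x 0) x) = 0"
      using F n tuple_cons_PiE[of "Suc k" "x 0" x] unfolding k by (auto simp: B0_fin_def vanishes_above_def)
    then show "?G n x = 0" using x unfolding k by (simp add: eq)
  qed
  ultimately show ?thesis by (simp add: B0_fin_def)
qed

context jacobi_field
begin

lemma integrable_smeared:
  assumes u: "u \<in> B0_functions" and g: "g \<in> B0_tuples (Suc n)" and x: "x \<in> PiE {..<n} (\<lambda>_. UNIV)"
  shows "integrable \<sigma> (\<lambda>t. u t * g (tuple_cons n t x))"
proof -
  obtain c C where u': "u \<in> borel_measurable borel" "\<And>t. \<bar>u t\<bar> \<le> c" "0 \<le> c" "compact C"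
    "\<And>t. u t \<noteq> 0 \<Longrightarrow> t \<in> C"
    using u by (rule B0_functionsE) blast
  obtain a where g': "g \<in> borel_measurable (PiM {..<Suc n} (\<lambda>_. borel))"
    "\<And>x. x \<in> PiE {..<Suc n} (\<lambda>_. UNIV) \<Longrightarrow> \<bar>g x\<bar> \<le> a"
    using g by (rule B0_tuplesE) blast
  have "(\<lambda>t. tuple_cons n t x) \<in> borel \<rightarrow>\<^sub>M PiM {..<Suc n} (\<lambda>_. borel)"
    using x by (intro measurable_tuple_cons measurable_ident[unfolded id_def] measurable_const) (simp_all add: space_PiM)
  then have "(\<lambda>t. u t * g (tuple_cons n t x)) \<in> borel_measurable borel"
    by (intro borel_measurable_times u'(1)) (rule measurable_compose[OF _ g'(1)])
  then show ?thesis
  proof (rule integrable_sigma_compact_support[OF _ u'(4)])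
    show "\<bar>u t * g (tuple_cons n t x)\<bar> \<le> c * a" for t
      unfolding abs_mult using u'(2)[of t] g'(2)[OF tuple_cons_PiE] u'(3) by (intro mult_mono) auto
  qed (use u'(5) in auto)
qed

lemma smeared_annihilation_B0_fin:
  assumes u: "u \<in> B0_functions" and F: "F \<in> B0_fin N"
  shows "smeared_annihilation \<sigma> u F \<in> B0_fin N"
proof -
  obtain c C where u': "u \<in> borel_measurable borel" "\<And>t. \<bar>u t\<bar> \<le> c" "0 \<le> c" "compact C"
    "\<And>t. u t \<noteq> 0 \<Longrightarrow> t \<in> C"
    using u by (rule B0_functionsE) blast
  have iu: "integrable \<sigma> (\<lambda>t. \<bar>u t\<bar>)"
    by (rule integrable_sigma_compact_support[OF _ u'(4)]) (use u' in auto)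
  have "smeared_annihilation \<sigma> u F n \<in> B0_tuples n" for n
  proof -
    have Fn: "F (Suc n) \<in> B0_tuples (Suc n)" using F by (simp add: B0_fin_def)
    then obtain a A where F': "F (Suc n) \<in> borel_measurable (PiM {..<Suc n} (\<lambda>_. borel))"
      "\<And>x. x \<in> PiE {..<Suc n} (\<lambda>_. UNIV) \<Longrightarrow> \<bar>F (Suc n) x\<bar> \<le> a" "0 \<le> a" "compact A"
      "\<And>x. x \<in> PiE {..<Suc n} (\<lambda>_. UNIV) \<Longrightarrow> F (Suc n) x \<noteq> 0 \<Longrightarrow> x \<in> PiE {..<Suc n} (\<lambda>_. A)"
      by (rule B0_tuplesE) blast
    let ?g = "\<lambda>x. \<integral>t. u t * F (Suc n) (tuple_cons n t x) \<partial>\<sigma>"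
    have "?g \<in> B0_tuples n"
    proof (rule B0_tuplesI[where c = "\<integral>t. \<bar>u t\<bar> * a \<partial>\<sigma>" and C = A])
      let ?M = "PiM {..<n} (\<lambda>_. borel :: 'a measure)"
      have "(\<lambda>z. tuple_cons n (snd z) (fst z)) \<in> ?M \<Otimes>\<^sub>M \<sigma> \<rightarrow>\<^sub>M PiM {..<Suc n} (\<lambda>_. borel)"
        by (intro measurable_tuple_cons) measurable
      then have "(\<lambda>z. F (Suc n) (tuple_cons n (snd z) (fst z))) \<in> borel_measurable (?M \<Otimes>\<^sub>M \<sigma>)"
        by (rule measurable_compose[OF _ F'(1)])
      moreover have "(\<lambda>z. u (snd z)) \<in> borel_measurable (?M \<Otimes>\<^sub>M \<sigma>)"
        using u'(1) by measurable
      ultimately have "(\<lambda>z. u (snd z) * F (Suc n) (tuple_cons n (snd z) (fst z))) \<in> borel_measurable (?M \<Otimes>\<^sub>M \<sigma>)"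
        by (rule borel_measurable_times[rotated])
      then show "?g \<in> borel_measurable ?M"
        by (intro sigma.borel_measurable_lebesgue_integral) (simp add: case_prod_beta')
      fix x :: "nat \<Rightarrow> 'a" assume x: "x \<in> PiE {..<n} (\<lambda>_. UNIV)"
      have "\<bar>?g x\<bar> \<le> (\<integral>t. \<bar>u t * F (Suc n) (tuple_cons n t x)\<bar> \<partial>\<sigma>)"
        by (rule integral_abs_bound)
      also have "\<dots> \<le> (\<integral>t. \<bar>u t\<bar> * a \<partial>\<sigma>)"
      proof (rule integral_mono)
        show "integrable \<sigma> (\<lambda>t. \<bar>u t * F (Suc n) (tuple_cons n t x)\<bar>)"
          by (rule integrable_abs[OF integrable_smeared[OF u Fn x]])
        show "integrable \<sigma> (\<lambda>t. \<bar>u t\<bar> * a)" using iu by simp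
        show "\<bar>u t * F (Suc n) (tuple_cons n t x)\<bar> \<le> \<bar>u t\<bar> * a" for t
          unfolding abs_mult using F'(2)[OF tuple_cons_PiE] by (intro mult_left_mono) auto
      qed
      finally show "\<bar>?g x\<bar> \<le> (\<integral>t. \<bar>u t\<bar> * a \<partial>\<sigma>)" .
      assume nz: "?g x \<noteq> 0"
      show "x \<in> PiE {..<n} (\<lambda>_. A)"
      proof (rule ccontr)
        assume "x \<notin> PiE {..<n} (\<lambda>_. A)"
        then obtain j where j: "j < n" "x j \<notin> A" using x by (auto simp: PiE_def)
        have "F (Suc n) (tuple_cons n t x) = 0" for t
          using PiE_mem[OF F'(5)[OF tuple_cons_PiE[of n t x]], of "Suc j"] j
          by (auto simp: tuple_cons_Suc)
        with nz show False by simp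
      qed
    qed (fact F'(4))
    then show ?thesis by (simp add: smeared_annihilation_def point_annihilation_def)
  qed
  moreover have "vanishes_above N (smeared_annihilation \<sigma> u F)"
    unfolding vanishes_above_def
  proof (intro allI ballI impI)
    fix n :: nat and x :: "nat \<Rightarrow> 'a" assume n: "N < n"
    have "F (Suc n) (tuple_cons n t x) = 0" for t
      using F n tuple_cons_PiE[of n t x] by (auto simp: B0_fin_def vanishes_above_def)
    then show "smeared_annihilation \<sigma> u F n x = 0"
      by (simp add: smeared_annihilation_def point_annihilation_def)
  qed
  ultimately show ?thesis by (simp add: B0_fin_def)
qed

end

section \<open>The field operator on the explicit formula\<close>

lemma annihilation_iterate_scaled:
  assumes "\<And>n x. x \<in> PiE {..<n} (\<lambda>_. UNIV) \<Longrightarrow> G n x = c * F n x"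
    and "x \<in> PiE {..<n} (\<lambda>_. UNIV)"
  shows "((point_annihilation t) ^^ l) G n x = c * ((point_annihilation t) ^^ l) F n x"
  using assms(2)
proof (induction l arbitrary: n x)
  case 0
  then show ?case by (simp add: assms(1))
next
  case (Suc l)
  have "((point_annihilation t) ^^ l) G (Suc n) (tuple_cons n t x) =
      c * ((point_annihilation t) ^^ l) F (Suc n) (tuple_cons n t x)"
    by (rule Suc.IH[OF tuple_cons_PiE])
  then show ?case by (simp add: point_annihilation_def[of t "(point_annihilation t ^^ l) _"])
qed

lemma annihilation_smeared_creation:
  "x \<in> PiE {..<n} (\<lambda>_. UNIV) \<Longrightarrow>
    point_annihilation t (smeared_creation u h) n x = u t * h t n x"
  by (simp add: point_annihilation_def smeared_creation_def)

lemma annihilation_iterate_vanishes: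
  assumes "vanishes_above N F" "N < n + l" "x \<in> PiE {..<n} (\<lambda>_. UNIV)"
  shows "((point_annihilation t) ^^ l) F n x = 0"
  using assms(2,3)
proof (induction l arbitrary: n x)
  case 0
  with assms(1) show ?case by (simp add: vanishes_above_def)
next
  case (Suc l)
  then have "((point_annihilation t) ^^ l) F (Suc n) (tuple_cons n t x) = 0"
    by (intro Suc.IH tuple_cons_PiE) simp
  then show ?case by (simp add: point_annihilation_def[of t "(point_annihilation t ^^ l) _"])
qed

lemma K_formula_scaled:
  assumes "\<And>n x. x \<in> PiE {..<n} (\<lambda>_. UNIV) \<Longrightarrow> G n x = c * F n x"
  shows "K_formula p M G i x = c * K_formula p M F i x"
proof -
  have "K_formula p M G i x = K_formula p M (\<lambda>n x. c * F n x + 0) i x"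
    by (rule K_formula_cong) (simp_all add: assms)
  then show ?thesis
    using K_formula_lincomb[of p M c F "\<lambda>_ _. 0" i x] by (simp add: K_formula_def)
qed

text \<open>The first of the annihilations in the split formula cancels the creation, at the price of the
  factor \<open>u(t)\<close>.\<close>

lemma K_formula_smeared_creation:
  "K_formula p M (smeared_creation u h) (Suc k) x =
    (\<Sum>l<M. poly (p l (fst (x 0))) (snd (x 0)) * (u (fst (x 0)) *
      K_formula p M (((point_annihilation (fst (x 0))) ^^ l) (h (fst (x 0)))) k (tuple_tail k x)))"
  unfolding K_formula_Suc
proof (intro sum.cong refl arg_cong2[where f = "(*)"] K_formula_scaled)
  fix l n :: nat and y :: "nat \<Rightarrow> 'a" assume y: "y \<in> PiE {..<n} (\<lambda>_. UNIV)"
  show "((point_annihilation (fst (x 0))) ^^ Suc l) (smeared_creation u h) n y =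
      u (fst (x 0)) * ((point_annihilation (fst (x 0))) ^^ l) (h (fst (x 0))) n y"
    unfolding funpow_Suc_right comp_def
    by (rule annihilation_iterate_scaled[OF annihilation_smeared_creation y])
qed

text \<open>Creation and preservation parts together: with \<open>Y\<^sub>l\<close> for the explicit formula of \<open>\<partial>\<^sub>t\<^sup>l F\<close>, the
  three creating operators contribute \<open>\<Sum> p\<^sub>l (Y\<^sub>l + \<lambda> Y\<^sub>l\<^sub>+\<^sub>1 + \<eta> Y\<^sub>l\<^sub>+\<^sub>2)\<close>, and shifting the index turns this
  into \<open>p\<^sub>0 Y\<^sub>0 + \<Sum> (p\<^sub>l\<^sub>+\<^sub>1 + \<lambda> p\<^sub>l + \<eta> p\<^sub>l\<^sub>-\<^sub>1) Y\<^sub>l\<^sub>+\<^sub>1\<close>, to which the recurrence applies.\<close>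

lemma sum_recurrence_shift:
  fixes q Y :: "nat \<Rightarrow> real"
  assumes rec: "\<And>l. l < Suc N \<Longrightarrow> s * q l = q (Suc l) + L * q l + (case l of 0 \<Rightarrow> 0 | Suc k \<Rightarrow> e * q k)"
    and Y: "\<And>l. Suc N \<le> l \<Longrightarrow> Y l = 0"
  shows "q 0 * Y 0 + s * (\<Sum>l<Suc N. q l * Y (Suc l)) =
    (\<Sum>l<Suc N. q l * Y l) + L * (\<Sum>l<Suc N. q l * Y (Suc l)) + e * (\<Sum>l<Suc N. q l * Y (Suc (Suc l)))"
proof -
  have "s * (\<Sum>l<Suc N. q l * Y (Suc l)) = (\<Sum>l<Suc N. (s * q l) * Y (Suc l))"
    by (simp add: sum_distrib_left mult.assoc del: sum.lessThan_Suc)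
  also have "\<dots> = (\<Sum>l<Suc N. q (Suc l) * Y (Suc l) + L * (q l * Y (Suc l)) +
      (case l of 0 \<Rightarrow> 0 | Suc k \<Rightarrow> e * (q k * Y (Suc (Suc k)))))"
  proof (intro sum.cong refl)
    fix l assume "l \<in> {..<Suc N}"
    then have "s * q l = q (Suc l) + L * q l + (case l of 0 \<Rightarrow> 0 | Suc k \<Rightarrow> e * q k)"
      using rec[of l] by simp
    then show "(s * q l) * Y (Suc l) = q (Suc l) * Y (Suc l) + L * (q l * Y (Suc l)) +
      (case l of 0 \<Rightarrow> 0 | Suc k \<Rightarrow> e * (q k * Y (Suc (Suc k))))"
      by (cases l) (simp_all add: algebra_simps)
  qed
  also have "\<dots> = (\<Sum>l<Suc N. q (Suc l) * Y (Suc l)) + L * (\<Sum>l<Suc N. q l * Y (Suc l)) +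
      (\<Sum>l<Suc N. (case l of 0 \<Rightarrow> 0 | Suc k \<Rightarrow> e * (q k * Y (Suc (Suc k)))))"
    by (simp only: sum.distrib sum_distrib_left)
  also have "(\<Sum>l<Suc N. (case l of 0 \<Rightarrow> 0 | Suc k \<Rightarrow> e * (q k * Y (Suc (Suc k))))) =
      e * (\<Sum>l<N. q l * Y (Suc (Suc l)))"
    by (subst sum.lessThan_Suc_shift) (simp add: sum_distrib_left)
  also have "(\<Sum>l<N. q l * Y (Suc (Suc l))) = (\<Sum>l<Suc N. q l * Y (Suc (Suc l)))"
    by (simp add: Y)
  finally have 1: "s * (\<Sum>l<Suc N. q l * Y (Suc l)) = (\<Sum>l<Suc N. q (Suc l) * Y (Suc l)) +
      L * (\<Sum>l<Suc N. q l * Y (Suc l)) + e * (\<Sum>l<Suc N. q l * Y (Suc (Suc l)))" .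
  have "q 0 * Y 0 + (\<Sum>l<Suc N. q (Suc l) * Y (Suc l)) = (\<Sum>l<Suc (Suc N). q l * Y l)"
    by (simp only: sum.lessThan_Suc_shift)
  also have "\<dots> = (\<Sum>l<Suc N. q l * Y l)"
    using Y[of "Suc N"] by simp
  finally show ?thesis using 1 by linarith
qed

lemma bounded_finite_sum:
  fixes g :: "'i \<Rightarrow> 'b \<Rightarrow> real"
  assumes "finite I" "\<And>i. i \<in> I \<Longrightarrow> \<exists>c. \<forall>t. \<bar>g i t\<bar> \<le> c"
  shows "\<exists>c. \<forall>t. \<bar>\<Sum>i\<in>I. g i t\<bar> \<le> c"
proof -
  obtain c where "\<And>i t. i \<in> I \<Longrightarrow> \<bar>g i t\<bar> \<le> c i" using assms(2) by metis
  then have "\<bar>\<Sum>i\<in>I. g i t\<bar> \<le> sum c I" for t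
    by (intro order_trans[OF sum_abs sum_mono])
  then show ?thesis by blast
qed

lemma annihilation_iterate_measurable:
  fixes F :: "('a::topological_space) fock"
  assumes F: "\<And>n. F n \<in> B0_tuples n" and g: "g \<in> borel \<rightarrow>\<^sub>M PiM {..<n} (\<lambda>_. borel)"
  shows "(\<lambda>t. ((point_annihilation t) ^^ l) F n (g t)) \<in> borel_measurable borel"
  using g
proof (induction l arbitrary: n g)
  case 0
  then show ?case using measurable_compose[OF _ B0_tuples_measurable[OF F]] by simp
next
  case (Suc l)
  have "(\<lambda>t. tuple_cons n t (g t)) \<in> borel \<rightarrow>\<^sub>M PiM {..<Suc n} (\<lambda>_. borel)"
    by (intro measurable_tuple_cons measurable_ident[unfolded id_def] Suc.prems)
  from Suc.IH[OF this] show ?case by (simp add: point_annihilation_def[of _ "(point_annihilation _ ^^ l) _"])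
qed

lemma annihilation_iterate_bounded:
  assumes F: "\<And>n. F n \<in> B0_tuples n"
  shows "\<exists>c. \<forall>t. \<forall>x\<in>PiE {..<n} (\<lambda>_. UNIV). \<bar>((point_annihilation t) ^^ l) F n x\<bar> \<le> c"
proof (induction l arbitrary: n)
  case 0
  obtain c where "\<And>x. x \<in> PiE {..<n} (\<lambda>_. UNIV) \<Longrightarrow> \<bar>F n x\<bar> \<le> c"
    using F[of n] by (rule B0_tuplesE) blast
  then show ?case by auto
next
  case (Suc l)
  obtain c where "\<forall>t. \<forall>x\<in>PiE {..<Suc n} (\<lambda>_. UNIV). \<bar>((point_annihilation t) ^^ l) F (Suc n) x\<bar> \<le> c"
    using Suc.IH by blast
  then have "\<bar>((point_annihilation t) ^^ l) F (Suc n) (tuple_cons n t x)\<bar> \<le> c" for t x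
    using tuple_cons_PiE[of n t x] by (elim allE[of _ t]) (drule bspec)
  then have "\<bar>((point_annihilation t) ^^ Suc l) F n x\<bar> \<le> c" for t x
    by (simp add: point_annihilation_def[of t "(point_annihilation t ^^ l) F"])
  then show ?case by blast
qed

context jacobi_field_K
begin

lemma space_Phi: "space (\<Phi> n) = PiE {..<n} (\<lambda>_. UNIV)"
  by (simp add: full_fock_def space_PiM space_rho)

text \<open>The integral over the new first coordinate \<open>(t, s)\<close> is evaluated fibre by fibre; only the term
  with \<open>p\<^sup>(\<^sup>0\<^sup>) = 1\<close> survives, and it contains exactly one \<open>\<partial>\<^sub>t\<close>.\<close>

lemma K_formula_annihilation_part:
  assumes f: "f \<in> B0_functions" and F: "F \<in> B0_fin N" and x: "x \<in> PiE {..<i} (\<lambda>_. UNIV)"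
  shows "a_minus \<rho> (\<lambda>(t, s). f t) (K_formula p (Suc N) F) i x =
    K_formula p (Suc N) (smeared_annihilation \<sigma> f F) i x"
proof -
  let ?M = "Suc N"
  obtain c C where f': "f \<in> borel_measurable borel" "\<And>t. \<bar>f t\<bar> \<le> c" "0 \<le> c" "compact C"
    "\<And>t. f t \<noteq> 0 \<Longrightarrow> t \<in> C"
    using f by (rule B0_functionsE) blast
  have FB: "F n \<in> B0_tuples n" for n using F by (simp add: B0_fin_def)
  \<comment> \<open>The coefficient of \<open>p\<^sup>(\<^sup>l\<^sup>)(t, s)\<close> after splitting off the first entry.\<close>
  define \<phi> where "\<phi> l t = f t * K_formula p ?M (((point_annihilation t) ^^ Suc l) F) i x" for l t
  let ?y = "\<lambda>ls. diag ls (\<lambda>j. fst (x j))"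
  let ?w = "\<lambda>ls. \<Prod>j<i. poly (p (ls ! j) (fst (x j))) (snd (x j))"
  have \<phi>_meas: "\<phi> l \<in> borel_measurable borel" for l
  proof -
    have "(\<lambda>t. ((point_annihilation t) ^^ Suc l) F (sum_list ls + length ls) (?y ls)) \<in> borel_measurable borel" for ls
      by (rule annihilation_iterate_measurable[OF FB])
         (simp add: space_PiM diag_PiE)
    then have "(\<lambda>t. K_formula p ?M (((point_annihilation t) ^^ Suc l) F) i x) \<in> borel_measurable borel"
      unfolding K_formula_def by (intro borel_measurable_sum borel_measurable_times) auto
    then show ?thesis unfolding \<phi>_def using f'(1) by (rule borel_measurable_times[rotated])
  qed
  have \<phi>_bd: "\<exists>b. \<forall>t. \<bar>\<phi> l t\<bar> \<le> b" for l
  proof -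
    have "\<exists>b. \<forall>t. \<bar>K_formula p ?M (((point_annihilation t) ^^ Suc l) F) i x\<bar> \<le> b"
      unfolding K_formula_def
    proof (rule bounded_finite_sum[OF finite_index_lists])
      fix ls
      obtain b where b: "\<forall>t. \<forall>x\<in>PiE {..<sum_list ls + length ls} (\<lambda>_. UNIV).
          \<bar>((point_annihilation t) ^^ Suc l) F (sum_list ls + length ls) x\<bar> \<le> b"
        using annihilation_iterate_bounded[OF FB] by blast
      have "\<bar>((point_annihilation t) ^^ Suc l) F (sum_list ls + length ls) (?y ls) * ?w ls\<bar> \<le> b * \<bar>?w ls\<bar>" for t
        unfolding abs_mult using b diag_PiE[of ls "\<lambda>j. fst (x j)"] by (intro mult_right_mono) auto
      then show "\<exists>b. \<forall>t. \<bar>((point_annihilation t) ^^ Suc l) F (sum_list ls + length ls) (?y ls) * ?w ls\<bar> \<le> b"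
        by blast
    qed
    then obtain b where b: "\<And>t. \<bar>K_formula p ?M (((point_annihilation t) ^^ Suc l) F) i x\<bar> \<le> b" by blast
    have "\<bar>\<phi> l t\<bar> \<le> c * b" for t
      unfolding \<phi>_def abs_mult using f'(2)[of t] b[of t] f'(3) by (intro mult_mono) auto
    then show ?thesis by blast
  qed
  have \<phi>_supp: "\<phi> l t \<noteq> 0 \<Longrightarrow> t \<in> C" for l t using f'(5) by (auto simp: \<phi>_def)
  have int: "integrable \<rho> (\<lambda>z. \<phi> l (fst z) * poly (p l (fst z)) (snd z))"
    and val: "(\<integral>z. \<phi> l (fst z) * poly (p l (fst z)) (snd z) \<partial>\<rho>) = (if l = 0 then \<integral>t. \<phi> l t \<partial>\<sigma> else 0)" for l
  proof -
    obtain b where "\<And>t. \<bar>\<phi> l t\<bar> \<le> b" using \<phi>_bd by blast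
    from integral_rho_p[OF \<phi>_meas[of l] f'(4) this \<phi>_supp[of l]]
    show "integrable \<rho> (\<lambda>z. \<phi> l (fst z) * poly (p l (fst z)) (snd z))"
      "(\<integral>z. \<phi> l (fst z) * poly (p l (fst z)) (snd z) \<partial>\<rho>) = (if l = 0 then \<integral>t. \<phi> l t \<partial>\<sigma> else 0)"
      by blast+
  qed
  have "a_minus \<rho> (\<lambda>(t, s). f t) (K_formula p ?M F) i x =
      (\<integral>z. (\<Sum>l<?M. \<phi> l (fst z) * poly (p l (fst z)) (snd z)) \<partial>\<rho>)"
    unfolding a_minus_def K_formula_Suc \<phi>_def
    by (simp only: tuple_cons_0 tuple_tail_cons_PiE[OF x] case_prod_beta sum_distrib_left mult_ac)
  also have "\<dots> = (\<Sum>l<?M. if l = 0 then \<integral>t. \<phi> l t \<partial>\<sigma> else 0)"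
    using int by (subst Bochner_Integration.integral_sum) (simp_all add: val del: sum.lessThan_Suc)
  also have "\<dots> = (\<integral>t. \<phi> 0 t \<partial>\<sigma>)"
    by (simp add: sum.lessThan_Suc_shift del: sum.lessThan_Suc)
  also have "\<dots> = (\<integral>t. (\<Sum>ls | set ls \<subseteq> {..<?M} \<and> length ls = i.
      (f t * F (Suc (sum_list ls + length ls)) (tuple_cons (sum_list ls + length ls) t (?y ls))) * ?w ls) \<partial>\<sigma>)"
    by (simp add: \<phi>_def K_formula_def point_annihilation_def sum_distrib_left mult_ac)
  also have "\<dots> = (\<Sum>ls | set ls \<subseteq> {..<?M} \<and> length ls = i.
      (\<integral>t. f t * F (Suc (sum_list ls + length ls)) (tuple_cons (sum_list ls + length ls) t (?y ls)) \<partial>\<sigma>) * ?w ls)"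
  proof (subst Bochner_Integration.integral_sum)
    show "integrable \<sigma> (\<lambda>t. f t * F (Suc (sum_list ls + length ls))
        (tuple_cons (sum_list ls + length ls) t (?y ls)) * ?w ls)" for ls
      by (rule integrable_mult_left[OF integrable_smeared[OF f FB diag_PiE]])
  qed (simp only: integral_mult_left_zero)
  also have "\<dots> = K_formula p ?M (smeared_annihilation \<sigma> f F) i x"
    by (simp add: K_formula_def smeared_annihilation_def point_annihilation_def)
  finally show ?thesis .
qed

abbreviation "smeared_omega f F \<equiv> (\<lambda>n x. smeared_creation f (\<lambda>t. F) n x
         + smeared_creation (\<lambda>t. f t * lam t) (\<lambda>t. point_annihilation t F) n x
         + smeared_annihilation \<sigma> f F n x
         + smeared_creation (\<lambda>t. f t * \<eta> t)
             (\<lambda>t. point_annihilation t (point_annihilation t F)) n x)"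

lemma smeared_omega_B0_fin:
  assumes f: "f \<in> B0_functions" and F: "F \<in> B0_fin N"
  shows "smeared_omega f F \<in> B0_fin (Suc N)"
  using B0_functions_mult_continuous[OF f continuous_lam] B0_functions_mult_continuous[OF f continuous_eta] f F
  by (intro B0_fin_add smeared_creation_B0_fin) (auto intro!: B0_fin_mono[of _ N "Suc N"]
      smeared_number_B0_fin smeared_annihilation_B0_fin smeared_double_annihilation_B0_fin)

text \<open>The identity holds at every tuple whose first coordinate satisfies the recurrence. The bound
  \<open>Suc N\<close> accommodates the degree of the created terms.\<close>

lemma K_formula_field:
  assumes F: "F \<in> B0_fin N" and f: "f \<in> B0_functions" and x: "x \<in> PiE {..<i} (\<lambda>_. UNIV)"
    and rec: "\<And>n. 0 < i \<Longrightarrow> snd (x 0) * poly (p n (fst (x 0))) (snd (x 0)) =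
      poly (p (Suc n) (fst (x 0))) (snd (x 0)) + lam (fst (x 0)) * poly (p n (fst (x 0))) (snd (x 0)) +
      (case n of 0 \<Rightarrow> 0 | Suc k \<Rightarrow> \<eta> (fst (x 0)) * poly (p k (fst (x 0))) (snd (x 0)))"
  shows "X_op \<rho> f (K_formula p (Suc N) F) i x = K_formula p (Suc N) (smeared_omega f F) i x"
proof -
  let ?K = "\<lambda>F. K_formula p (Suc N) F i x"
  have split: "?K (smeared_omega f F) = ?K (smeared_creation f (\<lambda>t. F))
      + ?K (smeared_creation (\<lambda>t. f t * lam t) (\<lambda>t. point_annihilation t F))
      + ?K (smeared_annihilation \<sigma> f F)
      + ?K (smeared_creation (\<lambda>t. f t * \<eta> t) (\<lambda>t. point_annihilation t (point_annihilation t F)))"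
    by (simp add: K_formula_def sum.distrib algebra_simps)
  note minus = K_formula_annihilation_part[OF f F x]
  show ?thesis
  proof (cases i)
    case 0
    then show ?thesis unfolding split
      using minus by (simp add: X_op_def a_plus_def a_zero_def K_formula_0 smeared_creation_def)
  next
    case (Suc k)
    let ?t = "fst (x 0)" and ?s = "snd (x 0)"
    let ?q = "\<lambda>l. poly (p l ?t) ?s"
    define Y where "Y l = K_formula p (Suc N) (((point_annihilation ?t) ^^ l) F) k (tuple_tail k x)" for l
    have van: "vanishes_above N F" using F by (simp add: B0_fin_def)
    have Y: "Y l = 0" if "Suc N \<le> l" for l
    proof -
      have "K_formula p (Suc N) (((point_annihilation ?t) ^^ l) F) k (tuple_tail k x) =
          K_formula p (Suc N) (\<lambda>_ _. 0) k (tuple_tail k x)"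
        using that by (intro K_formula_cong) (simp_all add: annihilation_iterate_vanishes[OF van])
      then show ?thesis by (simp add: Y_def K_formula_def)
    qed
    have rec': "?s * ?q l = ?q (Suc l) + lam ?t * ?q l + (case l of 0 \<Rightarrow> 0 | Suc k \<Rightarrow> \<eta> ?t * ?q k)" for l
      by (rule rec) (simp add: Suc)
    have A: "((point_annihilation ?t) ^^ l) (point_annihilation ?t F) = ((point_annihilation ?t) ^^ Suc l) F" for l
      by (simp only: funpow_Suc_right comp_def)
    have AA: "((point_annihilation ?t) ^^ l) (point_annihilation ?t (point_annihilation ?t F)) =
        ((point_annihilation ?t) ^^ Suc (Suc l)) F" for l
      by (simp only: funpow_Suc_right comp_def)
    have c1: "?K (smeared_creation f (\<lambda>t. F)) = f ?t * (\<Sum>l<Suc N. ?q l * Y l)"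
      unfolding Suc K_formula_smeared_creation Y_def by (simp only: sum_distrib_left mult_ac)
    have c2: "?K (smeared_creation (\<lambda>t. f t * lam t) (\<lambda>t. point_annihilation t F)) =
        f ?t * (lam ?t * (\<Sum>l<Suc N. ?q l * Y (Suc l)))"
      unfolding Suc K_formula_smeared_creation Y_def A by (simp only: sum_distrib_left mult_ac)
    have c3: "?K (smeared_creation (\<lambda>t. f t * \<eta> t) (\<lambda>t. point_annihilation t (point_annihilation t F))) =
        f ?t * (\<eta> ?t * (\<Sum>l<Suc N. ?q l * Y (Suc (Suc l))))"
      unfolding Suc K_formula_smeared_creation Y_def AA by (simp only: sum_distrib_left mult_ac)
    have plus: "a_plus (\<lambda>(t, s). f t) (K_formula p (Suc N) F) i x = f ?t * (?q 0 * Y 0)"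
      by (simp add: a_plus_def Suc Y_def p_0 case_prod_beta)
    have zero: "a_zero (\<lambda>(t, s). f t * s) (K_formula p (Suc N) F) i x =
        f ?t * (?s * (\<Sum>l<Suc N. ?q l * Y (Suc l)))"
      unfolding a_zero_def Suc nat.case(2) K_formula_Suc Y_def by (simp only: case_prod_beta mult.assoc)
    have "X_op \<rho> f (K_formula p (Suc N) F) i x =
        f ?t * (?q 0 * Y 0 + ?s * (\<Sum>l<Suc N. ?q l * Y (Suc l))) + ?K (smeared_annihilation \<sigma> f F)"
      unfolding X_op_def minus plus zero by (simp only: distrib_left add_ac)
    also have "\<dots> = ?K (smeared_omega f F)"
    proof -
      have "?q 0 * Y 0 + ?s * (\<Sum>l<Suc N. ?q l * Y (Suc l)) =
          (\<Sum>l<Suc N. ?q l * Y l) + lam ?t * (\<Sum>l<Suc N. ?q l * Y (Suc l))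
          + \<eta> ?t * (\<Sum>l<Suc N. ?q l * Y (Suc (Suc l)))"
        by (rule sum_recurrence_shift[where q = ?q]) (rule rec', rule Y)
      then show ?thesis unfolding split c1 c2 c3 by (simp only: distrib_left add_ac)
    qed
    finally show ?thesis .
  qed
qed

lemma K_formula_field_AE:
  assumes F: "F \<in> B0_fin N" and f: "f \<in> B0_functions"
  shows "AE x in \<Phi> i. X_op \<rho> f (K_formula p (Suc N) F) i x = K_formula p (Suc N) (smeared_omega f F) i x"
proof (cases i)
  case 0
  then show ?thesis by (intro AE_I2 K_formula_field[OF F f]) (auto simp: space_Phi)
next
  case (Suc k)
  let ?R = "\<lambda>n z. snd z * poly (p n (fst z)) (snd z) = poly (p (Suc n) (fst z)) (snd z) +
    lam (fst z) * poly (p n (fst z)) (snd z) +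
    (case n of 0 \<Rightarrow> 0 | Suc k \<Rightarrow> \<eta> (fst z) * poly (p k (fst z)) (snd z))"
  have "AE x in PiM {..<Suc k} (\<lambda>_. \<rho>). ?R n (x 0)" for n
  proof (subst AE_PiM_Suc_iff[OF rho.sigma_finite_measure_axioms])
    have "Measurable.pred \<rho> (?R n)" by (cases n) simp_all
    then show "{x \<in> space (PiM {..<Suc k} (\<lambda>_. \<rho>)). ?R n (x 0)} \<in> sets (PiM {..<Suc k} (\<lambda>_. \<rho>))"
      unfolding pred_def[symmetric] by (rule measurable_compose[OF measurable_tuple_head, where g = "?R n"])
    show "AE x in PiM {..<k} (\<lambda>_. \<rho>). AE z in \<rho>. ?R n (tuple_cons k z x 0)"
      unfolding tuple_cons_0 using AE_recurrence[of n] by simp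
  qed
  then have "AE x in \<Phi> i. \<forall>n. ?R n (x 0)"
    unfolding full_fock_def Suc by (subst AE_all_countable) blast
  moreover have "AE x in \<Phi> i. x \<in> PiE {..<i} (\<lambda>_. UNIV)"
    by (intro AE_I2) (simp add: space_Phi)
  ultimately show ?thesis
    by eventually_elim (rule K_formula_field[OF F f]; blast)
qed

text \<open>The field operator does not depend on the choice of representatives; for the annihilation part
  this is Fubini's theorem.\<close>

lemma
  assumes f: "f \<in> B0_functions" and G: "\<And>n. G n \<in> borel_measurable (\<Phi> n)"
  shows X_op_measurable: "X_op \<rho> f G n \<in> borel_measurable (\<Phi> n)"
    and X_op_AE_cong: "\<lbrakk>\<And>n. G' n \<in> borel_measurable (\<Phi> n); \<And>n. AE x in \<Phi> n. G n x = G' n x\<rbrakk> \<Longrightarrow>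
      AE x in \<Phi> n. X_op \<rho> f G n x = X_op \<rho> f G' n x"
proof -
  have [measurable]: "f \<in> borel_measurable borel" using f by (simp add: B0_functions_def)
  have h: "(\<lambda>(t, s). f t) \<in> borel_measurable \<rho>" "(\<lambda>(t, s). f t * s) \<in> borel_measurable \<rho>"
    by measurable
  let ?P = "\<lambda>n. PiM {..<n} (\<lambda>_. \<rho>)"
  have head: "(\<lambda>x. x 0) \<in> ?P (Suc k) \<rightarrow>\<^sub>M \<rho>" for k
    by (rule measurable_tuple_head)
  have tail: "tuple_tail k \<in> ?P (Suc k) \<rightarrow>\<^sub>M ?P k" for k
    by (rule measurable_tuple_tail[OF measurable_ident[unfolded id_def]])
  have cons: "(\<lambda>z. tuple_cons k (snd z) (fst z)) \<in> ?P k \<Otimes>\<^sub>M \<rho> \<rightarrow>\<^sub>M ?P (Suc k)" for k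
    by (intro measurable_tuple_cons) measurable
  have G: "G n \<in> borel_measurable (?P n)" for n using G by (simp add: full_fock_def)
  have "a_plus (\<lambda>(t, s). f t) G n \<in> borel_measurable (?P n)"
  proof (cases n)
    case (Suc k)
    show ?thesis unfolding a_plus_def Suc nat.case(2)
      by (intro borel_measurable_times measurable_compose[OF head h(1)] measurable_compose[OF tail G])
  qed (simp add: a_plus_def)
  moreover have "a_zero (\<lambda>(t, s). f t * s) G n \<in> borel_measurable (?P n)"
  proof (cases n)
    case (Suc k)
    show ?thesis unfolding a_zero_def Suc nat.case(2)
      by (intro borel_measurable_times measurable_compose[OF head h(2)] G)
  qed (simp add: a_zero_def)
  moreover have "a_minus \<rho> (\<lambda>(t, s). f t) G n \<in> borel_measurable (?P n)"
  proof -
    have "(\<lambda>z. (\<lambda>(t, s). f t) (snd z) * G (Suc n) (tuple_cons n (snd z) (fst z))) \<in> borel_measurable (?P n \<Otimes>\<^sub>M \<rho>)"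
      by (intro borel_measurable_times measurable_compose[OF measurable_snd h(1)] measurable_compose[OF cons G])
    then show ?thesis unfolding a_minus_def
      by (intro rho.borel_measurable_lebesgue_integral) (simp add: case_prod_beta')
  qed
  ultimately show "X_op \<rho> f G n \<in> borel_measurable (\<Phi> n)"
    unfolding X_op_def full_fock_def by (intro borel_measurable_add)
  assume G': "\<And>n. G' n \<in> borel_measurable (\<Phi> n)" and ae: "\<And>n. AE x in \<Phi> n. G n x = G' n x"
  have G': "G' n \<in> borel_measurable (?P n)" for n using G'[of n] by (simp only: full_fock_def)
  have ae: "AE x in ?P n. G n x = G' n x" for n using ae[of n] by (simp only: full_fock_def)
  have "AE x in ?P n. a_plus (\<lambda>(t, s). f t) G n x = a_plus (\<lambda>(t, s). f t) G' n x"
  proof (cases n)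
    case (Suc k)
    have "AE x in ?P (Suc k). G k (tuple_tail k x) = G' k (tuple_tail k x)"
    proof (subst AE_PiM_Suc_iff[OF rho.sigma_finite_measure_axioms])
      show "{x \<in> space (?P (Suc k)). G k (tuple_tail k x) = G' k (tuple_tail k x)} \<in> sets (?P (Suc k))"
        by (intro borel_measurable_eq measurable_compose[OF tail G] measurable_compose[OF tail G'])
      have "AE x in ?P k. x \<in> PiE {..<k} (\<lambda>_. UNIV)"
        by (intro AE_I2) (simp add: space_PiM space_rho)
      with ae[of k] show "AE x in ?P k. AE z in \<rho>. G k (tuple_tail k (tuple_cons k z x)) = G' k (tuple_tail k (tuple_cons k z x))"
        by eventually_elim simp
    qed
    then show ?thesis unfolding a_plus_def Suc nat.case(2) by eventually_elim simp
  qed (simp add: a_plus_def)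
  moreover have "AE x in ?P n. a_zero (\<lambda>(t, s). f t * s) G n x = a_zero (\<lambda>(t, s). f t * s) G' n x"
    using ae[of n] by eventually_elim (auto simp: a_zero_def split: nat.split)
  moreover have "AE x in ?P n. a_minus \<rho> (\<lambda>(t, s). f t) G n x = a_minus \<rho> (\<lambda>(t, s). f t) G' n x"
  proof -
    have "{x \<in> space (?P (Suc n)). G (Suc n) x = G' (Suc n) x} \<in> sets (?P (Suc n))"
      by (intro borel_measurable_eq G G')
    then have "AE x in ?P n. AE z in \<rho>. G (Suc n) (tuple_cons n z x) = G' (Suc n) (tuple_cons n z x)"
      using ae[of "Suc n"]
      by (subst AE_PiM_Suc_iff[OF rho.sigma_finite_measure_axioms, symmetric])
    moreover have "AE x in ?P n. x \<in> space (?P n)" by (rule AE_space)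
    ultimately show ?thesis
    proof eventually_elim
      case (elim x)
      have c: "(\<lambda>z. tuple_cons n z x) \<in> \<rho> \<rightarrow>\<^sub>M ?P (Suc n)"
        by (intro measurable_tuple_cons measurable_ident[unfolded id_def] measurable_const elim)
      show ?case unfolding a_minus_def
      proof (rule integral_cong_AE)
        show "(\<lambda>y. (\<lambda>(t, s). f t) y * G (Suc n) (tuple_cons n y x)) \<in> borel_measurable \<rho>"
          by (intro borel_measurable_times h(1) measurable_compose[OF c G])
        show "(\<lambda>y. (\<lambda>(t, s). f t) y * G' (Suc n) (tuple_cons n y x)) \<in> borel_measurable \<rho>"
          by (intro borel_measurable_times h(1) measurable_compose[OF c G'])
        show "AE y in \<rho>. (\<lambda>(t, s). f t) y * G (Suc n) (tuple_cons n y x) =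
            (\<lambda>(t, s). f t) y * G' (Suc n) (tuple_cons n y x)"
          using elim(1) by eventually_elim simp
      qed
    qed
  qed
  ultimately show "AE x in \<Phi> n. X_op \<rho> f G n x = X_op \<rho> f G' n x"
    unfolding X_op_def full_fock_def by eventually_elim simp
qed

text \<open>Both sides have the same image under \<open>K\<close>. As \<open>K\<close> yields arbitrary representatives, the explicit
  formula has to be exchanged for them under the field operator.\<close>

lemma hs_inv_X_op:
  assumes f: "f \<in> B0_functions" and F: "F \<in> B0_fin N"
  shows "hs_eq \<Gamma> (hs_inv \<Gamma> \<Phi> K (X_op \<rho> f (K F))) (smeared_omega f F)"
proof (rule hs_inv_eqI[OF K_unitary])
  let ?M = "Suc N"
  have F': "F \<in> B0_fin ?M" using B0_fin_mono[OF F] by simp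
  note R = smeared_omega_B0_fin[OF f F]
  note KF = K_B0_fin(2)[OF F'] and KR = K_B0_fin(2)[OF R]
  show "smeared_omega f F \<in> hs \<Gamma>" by (rule K_B0_fin(1)[OF R])
  from KF have hsF: "K F \<in> hs \<Phi>" "K_formula p ?M F \<in> hs \<Phi>"
    and aeF: "\<And>n. AE x in \<Phi> n. K F n x = K_formula p ?M F n x"
    by (auto simp: hs_eq_def)
  show "hs_eq \<Phi> (K (smeared_omega f F)) (X_op \<rho> f (K F))"
  proof (rule hs_cong_AE)
    show "K (smeared_omega f F) \<in> hs \<Phi>" using KR by (simp add: hs_eq_def)
    show "X_op \<rho> f (K F) n \<in> borel_measurable (\<Phi> n)" for n
      by (rule X_op_measurable[OF f hsD(1)[OF hsF(1)]])
    fix n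
    have "AE x in \<Phi> n. K (smeared_omega f F) n x = K_formula p ?M (smeared_omega f F) n x"
      using KR by (simp add: hs_eq_def)
    moreover have "AE x in \<Phi> n. X_op \<rho> f (K F) n x = X_op \<rho> f (K_formula p ?M F) n x"
      by (rule X_op_AE_cong[OF f hsD(1)[OF hsF(1)] hsD(1)[OF hsF(2)] aeF])
    moreover note K_formula_field_AE[OF F f, of n]
    ultimately show "AE x in \<Phi> n. K (smeared_omega f F) n x = X_op \<rho> f (K F) n x"
      by eventually_elim simp
  qed
qed

end

theorem corollary4p2:
  fixes \<sigma> :: "'a::{second_countable_topology, t2_space, perfect_space} measure"
    and \<mu> :: "'a \<Rightarrow> real measure"
    and p :: "nat \<Rightarrow> 'a \<Rightarrow> real poly"
    and a b :: "nat \<Rightarrow> 'a \<Rightarrow> real"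
    and K :: "'a fock \<Rightarrow> ('a \<times> real) fock"
    and lam \<eta> :: "'a \<Rightarrow> real"
    and f :: "'a \<Rightarrow> real"
    and F :: "'a fock"
  assumes "locally_compact_space (euclidean :: 'a topology)"
    and "radon_measure \<sigma>"
    and "non_atomic \<sigma>"
    and "\<And>U. open U \<Longrightarrow> U \<noteq> {} \<Longrightarrow> 0 < emeasure \<sigma> U"
    and "\<mu> \<in> borel \<rightarrow>\<^sub>M prob_algebra borel"
    and "\<And>D. D \<in> B0_sets \<Longrightarrow> \<exists>R>0. \<forall>t\<in>D. AE s in \<mu> t. s \<in> {-R..R}"
    and "\<And>t. monic_orthogonal (\<mu> t) (\<lambda>n. p n t)"
    and "\<And>t. jacobi_coefficients (\<mu> t) (\<lambda>n. p n t) (\<lambda>n. a n t) (\<lambda>n. b n t)"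
    and "is_K \<sigma> \<mu> p K"
    and "continuous_on UNIV lam"
    and "continuous_on UNIV \<eta>"
    and "\<And>t. 0 \<le> \<eta> t"
    and "\<And>l t. b l t = lam t"
    and "\<And>l t. 1 \<le> l \<Longrightarrow> a l t = \<eta> t"
    and "f \<in> B0_functions"
    and "F \<in> F_fin"
  shows "hs_eq (gamma \<sigma> \<mu> p)
    (hs_inv (gamma \<sigma> \<mu> p) (full_fock (sigma_tilde \<sigma> \<mu>)) K (X_op (sigma_tilde \<sigma> \<mu>) f (K F)))
    (\<lambda>n x. smeared_creation f (\<lambda>t. F) n x
         + smeared_creation (\<lambda>t. f t * lam t) (\<lambda>t. point_annihilation t F) n x
         + smeared_annihilation \<sigma> f F n x
         + smeared_creation (\<lambda>t. f t * \<eta> t)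
             (\<lambda>t. point_annihilation t (point_annihilation t F)) n x)"
proof -
  have "\<exists>R. constant_jacobi (\<mu> t) (\<lambda>n. p n t) (lam t) (\<eta> t) R" for t
  proof -
    have "\<mu> t \<in> space (prob_algebra borel)"
      using measurable_space[OF assms(5), of t] by simp
    then have prob: "prob_space (\<mu> t)" and sets: "sets (\<mu> t) = sets borel"
      by (auto simp: space_prob_algebra)
    have "{t} \<in> B0_sets" by (simp add: B0_sets_def)
    then obtain R where "AE s in \<mu> t. s \<in> {-R..R}" using assms(6) by blast
    then have R: "AE s in \<mu> t. \<bar>s\<bar> \<le> R" by eventually_elim (simp add: abs_le_iff)
    note J = assms(8)[of t, unfolded jacobi_coefficients_def]
    have "constant_jacobi (\<mu> t) (\<lambda>n. p n t) (lam t) (\<eta> t) R"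
    proof (intro constant_jacobi.intro constant_jacobi_axioms.intro prob sets R assms(7))
      fix n
      from J have "AE s in \<mu> t. s * poly (p n t) s = poly (p (Suc n) t) s + b n t * poly (p n t) s +
          (case n of 0 \<Rightarrow> 0 | Suc k \<Rightarrow> a n t * poly (p k t) s)" by blast
      then show "AE s in \<mu> t. s * poly (p n t) s = poly (p (Suc n) t) s + lam t * poly (p n t) s +
          (case n of 0 \<Rightarrow> 0 | Suc k \<Rightarrow> \<eta> t * poly (p k t) s)"
        by (cases n) (simp_all add: assms(13,14))
    next
      fix N n assume "supported_on_exactly (\<mu> t) N" "N \<le> Suc n"
      with J have "a (Suc n) t = 0" by blast
      then show "\<eta> t = 0" by (simp add: assms(14))
    qed
    then show ?thesis ..
  qed
  then interpret jacobi_field_K \<sigma> \<mu> p lam \<eta> K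
    by (intro jacobi_field_K.intro jacobi_field.intro jacobi_field_K_axioms.intro assms)
  obtain N where "F \<in> B0_fin N" using F_fin_subset_B0_fin[OF assms(16)] .
  from hs_inv_X_op[OF assms(15) this] show ?thesis .
qed

end
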